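(* Let $p$ be an odd prime. Let $L$ be a non-split link which admits non-trivial $p$-colorings. Then $$\mathrm{Spec}_p L = \{ \mathrm{mincol}_p L,\ 1+\mathrm{mincol}_p L,\ 2+\mathrm{mincol}_p L,\ \dots,\ \mathrm{maxcol}_p L \}.$$
   Context: Links are classical links in $3$-space. A split link is a link which can be made (by isotopy) to be contained in two disjoint balls in $3$-space, with part of the link in each ball; a non-split link is a link which is not split. For an integer $p>1$ and a diagram $D$ of a link $L$, a $p$-coloring of $D$ is an assignment of integers modulo $p$ (called colors) to the arcs of $D$ such that at each crossing, twice the color of the over-arc equals the sum of the colors of the two under-arcs, modulo $p$. A $p$-coloring is trivial if all arcs of the diagram receive the same color, and non-trivial if it uses more than one color. Whether a link admits non-trivial $p$-colorings does not depend on the diagram. Suppose $L$ admits non-trivial $p$-colorings. $\mathrm{mincol}_p L$ (respectively $\mathrm{maxcol}_p L$) is the minimum (respectively maximum) number of distinct colors used in a non-trivial $p$-coloring of a diagram of $L$, taken over all diagrams of $L$ and all their non-trivial $p$-colorings. The spectrum of $L$ mod $p$ is $\mathrm{Spec}_p L := \{ n\in \mathbf{Z}^+ \mid \text{there is a diagram } D \text{ of } L \text{ with a non-trivial } p\text{-coloring which uses (exactly) } n \text{ colors}\}$. *)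

theory Defs
  imports "HOL-Analysis.Analysis" "HOL-Number_Theory.Number_Theory"
begin

text \<open>Links are unoriented and tame: a link is a subset of 3-space that some ambient isotopy carries
  to a polygonal link.\<close>

definition polygonal_link :: "(real^3) set \<Rightarrow> bool" where
  "polygonal_link K \<longleftrightarrow>
     (\<exists>\<C>. finite \<C> \<and> \<C> \<noteq> {} \<and> pairwise disjnt \<C> \<and> K = \<Union>\<C> \<and>
        (\<forall>C\<in>\<C>. \<exists>g. simple_path g \<and> pathfinish g = pathstart g \<and> C = path_image g)) \<and>
     (\<exists>E. finite E \<and> K = (\<Union>(a, b)\<in>E. closed_segment a b))"

definition isotopic :: "(real^3) set \<Rightarrow> (real^3) set \<Rightarrow> bool" where
  "isotopic K K' \<longleftrightarrow>
     (\<exists>H :: real \<Rightarrow> real^3 \<Rightarrow> real^3.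
        continuous_on ({0..1} \<times> UNIV) (\<lambda>(t, x). H t x) \<and>
        (\<forall>t\<in>{0..1}. \<exists>g. homeomorphism UNIV UNIV (H t) g) \<and>
        (\<forall>x. H 0 x = x) \<and> H 1 ` K = K')"

definition is_link :: "(real^3) set \<Rightarrow> bool" where
  "is_link L \<longleftrightarrow> (\<exists>K. polygonal_link K \<and> isotopic L K)"

definition split_link :: "(real^3) set \<Rightarrow> bool" where
  "split_link L \<longleftrightarrow> is_link L \<and>
     (\<exists>L' a r b s. isotopic L L' \<and> disjnt (cball a r) (cball b s) \<and>
        L' \<subseteq> cball a r \<union> cball b s \<and> L' \<inter> cball a r \<noteq> {} \<and> L' \<inter> cball b s \<noteq> {})"

text \<open>Diagrams are drawn in the plane of the first two coordinates; the third coordinate is the height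
  that decides which strand of a crossing is the over-strand. A diagram is represented by a polygonal
  link in regular position, and stands for the planar projection of that link together with the
  over/under information at the double points.\<close>

definition plane_proj :: "real^3 \<Rightarrow> real^2" where
  "plane_proj x = vector [x $ 1, x $ 2]"

definition straight_at :: "(real^3) set \<Rightarrow> real^3 \<Rightarrow> real^3 \<Rightarrow> bool" where
  "straight_at K x d \<longleftrightarrow>
     d \<noteq> 0 \<and> (\<exists>e>0. K \<inter> ball x e = range (\<lambda>t. x + t *\<^sub>R d) \<inter> ball x e)"

definition crossing :: "(real^3) set \<Rightarrow> real^3 \<Rightarrow> real^3 \<Rightarrow> bool" where
  \<comment> \<open>\<open>u\<close> lies on the under-strand and \<open>v\<close> on the over-strand\<close>
  "crossing K u v \<longleftrightarrow> u \<in> K \<and> v \<in> K \<and> plane_proj u = plane_proj v \<and> u $ 3 < v $ 3"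

text \<open>Regular position: finitely many multiple points, all of them double, none of them the image of a
  vertex of the polygonal link, and all of them transverse.\<close>

definition regular_position :: "(real^3) set \<Rightarrow> bool" where
  "regular_position K \<longleftrightarrow>
     finite {(u, v). crossing K u v} \<and>
     (\<forall>x. card {y \<in> K. plane_proj y = x} \<le> 2 \<and> finite {y \<in> K. plane_proj y = x}) \<and>
     (\<forall>u v. crossing K u v \<longrightarrow>
        (\<exists>d d'. straight_at K u d \<and> straight_at K v d' \<and>
           plane_proj d \<noteq> plane_proj d' \<and> independent {plane_proj d, plane_proj d'}))"

definition is_diagram :: "(real^3) set \<Rightarrow> bool" where
  "is_diagram D \<longleftrightarrow> polygonal_link D \<and> regular_position D"

definition diagram_of :: "(real^3) set \<Rightarrow> (real^3) set \<Rightarrow> bool" where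
  "diagram_of L D \<longleftrightarrow> is_diagram D \<and> isotopic L D"

text \<open>The arcs of a diagram are what remains of the link, up to connectedness, when it is cut at all
  under-crossing points. A component of the link that never passes under is a single closed arc.\<close>

definition cut_diagram :: "(real^3) set \<Rightarrow> (real^3) set" where
  "cut_diagram D = D - {u. \<exists>v. crossing D u v}"

definition arcs :: "(real^3) set \<Rightarrow> (real^3) set set" where
  "arcs D = components (cut_diagram D)"

definition arc_at :: "(real^3) set \<Rightarrow> real^3 \<Rightarrow> (real^3) set" where
  "arc_at D x = connected_component_set (cut_diagram D) x"

text \<open>Integers modulo \<open>p\<close> are represented by \<open>0, \<dots>, p - 1\<close>. At an under-crossing
  point \<open>u\<close> the two under-arcs are those met immediately on either side of \<open>u\<close> along the
  under-strand; they may be the same arc, which then counts twice.\<close>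

definition coloring :: "nat \<Rightarrow> (real^3) set \<Rightarrow> ((real^3) set \<Rightarrow> int) \<Rightarrow> bool" where
  "coloring p D c \<longleftrightarrow>
     (\<forall>A\<in>arcs D. c A \<in> {0..<int p}) \<and>
     (\<forall>u v d. crossing D u v \<and> straight_at D u d \<longrightarrow>
        (\<forall>\<^sub>F t in at_right 0.
           [2 * c (arc_at D v) = c (arc_at D (u + t *\<^sub>R d)) + c (arc_at D (u - t *\<^sub>R d))]
             (mod int p)))"

definition num_colors :: "(real^3) set \<Rightarrow> ((real^3) set \<Rightarrow> int) \<Rightarrow> nat" where
  "num_colors D c = card (c ` arcs D)"

definition nontrivial_coloring :: "nat \<Rightarrow> (real^3) set \<Rightarrow> ((real^3) set \<Rightarrow> int) \<Rightarrow> bool" where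
  "nontrivial_coloring p D c \<longleftrightarrow> coloring p D c \<and> num_colors D c > 1"

definition admits_nontrivial_colorings :: "nat \<Rightarrow> (real^3) set \<Rightarrow> bool" where
  "admits_nontrivial_colorings p L \<longleftrightarrow> (\<exists>D c. diagram_of L D \<and> nontrivial_coloring p D c)"

definition mincol :: "nat \<Rightarrow> (real^3) set \<Rightarrow> nat" where
  "mincol p L = Min {num_colors D c | D c. diagram_of L D \<and> nontrivial_coloring p D c}"

definition maxcol :: "nat \<Rightarrow> (real^3) set \<Rightarrow> nat" where
  "maxcol p L = Max {num_colors D c | D c. diagram_of L D \<and> nontrivial_coloring p D c}"

definition Spec :: "nat \<Rightarrow> (real^3) set \<Rightarrow> nat set" where
  "Spec p L =
     {n. n > 0 \<and> (\<exists>D c. diagram_of L D \<and> nontrivial_coloring p D c \<and> num_colors D c = n)}"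

end

theory Submission imports Defs begin

text \<open>A coloring modulo \<open>p\<close> uses at most \<open>p\<close> colors. Hence the spectrum is finite, and it is an
  interval as soon as every non-trivial coloring with \<open>n < p\<close> colors gives rise to one with exactly
  \<open>n + 1\<close> colors on another diagram of the same link (\<open>one_more_color\<close>).

  Let \<open>S\<close> be the set of the \<open>n\<close> colors in use. If \<open>S\<close> were closed under
  \<open>(s, t) \<mapsto> 2 s - t\<close>, it would contain a whole arithmetic progression and therefore,
  \<open>p\<close> being prime, every residue (\<open>closed_under_reflection_imp_all\<close>). So there are
  \<open>s, t \<in> S\<close> with \<open>2 s - t \<notin> S\<close>. Pull a finger of an arc of color
  \<open>s\<close> over the diagram, straight towards an arc of color \<open>t\<close>. Whatever has color
  \<open>q\<close> changes to \<open>2 s - q\<close> under the finger and keeps its color elsewhere. The finger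
  stops right after the first strand whose reflected color is not in \<open>S\<close>. Then exactly one color has
  been added, and none is lost because the finger is thin (\<open>finger_towards_point\<close>).

  Three devices keep the argument elementary. First, the finger is produced by a single shear \<open>z \<mapsto> z +
  f(z) w\<close> with a tent function \<open>f\<close> that is invariant under translation by \<open>w\<close>. The
  direction \<open>w\<close> is steep, so the finger passes over everything else, and shears are evidently isotopic
  to the identity. Second, a coloring is treated as a locally constant function on the cut diagram. The new coloring
  is then a formula: reflect the old one over the triangle covered by the finger. The strands that the finger passes
  never have to be enumerated. Third, general position is obtained from a finite set of bad points and a finite set
  of bad directions (\<open>generic_data\<close>), which exclude only finitely many choices for each parameter. One
  degenerate position cannot be removed in this way, namely that the starting point lies on the projected line of
  the strand to be reached. It is dealt with by a first, very short finger (\<open>bend_off_line\<close>).\<close>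

section \<open>Isotopy and polygonal links\<close>

lemma isotopicE:
  assumes "isotopic K L"
  obtains H :: "real \<Rightarrow> real^3 \<Rightarrow> real^3" where "continuous_on ({0..1} \<times> UNIV) (\<lambda>(t, x). H t x)"
    "\<And>t. t \<in> {0..1} \<Longrightarrow> \<exists>g. homeomorphism UNIV UNIV (H t) g" "\<And>x. H 0 x = x" "H 1 ` K = L"
  using assms unfolding isotopic_def by blast

lemma isotopic_trans:
  assumes "isotopic K L" "isotopic L M"
  shows "isotopic K M"
proof -
  obtain F :: "real \<Rightarrow> real^3 \<Rightarrow> real^3" where F: "continuous_on ({0..1} \<times> UNIV) (\<lambda>(t, x). F t x)"
    "\<And>t. t \<in> {0..1} \<Longrightarrow> \<exists>g. homeomorphism UNIV UNIV (F t) g" "\<And>x. F 0 x = x" "F 1 ` K = L"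
    using isotopicE[OF assms(1)] by blast
  obtain G :: "real \<Rightarrow> real^3 \<Rightarrow> real^3" where G: "continuous_on ({0..1} \<times> UNIV) (\<lambda>(t, x). G t x)"
    "\<And>t. t \<in> {0..1} \<Longrightarrow> \<exists>g. homeomorphism UNIV UNIV (G t) g" "\<And>x. G 0 x = x" "G 1 ` L = M"
    using isotopicE[OF assms(2)] by blast
  define H where "H t x = (if t \<le> 1/2 then F (2*t) x else G (2*t-1) (F 1 x))" for t :: real and x
  have F1: "continuous_on UNIV (F 1)"
    using F(2)[of 1] by (auto simp: homeomorphism_def)
  have cF: "continuous_on ({0..1/2} \<times> UNIV) (\<lambda>z. F (2 * fst z) (snd z))"
  proof -
    have "continuous_on ({0..1/2} \<times> UNIV)
        (\<lambda>z::real \<times> (real^3). (\<lambda>(t, x). F t x) ((\<lambda>z. (2 * fst z, snd z)) z))"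
      by (rule continuous_on_compose2[OF F(1)]) (auto intro!: continuous_intros)
    then show ?thesis by simp
  qed
  have cG: "continuous_on ({1/2..1} \<times> UNIV) (\<lambda>z. G (2 * fst z - 1) (F 1 (snd z)))"
  proof -
    have "continuous_on ({1/2..1} \<times> UNIV) (\<lambda>z::real \<times> (real^3). F 1 (snd z))"
      by (rule continuous_on_compose2[OF F1]) (auto intro!: continuous_intros)
    then have "continuous_on ({1/2..1} \<times> UNIV)
        (\<lambda>z::real \<times> (real^3). (\<lambda>(t, x). G t x) ((\<lambda>z. (2 * fst z - 1, F 1 (snd z))) z))"
      by (intro continuous_on_compose2[OF G(1)]) (auto intro!: continuous_intros)
    then show ?thesis by simp
  qed
  have un: "{0..1::real} \<times> (UNIV :: (real^3) set) = {0..1/2} \<times> UNIV \<union> {1/2..1} \<times> UNIV"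
    by auto
  have "continuous_on ({0..1/2} \<times> UNIV \<union> {1/2..1} \<times> UNIV)
      (\<lambda>z::real \<times> (real^3). if fst z \<le> 1/2 then F (2 * fst z) (snd z) else G (2 * fst z - 1) (F 1 (snd z)))"
  proof (rule continuous_on_cases[OF _ _ cF cG])
    have "F (2 * s) y = G (2 * s - 1) (F 1 y)" if "s = 1/2" for s y unfolding that by (simp add: G(3))
    then show "\<forall>z. (z \<in> {0..1/2} \<times> UNIV \<and> \<not> fst z \<le> 1/2) \<or> (z \<in> {1/2..1} \<times> UNIV \<and> fst z \<le> 1/2) \<longrightarrow>
        F (2 * fst z) (snd z) = G (2 * fst z - 1) (F 1 (snd z))"
      by fastforce
  qed (auto intro!: closed_Times)
  then have "continuous_on ({0..1} \<times> UNIV) (\<lambda>(t, x). H t x)"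
    unfolding un H_def by (simp add: case_prod_beta)
  moreover have "\<exists>g. homeomorphism UNIV UNIV (H t) g" if t: "t \<in> {0..1}" for t
  proof (cases "t \<le> 1/2")
    case True
    then have "H t = F (2*t)" by (auto simp: H_def)
    then show ?thesis using F(2)[of "2*t"] t True by auto
  next
    case False
    then have "H t = G (2*t-1) \<circ> F 1" by (auto simp: H_def)
    moreover obtain f g where "homeomorphism UNIV UNIV (F 1) f" "homeomorphism UNIV UNIV (G (2*t-1)) g"
      using F(2)[of 1] G(2)[of "2*t-1"] t False by auto
    ultimately show ?thesis using homeomorphism_compose by metis
  qed
  moreover have "H 0 x = x" for x by (simp add: H_def F(3))
  moreover have "H 1 ` K = M" 
    using F(4) G(4) by (auto simp: H_def image_image)
  ultimately show ?thesis unfolding isotopic_def by blast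
qed

definition shear :: "(real^3 \<Rightarrow> real) \<Rightarrow> real^3 \<Rightarrow> real^3 \<Rightarrow> real^3" where
  "shear f w z = z + f z *\<^sub>R w"

lemma homeomorphism_shear:
  assumes cont: "continuous_on UNIV f" and inv: "\<And>z s. f (z + s *\<^sub>R w) = f z"
  shows "homeomorphism UNIV UNIV (shear f w) (shear (\<lambda>z. - f z) w)"
proof -
  have a: "shear (\<lambda>z. - f z) w (shear f w z) = z" for z
    unfolding shear_def by (simp only: inv) simp
  have b: "shear f w (shear (\<lambda>z. - f z) w z) = z" for z
    unfolding shear_def by (simp only: inv) simp
  show ?thesis
  proof (rule homeomorphismI)
    show "continuous_on UNIV (shear f w)" "continuous_on UNIV (shear (\<lambda>z. - f z) w)"
      unfolding shear_def by (intro continuous_intros cont)+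
  qed (auto simp: a b)
qed

text \<open>The displacement of a shear is constant along the lines on which it moves points, so every intermediate stage
  \<open>z + t f(z) w\<close> is undone by \<open>z - t f(z) w\<close> and is again a homeomorphism. This is the
  only source of isotopies below.\<close>
lemma isotopic_shear:
  assumes cont: "continuous_on UNIV f" and inv: "\<And>z s. f (z + s *\<^sub>R w) = f z"
  shows "isotopic K (shear f w ` K)"
proof -
  define H where "H t = shear (\<lambda>z. t * f z) w" for t
  have "continuous_on ({0..1} \<times> UNIV) (\<lambda>z. f (snd z))"
    by (rule continuous_on_compose2[OF cont]) (auto intro!: continuous_intros)
  then have "continuous_on ({0..1} \<times> UNIV) (\<lambda>(t, x). H t x)"
    by (auto simp: H_def shear_def case_prod_beta intro!: continuous_intros)
  moreover have "\<exists>g. homeomorphism UNIV UNIV (H t) g" for t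
    unfolding H_def by (rule exI, rule homeomorphism_shear) (auto intro!: continuous_intros cont simp: inv)
  moreover have "H 0 x = x" for x by (simp add: H_def shear_def)
  moreover have "H 1 ` K = shear f w ` K" by (simp add: H_def)
  ultimately show ?thesis unfolding isotopic_def by blast
qed

lemma polygonal_link_homeomorphic_image:
  assumes K: "polygonal_link K" and h: "homeomorphism UNIV UNIV h g"
    and E: "finite E" "h ` K = (\<Union>(a, b)\<in>E. closed_segment a b)"
  shows "polygonal_link (h ` K)"
proof -
  obtain \<C> where C: "finite \<C>" "\<C> \<noteq> {}" "pairwise disjnt \<C>" "K = \<Union>\<C>"
    "\<And>C. C \<in> \<C> \<Longrightarrow> \<exists>g. simple_path g \<and> pathfinish g = pathstart g \<and> C = path_image g"
    using K unfolding polygonal_link_def by metis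
  have cont: "continuous_on UNIV h" and inj: "inj h"
    using h by (auto simp: homeomorphism_def intro: inj_on_inverseI)
  define \<C>' where "\<C>' = (`) h ` \<C>"
  have "finite \<C>'" "\<C>' \<noteq> {}" "h ` K = \<Union>\<C>'"
    using C by (auto simp: \<C>'_def)
  moreover have "pairwise disjnt \<C>'"
    unfolding pairwise_def disjnt_def
  proof (intro ballI impI)
    fix X Y assume XY: "X \<in> \<C>'" "Y \<in> \<C>'" "X \<noteq> Y"
    then obtain A A' where A: "A \<in> \<C>" "A' \<in> \<C>" "X = h ` A" "Y = h ` A'" by (auto simp: \<C>'_def)
    then have "A \<noteq> A'" using XY by auto
    then have "A \<inter> A' = {}" using C(3) A unfolding pairwise_def disjnt_def by blast
    then show "X \<inter> Y = {}" using A(3,4) image_Int[OF inj, of A A'] by simp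
  qed
  moreover have "\<exists>g. simple_path g \<and> pathfinish g = pathstart g \<and> C = path_image g" if "C \<in> \<C>'" for C
  proof -
    obtain A where A: "A \<in> \<C>" "C = h ` A" using \<open>C \<in> \<C>'\<close> by (auto simp: \<C>'_def)
    then obtain q where q: "simple_path q" "pathfinish q = pathstart q" "A = path_image q" using C(5) by blast
    have "simple_path (h \<circ> q)"
      by (rule simple_path_continuous_image) (auto intro: q continuous_on_subset[OF cont] inj_on_subset[OF inj])
    then show ?thesis using q A
      by (intro exI[of _ "h \<circ> q"]) (auto simp: path_image_compose pathfinish_compose pathstart_compose)
  qed
  ultimately have "\<exists>\<C>. finite \<C> \<and> \<C> \<noteq> {} \<and> pairwise disjnt \<C> \<and> h ` K = \<Union>\<C> \<and>
      (\<forall>C\<in>\<C>. \<exists>g. simple_path g \<and> pathfinish g = pathstart g \<and> C = path_image g)"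
    by (intro exI[of _ \<C>'] conjI ballI)
  moreover have "\<exists>E. finite E \<and> h ` K = (\<Union>(a, b)\<in>E. closed_segment a b)"
    using E by (intro exI conjI)
  ultimately show ?thesis unfolding polygonal_link_def by (rule conjI)
qed

lemma polygonal_link_segments:
  assumes "polygonal_link K"
  obtains E where "finite E" "K = (\<Union>(a, b)\<in>E. closed_segment a b)"
  using assms[unfolded polygonal_link_def, THEN conjunct2] by (elim exE conjE)

text \<open>Every component of a link is a connected set with more than one point. This supplies the freedom to move a chosen
  point of an arc away from finitely many bad positions.\<close>
lemma polygonal_link_islimpt:
  assumes K: "polygonal_link K" and z: "z \<in> K"
  shows "z islimpt K"
proof -
  obtain g where g: "simple_path g" "pathfinish g = pathstart g" "z \<in> path_image g" "path_image g \<subseteq> K"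
  proof -
    obtain \<C> where C: "K = \<Union>\<C>"
      "\<forall>C\<in>\<C>. \<exists>g. simple_path g \<and> pathfinish g = pathstart g \<and> C = path_image g"
      using K[unfolded polygonal_link_def, THEN conjunct1] by (elim exE conjE)
    from z C(1) obtain C where "C \<in> \<C>" "z \<in> C" "C \<subseteq> K" by auto
    then show ?thesis using C(2) that by metis
  qed
  have "path_image g \<noteq> {y}" for y
  proof
    assume y: "path_image g = {y}"
    have "g t \<in> path_image g" if "t \<in> {0..1}" for t using that by (auto simp: path_image_def)
    then have "g t = y" if "t \<in> {0..1}" for t using that y by auto
    then have "g (1/2) = g (1/3)" by simp
    moreover have "inj_on g {0<..<1}" using g simple_path_inj_on by blast
    ultimately show False using inj_onD[of g "{0<..<1}" "1/2" "1/3"] by simp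
  qed
  then have "z islimpt path_image g"
    using connected_imp_perfect[of "path_image g" z] g connected_simple_path_image by blast
  then show ?thesis using g islimpt_subset by blast
qed

lemma polygonal_link_compact:
  assumes K: "polygonal_link K" shows "compact K"
proof -
  obtain E where E: "finite E" "K = (\<Union>(a, b)\<in>E. closed_segment a b)"
    using polygonal_link_segments[OF assms] .
  show ?thesis unfolding E(2) by (rule compact_UN[OF E(1)]) auto
qed

text \<open>The members that miss \<open>z\<close> have a closed union, so a small ball about \<open>z\<close> avoids all of
  them.\<close>
lemma finite_family_locally_through_point:
  fixes F :: "'a::metric_space set set"
  assumes "finite F" "\<And>S. S \<in> F \<Longrightarrow> closed S"
  shows "\<exists>e>0. \<forall>S\<in>F. S \<inter> ball z e \<noteq> {} \<longrightarrow> z \<in> S"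
proof -
  have "closed (\<Union>{S\<in>F. z \<notin> S})" using assms by (intro closed_Union) auto
  then have "open (- \<Union>{S\<in>F. z \<notin> S})" by (simp add: open_Compl)
  moreover have "z \<in> - \<Union>{S\<in>F. z \<notin> S}" by auto
  ultimately obtain e where "e > 0" "ball z e \<subseteq> - \<Union>{S\<in>F. z \<notin> S}"
    using openE by blast
  then show ?thesis by (intro exI[of _ e]) blast
qed

text \<open>In a small ball about \<open>z\<close> only segments through \<open>z\<close> survive, and each of them meets the
  ball in a convex set containing \<open>z\<close>.\<close>
lemma segments_locally_connected:
  fixes E :: "('a::real_normed_vector \<times> 'a) set"
  assumes E: "finite E" "K = (\<Union>(a, b)\<in>E. closed_segment a b)" and z: "z \<in> K"
  shows "\<exists>e>0. \<forall>r. 0 < r \<and> r \<le> e \<longrightarrow> connected (K \<inter> ball z r)"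
proof -
  define F where "F = (\<lambda>(a, b). closed_segment a b) ` E"
  have "finite F" using E by (simp add: F_def)
  moreover have "closed S" if "S \<in> F" for S using that by (auto simp: F_def)
  ultimately obtain e where e: "e > 0" "\<And>S. S \<in> F \<Longrightarrow> S \<inter> ball z e \<noteq> {} \<Longrightarrow> z \<in> S"
    using finite_family_locally_through_point[of F z] by blast
  have KF: "K = \<Union>F" using E by (auto simp: F_def)
  have "connected (K \<inter> ball z r)" if r: "0 < r" "r \<le> e" for r
  proof -
    let ?G = "(\<lambda>S. S \<inter> ball z r) ` {S\<in>F. z \<in> S}"
    have "K \<inter> ball z r = \<Union>?G"
    proof (intro equalityI subsetI)
      fix y assume y: "y \<in> K \<inter> ball z r"
      then obtain S where S: "S \<in> F" "y \<in> S" by (auto simp: KF)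
      moreover have "S \<inter> ball z e \<noteq> {}" using S y r by (intro ex_in_conv[THEN iffD1] exI[of _ y]) auto
      ultimately have "z \<in> S" using e(2) by blast
      then show "y \<in> \<Union>?G" using S y by auto
    qed (auto simp: KF)
    moreover have "connected (\<Union>?G)"
    proof (rule connected_Union)
      show "\<Inter>?G \<noteq> {}" using r by (intro ex_in_conv[THEN iffD1] exI[of _ z]) auto
      show "connected s" if "s \<in> ?G" for s
        using that by (auto simp: F_def intro!: convex_connected convex_Int)
    qed
    ultimately show ?thesis by simp
  qed
  then show ?thesis using e by blast
qed

lemma straight_at_on_segment:
  fixes a b z :: "'a::real_normed_vector"
  assumes z: "z \<in> open_segment a b"
  shows "\<exists>e>0. \<forall>r. 0 < r \<and> r \<le> e \<longrightarrow> closed_segment a b \<inter> ball z r = range (\<lambda>t. z + t *\<^sub>R (b - a)) \<inter> ball z r"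
proof -
  obtain u where u: "0 < u" "u < 1" "z = (1-u) *\<^sub>R a + u *\<^sub>R b" and ab: "a \<noteq> b"
    using z by (auto simp: in_segment)
  have zz: "z + t *\<^sub>R (b - a) = (1-(u+t)) *\<^sub>R a + (u+t) *\<^sub>R b" for t
    unfolding u by (simp add: algebra_simps)
  define e where "e = min u (1-u) * norm (b-a)"
  have e: "e > 0" using u ab by (simp add: e_def)
  have "closed_segment a b \<inter> ball z r = range (\<lambda>t. z + t *\<^sub>R (b - a)) \<inter> ball z r" if r: "0 < r" "r \<le> e" for r
  proof (intro equalityI subsetI)
    fix y assume y: "y \<in> closed_segment a b \<inter> ball z r"
    then obtain s where "y = (1-s) *\<^sub>R a + s *\<^sub>R b" by (auto simp: in_segment)
    then have "y = z + (s-u) *\<^sub>R (b-a)" unfolding zz by simp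
    then show "y \<in> range (\<lambda>t. z + t *\<^sub>R (b - a)) \<inter> ball z r" using y by auto
  next
    fix y assume y: "y \<in> range (\<lambda>t. z + t *\<^sub>R (b - a)) \<inter> ball z r"
    then obtain t where t: "y = z + t *\<^sub>R (b - a)" by auto
    have "\<bar>t\<bar> * norm (b-a) < r" using y t by (auto simp: dist_norm)
    then have "\<bar>t\<bar> * norm (b-a) < min u (1-u) * norm (b-a)" using r e_def by linarith
    then have "\<bar>t\<bar> < min u (1-u)" using ab by simp
    then have "0 \<le> u + t" "u + t \<le> 1" by auto
    then have "y \<in> closed_segment a b" unfolding t zz by (auto simp: in_segment intro!: exI[of _ "u+t"])
    then show "y \<in> closed_segment a b \<inter> ball z r" using y by auto
  qed
  then show ?thesis using e by blast
qed

text \<open>The exceptional points are the endpoints of the segments and the intersection points of pairs of non-parallel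
  segments. At every other point all segments through it lie on one line. That finitely many directions suffice is
  what makes it possible later to choose a line transverse to the whole diagram.\<close>
lemma segments_straight_almost_everywhere:
  assumes E: "finite E" "K = (\<Union>(a, b)\<in>E. closed_segment a b)"
  shows "\<exists>B Dirs. finite B \<and> finite Dirs \<and> (\<forall>z\<in>K - B. \<exists>d\<in>Dirs. straight_at K z d)"
proof -
  define par where "par u v \<longleftrightarrow> (\<exists>c. c \<noteq> 0 \<and> u = c *\<^sub>R v)" for u v :: "real^3"
  define I where "I = (\<lambda>((a,b),(c,d)). if par (b-a) (d-c) then {} else closed_segment a b \<inter> closed_segment c d)"
  define B where "B = fst ` E \<union> snd ` E \<union> (\<Union>q\<in>E \<times> E. I q)"
  define Dirs where "Dirs = (\<lambda>(a,b). b - a) ` E"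
  have "finite (I ((a,b),(c,d)))" for a b c d
  proof -
    have "is_singleton (I ((a,b),(c,d))) \<or> I ((a,b),(c,d)) = {}"
    proof (rule ccontr)
      assume "\<not> ?thesis"
      then obtain y z where yz: "y \<in> I ((a,b),(c,d))" "z \<in> I ((a,b),(c,d))" "y \<noteq> z"
        by (meson is_singletonI' )
      then have np: "\<not> par (b-a) (d-c)" by (auto simp: I_def split: if_splits)
      have "y \<in> closed_segment a b" "z \<in> closed_segment a b" "y \<in> closed_segment c d" "z \<in> closed_segment c d"
        using yz by (auto simp: I_def split: if_splits)
      then obtain s t u v where 
        1: "y = (1-s) *\<^sub>R a + s *\<^sub>R b" "z = (1-t) *\<^sub>R a + t *\<^sub>R b" 
        "y = (1-u) *\<^sub>R c + u *\<^sub>R d" "z = (1-v) *\<^sub>R c + v *\<^sub>R d"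
        unfolding in_segment by metis
      have "z - y = (t-s) *\<^sub>R (b-a)" unfolding 1(1,2) by (simp add: algebra_simps)
      moreover have "z - y = (v-u) *\<^sub>R (d-c)" unfolding 1(3,4) by (simp add: algebra_simps)
      ultimately have "(t-s) *\<^sub>R (b-a) = (v-u) *\<^sub>R (d-c)" "t \<noteq> s" "v \<noteq> u" using yz(3) by auto
      then have "b - a = inverse (t-s) *\<^sub>R (v-u) *\<^sub>R (d-c)"
        by (metis eq_iff_diff_eq_0 left_inverse scaleR_one scaleR_scaleR)
      then have "b - a = (inverse (t-s) * (v-u)) *\<^sub>R (d-c)" "inverse (t-s) * (v-u) \<noteq> 0"
        using \<open>t \<noteq> s\<close> \<open>v \<noteq> u\<close> by auto
      then show False using np unfolding par_def by blast
    qed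
    then show ?thesis by (auto elim: is_singletonE)
  qed
  then have "finite B" using E by (auto simp: B_def)
  moreover have "finite Dirs" using E by (simp add: Dirs_def)
  moreover have "\<exists>d\<in>Dirs. straight_at K z d" if z: "z \<in> K - B" for z
  proof -
    define F where "F = (\<lambda>(a, b). closed_segment a b) ` E"
    have "finite F" using E by (simp add: F_def)
    moreover have "closed S" if "S \<in> F" for S using that by (auto simp: F_def)
    ultimately obtain e where e: "e > 0" "\<And>S. S \<in> F \<Longrightarrow> S \<inter> ball z e \<noteq> {} \<Longrightarrow> z \<in> S"
      using finite_family_locally_through_point[of F z] by blast
    obtain a b where ab: "(a,b) \<in> E" "z \<in> closed_segment a b" using z E by auto
    have op: "z \<in> open_segment c d" if "(c,d) \<in> E" "z \<in> closed_segment c d" for c d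
      using that z by (force simp: open_segment_def B_def image_iff)
    then have "a \<noteq> b" using ab by fastforce
    have pr: "par (b-a) (d-c)" if "(c,d) \<in> E" "z \<in> closed_segment c d" for c d
    proof (rule ccontr)
      assume "\<not> par (b-a) (d-c)"
      then have "z \<in> I ((a,b),(c,d))" using ab that by (auto simp: I_def)
      then have "z \<in> B" unfolding B_def using ab that by blast
      then show False using z by auto
    qed
    obtain r where r: "r > 0" "\<And>r'. 0 < r' \<and> r' \<le> r \<Longrightarrow> closed_segment a b \<inter> ball z r' = range (\<lambda>t. z + t *\<^sub>R (b - a)) \<inter> ball z r'"
      using straight_at_on_segment[OF op[OF ab]] by blast
    define m where "m = min e r"
    have m: "m > 0" "m \<le> e" "m \<le> r" using e r by (auto simp: m_def)
    have "K \<inter> ball z m = range (\<lambda>t. z + t *\<^sub>R (b - a)) \<inter> ball z m"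
    proof (intro equalityI subsetI)
      fix y assume "y \<in> range (\<lambda>t. z + t *\<^sub>R (b - a)) \<inter> ball z m"
      then have "y \<in> closed_segment a b \<inter> ball z m" using r(2)[of m] m by auto
      then show "y \<in> K \<inter> ball z m" using ab E by auto
    next
      fix y assume y: "y \<in> K \<inter> ball z m"
      then obtain c d where cd: "(c,d) \<in> E" "y \<in> closed_segment c d" using E by auto
      then have "closed_segment c d \<in> F" by (auto simp: F_def)
      moreover have "closed_segment c d \<inter> ball z e \<noteq> {}"
        using cd y m by (intro ex_in_conv[THEN iffD1] exI[of _ y]) auto
      ultimately have zc: "z \<in> closed_segment c d" using e(2) by blast
      obtain k where k: "k \<noteq> 0" "b - a = k *\<^sub>R (d-c)" using pr[OF cd(1) zc] par_def by auto
      obtain s u where su: "y = (1-s) *\<^sub>R c + s *\<^sub>R d" "z = (1-u) *\<^sub>R c + u *\<^sub>R d"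
        using cd zc by (auto simp: in_segment)
      have "y - z = (s-u) *\<^sub>R (d-c)" unfolding su by (simp add: algebra_simps)
      also have "\<dots> = ((s-u)/k) *\<^sub>R (b-a)" using k by simp
      finally have "y = z + ((s-u)/k) *\<^sub>R (b-a)" by (simp add: algebra_simps)
      then show "y \<in> range (\<lambda>t. z + t *\<^sub>R (b - a)) \<inter> ball z m" using y by auto
    qed
    then have "straight_at K z (b-a)" using m \<open>a \<noteq> b\<close> by (auto simp: straight_at_def)
    then show ?thesis using ab by (force simp: Dirs_def)
  qed
  ultimately show ?thesis by blast
qed

section \<open>Straight points and the local structure of diagrams\<close>

lemma straight_at_cong_locally:
  assumes eq: "K \<inter> ball z e = K' \<inter> ball z e" and e: "e > 0" and s: "straight_at K z d"
  shows "straight_at K' z d"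
proof -
  obtain r where r: "r > 0" "K \<inter> ball z r = range (\<lambda>t. z + t *\<^sub>R d) \<inter> ball z r" "d \<noteq> 0"
    using s unfolding straight_at_def by blast
  have "ball z (min e r) = ball z e \<inter> ball z r" by auto
  then have "K' \<inter> ball z (min e r) = range (\<lambda>t. z + t *\<^sub>R d) \<inter> ball z (min e r)"
    using eq r(2) by blast
  then show ?thesis unfolding straight_at_def using e r by (intro conjI exI[of _ "min e r"]) auto
qed

lemma straight_at_eventually:
  assumes "straight_at K u d"
  shows "\<forall>\<^sub>F t in at 0. u + t *\<^sub>R d \<in> K"
proof -
  obtain r where r: "r > 0" "K \<inter> ball u r = range (\<lambda>t. u + t *\<^sub>R d) \<inter> ball u r"
    using assms unfolding straight_at_def by blast
  have "((\<lambda>t. u + t *\<^sub>R d) \<longlongrightarrow> u + 0 *\<^sub>R d) (at 0)" by (intro tendsto_intros)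
  then have "\<forall>\<^sub>F t in at 0. u + t *\<^sub>R d \<in> ball u r"
    using r(1) by (intro topological_tendstoD) auto
  then show ?thesis by eventually_elim (use r in blast)
qed

lemma straight_at_filterlim:
  assumes "straight_at K u d"
  shows "filterlim (\<lambda>t. u + t *\<^sub>R d) (at u within K) (at 0)"
proof -
  have "((\<lambda>t. u + t *\<^sub>R d) \<longlongrightarrow> u + 0 *\<^sub>R d) (at 0)" by (intro tendsto_intros)
  moreover have "\<forall>\<^sub>F t in at 0. u + t *\<^sub>R d \<noteq> u"
    using assms unfolding straight_at_def by (auto simp: eventually_at_filter)
  ultimately show ?thesis
    unfolding filterlim_at using eventually_conj[OF straight_at_eventually[OF assms]] by auto
qed

lemma eventually_at_right_both_signs:
  fixes P :: "real \<Rightarrow> bool"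
  assumes "\<forall>\<^sub>F t in at 0. P t"
  shows "\<forall>\<^sub>F t in at_right 0. P t \<and> P (- t)"
proof -
  obtain e where e: "e > 0" "\<And>t. t \<noteq> 0 \<Longrightarrow> \<bar>t\<bar> < e \<Longrightarrow> P t"
    using assms unfolding eventually_at by (auto simp: dist_real_def)
  show ?thesis unfolding eventually_at_right_field using e by (intro exI[of _ e]) auto
qed

lemma straight_at_parallel:
  assumes "straight_at K u d" "straight_at K u e"
  shows "\<exists>c. c \<noteq> 0 \<and> e = c *\<^sub>R d"
proof -
  obtain r where r: "r > 0" "K \<inter> ball u r = range (\<lambda>t. u + t *\<^sub>R d) \<inter> ball u r"
    using assms(1) unfolding straight_at_def by blast
  have e0: "e \<noteq> 0" using assms(2) by (simp add: straight_at_def)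
  have "((\<lambda>t. u + t *\<^sub>R e) \<longlongrightarrow> u + 0 *\<^sub>R e) (at 0)" by (intro tendsto_intros)
  then have "\<forall>\<^sub>F t in at 0. u + t *\<^sub>R e \<in> ball u r"
    using r(1) by (intro topological_tendstoD) auto
  then have "\<forall>\<^sub>F t in at 0. t \<noteq> 0 \<and> u + t *\<^sub>R e \<in> K \<inter> ball u r"
    using straight_at_eventually[OF assms(2)] eventually_neq_at_within[of 0 0 UNIV]
    by eventually_elim auto
  moreover have "at (0::real) \<noteq> bot" by simp
  ultimately obtain t where t: "t \<noteq> 0" "u + t *\<^sub>R e \<in> K \<inter> ball u r"
    using eventually_happens' by blast
  then have "u + t *\<^sub>R e \<in> range (\<lambda>t. u + t *\<^sub>R d)" using r(2) by simp
  then obtain s where "u + t *\<^sub>R e = u + s *\<^sub>R d" by (rule rangeE)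
  then have "t *\<^sub>R e = s *\<^sub>R d" by simp
  then have "e = (inverse t * s) *\<^sub>R d" using t(1)
    by (metis left_inverse scaleR_one scaleR_scaleR)
  then show ?thesis using e0 by (metis scaleR_zero_left)
qed

lemma plane_proj_linear: "linear plane_proj"
  by (rule linearI) (auto simp: plane_proj_def vec_eq_iff forall_2)

lemma diagram_segments:
  assumes "is_diagram D"
  obtains E where "finite E" "D = (\<Union>(a, b)\<in>E. closed_segment a b)"
  using polygonal_link_segments assms unfolding is_diagram_def by blast

lemma diagram_compact: "is_diagram D \<Longrightarrow> compact D"
  using polygonal_link_compact unfolding is_diagram_def by blast

lemma diagram_finite_crossings:
  assumes "is_diagram D" shows "finite {(u, v). crossing D u v}"
  using assms unfolding is_diagram_def regular_position_def by blast

lemma diagram_finite_under: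
  assumes "is_diagram D" shows "finite {u. \<exists>v. crossing D u v}"
proof -
  have "{u. \<exists>v. crossing D u v} = fst ` {(u, v). crossing D u v}" by force
  then show ?thesis using diagram_finite_crossings[OF assms] by simp
qed

lemma diagram_fiber_at_crossing:
  assumes D: "is_diagram D" and c: "crossing D u v" and z: "z \<in> D" "plane_proj z = plane_proj u"
  shows "z = u \<or> z = v"
proof (rule ccontr)
  assume n: "\<not> ?thesis"
  have "u \<noteq> v" using c by (auto simp: crossing_def)
  then have "card {u, v, z} = 3" using n by auto
  moreover have "{u, v, z} \<subseteq> {y \<in> D. plane_proj y = plane_proj u}"
    using c z by (auto simp: crossing_def)
  moreover have "card {y \<in> D. plane_proj y = plane_proj u} \<le> 2" "finite {y \<in> D. plane_proj y = plane_proj u}"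
    using D unfolding is_diagram_def regular_position_def by blast+
  ultimately show False using card_mono[of "{y \<in> D. plane_proj y = plane_proj u}" "{u, v, z}"] by linarith
qed

lemma diagram_over_in_cut:
  assumes D: "is_diagram D" and c: "crossing D u v"
  shows "v \<in> cut_diagram D"
proof -
  have False if "crossing D v w" for w
    using diagram_fiber_at_crossing[OF D c, of w] that c by (auto simp: crossing_def)
  then show ?thesis using c by (auto simp: cut_diagram_def crossing_def)
qed

text \<open>A vertical strand would put infinitely many points over one point of the plane.\<close>
lemma diagram_nonvertical:
  assumes D: "is_diagram D" and s: "straight_at D z e"
  shows "plane_proj e \<noteq> 0"
proof
  assume e: "plane_proj e = 0"
  have fin: "finite {y \<in> D. plane_proj y = plane_proj z}"
    using D unfolding is_diagram_def regular_position_def by blast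
  have "plane_proj (z + t *\<^sub>R e) = plane_proj z" for t
    by (simp add: linear_add[OF plane_proj_linear] linear_cmul[OF plane_proj_linear] e)
  then have "\<forall>\<^sub>F t in at 0. z + t *\<^sub>R e \<in> {y \<in> D. plane_proj y = plane_proj z}"
    using straight_at_eventually[OF s] by simp
  note A = this
  have "\<forall>\<^sub>F y in at z. y \<notin> {y \<in> D. plane_proj y = plane_proj z}"
    using islimpt_finite[OF fin] unfolding islimpt_iff_eventually by blast
  moreover have "filterlim (\<lambda>t. z + t *\<^sub>R e) (at z) (at 0)"
    by (rule filterlim_mono[OF straight_at_filterlim[OF s] at_le[OF subset_UNIV] order_refl])
  ultimately have "\<forall>\<^sub>F t in at 0. z + t *\<^sub>R e \<notin> {y \<in> D. plane_proj y = plane_proj z}"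
    using eventually_compose_filterlim by blast
  with A have "\<forall>\<^sub>F t in at (0::real). False" by eventually_elim (rule notE)
  then show False by simp
qed

text \<open>\<open>B\<close> collects the bad points, namely crossings and points where the diagram is not known to be straight,
  and \<open>Dirs\<close> the directions of the strands elsewhere. General position of a segment in the plane means
  that it avoids the projection of \<open>B\<close> and is parallel to no member of \<open>Dirs\<close>.\<close>
definition generic_data :: "(real^3) set \<Rightarrow> (real^3) set \<Rightarrow> (real^3) set \<Rightarrow> bool" where
  "generic_data D B Dirs \<longleftrightarrow> finite B \<and> B \<subseteq> D \<and> (\<forall>u v. crossing D u v \<longrightarrow> u \<in> B \<and> v \<in> B) \<and>
     finite Dirs \<and> (\<forall>e\<in>Dirs. plane_proj e \<noteq> 0) \<and> (\<forall>z\<in>D - B. \<exists>e\<in>Dirs. straight_at D z e)"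

lemma generic_dataD:
  assumes "generic_data D B Dirs"
  shows "finite B" "B \<subseteq> D" "crossing D u v \<Longrightarrow> u \<in> B \<and> v \<in> B"
    "finite Dirs" "e \<in> Dirs \<Longrightarrow> plane_proj e \<noteq> 0" "z \<in> D \<Longrightarrow> z \<notin> B \<Longrightarrow> \<exists>e\<in>Dirs. straight_at D z e"
  using assms unfolding generic_data_def by simp_all

lemma diagram_generic:
  assumes D: "is_diagram D"
  shows "\<exists>B Dirs. generic_data D B Dirs"
proof -
  obtain E where "finite E" "D = (\<Union>(a, b)\<in>E. closed_segment a b)" using diagram_segments[OF D] .
  from segments_straight_almost_everywhere[OF this]
  obtain B Dirs where B: "finite B" "finite Dirs" "\<forall>z\<in>D - B. \<exists>e\<in>Dirs. straight_at D z e"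
    by (elim exE conjE)
  let ?C = "{(u, v). crossing D u v}"
  define B' where "B' = (B \<inter> D) \<union> fst ` ?C \<union> snd ` ?C"
  define Dirs' where "Dirs' = {e \<in> Dirs. plane_proj e \<noteq> 0}"
  have "finite B'" unfolding B'_def using B(1) diagram_finite_crossings[OF D] by simp
  moreover have "B' \<subseteq> D" by (auto simp: B'_def crossing_def)
  moreover have "u \<in> B' \<and> v \<in> B'" if "crossing D u v" for u v
  proof -
    have "(u, v) \<in> ?C" using that by simp
    then have "fst (u, v) \<in> fst ` ?C" "snd (u, v) \<in> snd ` ?C" by (rule imageI)+
    then show ?thesis by (simp add: B'_def)
  qed
  moreover have "\<exists>e\<in>Dirs'. straight_at D z e" if "z \<in> D - B'" for z
  proof -
    have "z \<in> D - B" using that by (auto simp: B'_def)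
    then obtain e where "e \<in> Dirs" "straight_at D z e" using B(3) by blast
    then show ?thesis using diagram_nonvertical[OF D] by (auto simp: Dirs'_def)
  qed
  moreover have "finite Dirs'" "\<forall>e\<in>Dirs'. plane_proj e \<noteq> 0" using B(2) by (simp_all add: Dirs'_def)
  ultimately have "generic_data D B' Dirs'" unfolding generic_data_def by blast
  then show ?thesis by blast
qed

lemma finite_avoids_punctured: "finite (U :: 'a::t1_space set) \<Longrightarrow> \<forall>\<^sub>F y in at z within S. y \<notin> U"
  using islimpt_finite[of U z] filter_leD[OF at_le[of S UNIV z], of "\<lambda>y. y \<notin> U"]
  unfolding islimpt_iff_eventually by simp

lemma cut_diagram_eventually_eq:
  assumes D: "is_diagram D"
  shows "\<forall>\<^sub>F y in at z. y \<in> D \<longrightarrow> y \<in> cut_diagram D"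
  using finite_avoids_punctured[OF diagram_finite_under[OF D], of z UNIV]
  by eventually_elim (auto simp: cut_diagram_def)

lemma straight_at_filterlim_cut:
  assumes D: "is_diagram D" and s: "straight_at D u d"
  shows "filterlim (\<lambda>t. u + t *\<^sub>R d) (at u within cut_diagram D) (at 0)"
proof -
  have "filterlim (\<lambda>t. u + t *\<^sub>R d) (at u) (at 0)"
    by (rule filterlim_mono[OF straight_at_filterlim[OF s] at_le[OF subset_UNIV] order_refl])
  from eventually_compose_filterlim[OF cut_diagram_eventually_eq[OF D] this]
  have "\<forall>\<^sub>F t in at 0. u + t *\<^sub>R d \<in> cut_diagram D"
    using straight_at_eventually[OF s] by eventually_elim auto
  moreover have f: "(\<forall>\<^sub>F t in at 0. u + t *\<^sub>R d \<in> D \<and> u + t *\<^sub>R d \<noteq> u) \<and> ((\<lambda>t. u + t *\<^sub>R d) \<longlongrightarrow> u) (at 0)"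
    using straight_at_filterlim[OF s] unfolding filterlim_at .
  ultimately have "\<forall>\<^sub>F t in at 0. u + t *\<^sub>R d \<in> cut_diagram D \<and> u + t *\<^sub>R d \<noteq> u"
    by (elim conjE) (rule eventually_elim2, assumption+, blast)
  then show ?thesis unfolding filterlim_at using f by (intro conjI) blast+
qed

section \<open>Colorings as locally constant functions\<close>

text \<open>A small ball about a point of the cut diagram contains no under-crossing point, and it meets the diagram in a
  connected set.\<close>
lemma cut_diagram_locally_arc:
  assumes D: "is_diagram D" and z: "z \<in> cut_diagram D"
  shows "\<forall>\<^sub>F y in at z within cut_diagram D. arc_at D y = arc_at D z"
proof -
  obtain E where E: "finite E" "D = (\<Union>(a, b)\<in>E. closed_segment a b)" using diagram_segments[OF D] .
  have zD: "z \<in> D" using z by (simp add: cut_diagram_def)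
  obtain e where e: "e > 0" "\<And>r. 0 < r \<Longrightarrow> r \<le> e \<Longrightarrow> connected (D \<inter> ball z r)"
    using segments_locally_connected[OF E zD] by blast
  obtain e' where e': "e' > 0" "\<And>y. y \<noteq> z \<Longrightarrow> dist y z < e' \<Longrightarrow> y \<in> D \<Longrightarrow> y \<in> cut_diagram D"
    using cut_diagram_eventually_eq[OF D, of z] unfolding eventually_at by auto
  define r where "r = min e e'"
  have r: "r > 0" "r \<le> e" "r \<le> e'" using e e' by (auto simp: r_def)
  have sub: "D \<inter> ball z r \<subseteq> cut_diagram D" using e'(2) z r by (force simp: dist_commute)
  have "arc_at D y = arc_at D z" if y: "y \<in> cut_diagram D" "dist y z < r" for y
    unfolding arc_at_def
  proof (rule joinable_connected_component_eq[OF e(2)[OF r(1,2)] sub])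
    have "y \<in> D \<inter> ball z r" using y by (auto simp: cut_diagram_def dist_commute)
    then show "connected_component_set (cut_diagram D) y \<inter> (D \<inter> ball z r) \<noteq> {}"
      using y by (intro ex_in_conv[THEN iffD1] exI[of _ y]) (auto simp: connected_component_refl_eq)
    show "connected_component_set (cut_diagram D) z \<inter> (D \<inter> ball z r) \<noteq> {}"
      using z zD r by (intro ex_in_conv[THEN iffD1] exI[of _ z]) (auto simp: connected_component_refl_eq)
  qed
  then show ?thesis unfolding eventually_at using r by blast
qed

text \<open>Colors are attached to points instead of arcs. Local constancy on the cut diagram replaces constancy on arcs, so
  that a coloring of a modified diagram can be written down by a formula in the points, without a description of its
  arcs.\<close>
definition point_coloring :: "nat \<Rightarrow> (real^3) set \<Rightarrow> (real^3 \<Rightarrow> int) \<Rightarrow> bool" where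
  "point_coloring p D k \<longleftrightarrow>
     (\<forall>z\<in>cut_diagram D. k z \<in> {0..<int p} \<and> (\<forall>\<^sub>F y in at z within cut_diagram D. k z = k y)) \<and>
     (\<forall>u v d. crossing D u v \<and> straight_at D u d \<longrightarrow>
        (\<forall>\<^sub>F t in at_right 0. [2 * k v = k (u + t *\<^sub>R d) + k (u - t *\<^sub>R d)] (mod int p)))"

lemma arc_at_in_arcs: "z \<in> cut_diagram D \<Longrightarrow> arc_at D z \<in> arcs D"
  by (simp add: arc_at_def arcs_def componentsI)

lemma arcsE:
  assumes "A \<in> arcs D" obtains z where "z \<in> cut_diagram D" "A = arc_at D z"
  using assms unfolding arcs_def arc_at_def by (elim componentsE)

lemma point_coloring_of_coloring:
  assumes D: "is_diagram D" and c: "coloring p D c"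
  shows "point_coloring p D (\<lambda>z. c (arc_at D z))"
    and "(\<lambda>z. c (arc_at D z)) ` cut_diagram D = c ` arcs D"
proof -
  show "point_coloring p D (\<lambda>z. c (arc_at D z))"
    unfolding point_coloring_def
  proof (intro conjI ballI)
    fix z assume z: "z \<in> cut_diagram D"
    show "c (arc_at D z) \<in> {0..<int p}" using c arc_at_in_arcs[OF z] by (simp add: coloring_def)
    show "\<forall>\<^sub>F y in at z within cut_diagram D. c (arc_at D z) = c (arc_at D y)"
      using cut_diagram_locally_arc[OF D z] by eventually_elim simp
  qed (use c in \<open>simp add: coloring_def\<close>)
  show "(\<lambda>z. c (arc_at D z)) ` cut_diagram D = c ` arcs D"
    by (auto intro: arc_at_in_arcs elim!: arcsE)
qed

text \<open>A locally constant function is constant on the connected components, that is on the arcs.\<close>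
lemma coloring_of_point_coloring:
  assumes D: "is_diagram D" and k: "point_coloring p D k"
  shows "\<exists>c. coloring p D c \<and> c ` arcs D = k ` cut_diagram D"
proof -
  define c where "c A = k (SOME z. z \<in> A)" for A
  have const: "c (arc_at D z) = k z" if z: "z \<in> cut_diagram D" for z
  proof -
    have zz: "z \<in> arc_at D z" using z by (simp add: arc_at_def connected_component_refl_eq)
    define y where "y = (SOME y. y \<in> arc_at D z)"
    have y: "y \<in> arc_at D z" unfolding y_def using zz by (rule someI)
    have sub: "arc_at D z \<subseteq> cut_diagram D" by (simp add: arc_at_def connected_component_subset)
    have "k y = k z"
    proof (rule connected_local_const[OF _ y zz])
      show "connected (arc_at D z)" by (simp add: arc_at_def)
      show "\<forall>a\<in>arc_at D z. \<forall>\<^sub>F b in at a within arc_at D z. k a = k b"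
      proof
        fix a assume "a \<in> arc_at D z"
        then have "\<forall>\<^sub>F b in at a within cut_diagram D. k a = k b"
          using k sub unfolding point_coloring_def by blast
        then show "\<forall>\<^sub>F b in at a within arc_at D z. k a = k b" by (rule filter_leD[OF at_le[OF sub]])
      qed
    qed
    then show ?thesis by (simp add: c_def y_def)
  qed
  have "coloring p D c"
    unfolding coloring_def
  proof (intro conjI ballI allI impI)
    show "c A \<in> {0..<int p}" if "A \<in> arcs D" for A
      using that k const by (auto elim!: arcsE simp: point_coloring_def)
    fix u v d assume a: "crossing D u v \<and> straight_at D u d"
    have "\<forall>\<^sub>F t in at 0. u + t *\<^sub>R d \<in> cut_diagram D"
      using straight_at_filterlim_cut[OF D, of u d] a unfolding filterlim_at by (auto elim: eventually_mono)
    then have "\<forall>\<^sub>F t in at_right 0. u + t *\<^sub>R d \<in> cut_diagram D \<and> u - t *\<^sub>R d \<in> cut_diagram D"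
      using eventually_at_right_both_signs[of "\<lambda>t. u + t *\<^sub>R d \<in> cut_diagram D"] by simp
    moreover have "\<forall>\<^sub>F t in at_right 0. [2 * k v = k (u + t *\<^sub>R d) + k (u - t *\<^sub>R d)] (mod int p)"
      using k a unfolding point_coloring_def by blast
    ultimately show "\<forall>\<^sub>F t in at_right 0. [2 * c (arc_at D v) = c (arc_at D (u + t *\<^sub>R d)) + c (arc_at D (u - t *\<^sub>R d))] (mod int p)"
      by eventually_elim (simp add: const diagram_over_in_cut[OF D conjunct1[OF a]])
  qed
  moreover have "c ` arcs D = k ` cut_diagram D"
    by (auto simp: const elim!: arcsE) (metis arc_at_in_arcs const imageI)
  ultimately show ?thesis by blast
qed

section \<open>The finger as a shear of space\<close>

lemma eventually_at_within_open: "open S \<Longrightarrow> z \<in> S \<Longrightarrow> \<forall>\<^sub>F y in at z within T. y \<in> S \<and> y \<in> T"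
  unfolding eventually_at_topological by blast

lemma straight_at_openI:
  assumes "open S" "z \<in> S" "d \<noteq> 0" "K \<inter> S = range (\<lambda>t. z + t *\<^sub>R d) \<inter> S"
  shows "straight_at K z d"
proof -
  obtain e where e: "e > 0" "ball z e \<subseteq> S" using assms openE by blast
  then have "K \<inter> ball z e = range (\<lambda>t. z + t *\<^sub>R d) \<inter> ball z e" using assms(4) by blast
  then show ?thesis unfolding straight_at_def using e assms by blast
qed

text \<open>Near a straight point the set is a line, so a property of the punctured line holds for all nearby points of the set.\<close>
lemma straight_at_punctured_coverage:
  assumes "straight_at K u e" "\<forall>\<^sub>F t in at 0. P (u + t *\<^sub>R e)"
  shows "\<forall>\<^sub>F y in at u within K. P y"
proof -
  obtain r where r: "r > 0" "K \<inter> ball u r = range (\<lambda>t. u + t *\<^sub>R e) \<inter> ball u r" "e \<noteq> 0"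
    using assms(1) unfolding straight_at_def by blast
  obtain m where m: "m > 0" "\<And>t. t \<noteq> 0 \<Longrightarrow> \<bar>t\<bar> < m \<Longrightarrow> P (u + t *\<^sub>R e)"
    using assms(2) unfolding eventually_at by (auto simp: dist_real_def)
  have "P y" if y: "y \<in> K" "y \<noteq> u" "dist y u < min r (m * norm e)" for y
  proof -
    have "y \<in> K \<inter> ball u r" using y by (simp add: dist_commute)
    then have "y \<in> range (\<lambda>t. u + t *\<^sub>R e)" using r(2) by simp
    then obtain t where t: "y = u + t *\<^sub>R e" by (rule rangeE)
    then have "\<bar>t\<bar> * norm e < m * norm e" using y(3) by (simp add: dist_norm)
    then have "\<bar>t\<bar> < m" using r(3) by simp
    then show ?thesis using m(2)[of t] t y(2) by auto
  qed
  then show ?thesis unfolding eventually_at using r m by (intro exI[of _ "min r (m * norm e)"]) auto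
qed

text \<open>If a point of the segment lies in \<open>C\<close>, then what is left on either side of it is convex and compact,
  hence a segment or empty.\<close>
lemma segment_minus_open_convex:
  fixes p q :: "'a::real_normed_vector"
  assumes C: "open C" "convex C"
  shows "\<exists>E. finite E \<and> closed_segment p q - C = (\<Union>(a, b)\<in>E. closed_segment a b)"
proof (cases "closed_segment p q \<inter> C = {}")
  case True
  then show ?thesis by (intro exI[of _ "{(p, q)}"]) auto
next
  case False
  define h where "h t = p + t *\<^sub>R (q - p)" for t
  have hseg: "h ` {u..v} = closed_segment (h u) (h v)" if "u \<le> v" for u v
  proof (intro equalityI subsetI)
    fix y assume "y \<in> h ` {u..v}"
    then obtain t where t: "y = h t" "u \<le> t" "t \<le> v" by auto
    show "y \<in> closed_segment (h u) (h v)"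
    proof (cases "u = v")
      case False
      define r where "r = (t - u) / (v - u)"
      have "r * (v - u) = t - u" using False by (simp add: r_def)
      then have "t = (1-r) * u + r * v" by (simp add: algebra_simps)
      then have "h t = h ((1-r) * u + r * v)" by (rule arg_cong)
      also have "\<dots> = (1-r) *\<^sub>R h u + r *\<^sub>R h v" by (simp add: h_def algebra_simps)
      finally have "y = (1-r) *\<^sub>R h u + r *\<^sub>R h v" by (simp add: t)
      moreover have "0 \<le> r" "r \<le> 1" using t False that by (auto simp: r_def field_simps)
      ultimately show ?thesis by (auto simp: in_segment)
    qed (use t in auto)
  next
    fix y assume "y \<in> closed_segment (h u) (h v)"
    then obtain r where r: "0 \<le> r" "r \<le> 1" "y = (1-r) *\<^sub>R h u + r *\<^sub>R h v" by (auto simp: in_segment)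
    have "y = h ((1-r) * u + r * v)" by (simp add: r h_def algebra_simps)
    moreover have "u \<le> (1-r) * u + r * v" "(1-r) * u + r * v \<le> v"
      using r that mult_left_mono[of u v r] mult_left_mono[of u v "1-r"] by (auto simp: algebra_simps)
    ultimately show "y \<in> h ` {u..v}" by auto
  qed
  have seg01: "closed_segment p q = h ` {0..1}" using hseg[of 0 1] by (simp add: h_def)
  then obtain s where s: "s \<in> {0..1}" "h s \<in> C" using False by (metis disjoint_iff imageE)
  have cont: "continuous_on UNIV h" unfolding h_def by (intro continuous_intros)
  define V where "V = h -` C"
  have V: "open V" unfolding V_def using cont C(1) by (auto intro: open_vimage)
  have conv: "t \<in> V" if "u \<in> V" "v \<in> V" "u \<le> t" "t \<le> v" for t u v
  proof -
    have "h t \<in> closed_segment (h u) (h v)" using hseg[of u v] that by auto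
    then show ?thesis using that C(2) unfolding V_def by (auto dest: closed_segment_subset)
  qed
  have I1: "\<exists>u v. {0..s} - V = {u..v}"
  proof -
    have "is_interval ({0..s} - V)" unfolding is_interval_1
      using conv[of _ s] s by (auto simp: V_def)
    moreover have "compact ({0..s} - V)" using V by (intro compact_diff) auto
    ultimately show ?thesis using connected_compact_interval_1 is_interval_connected_1 by blast
  qed
  have I2: "\<exists>u v. {s..1} - V = {u..v}"
  proof -
    have "is_interval ({s..1} - V)" unfolding is_interval_1
      using conv[of s] s by (auto simp: V_def)
    moreover have "compact ({s..1} - V)" using V by (intro compact_diff) auto
    ultimately show ?thesis using connected_compact_interval_1 is_interval_connected_1 by blast
  qed
  have im: "\<exists>E. finite E \<and> h ` {u..v} = (\<Union>(a, b)\<in>E. closed_segment a b)" for u v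
  proof (cases "u \<le> v")
    case True
    then show ?thesis using hseg[OF True] by (intro exI[of _ "{(h u, h v)}"]) auto
  qed (auto intro: exI[of _ "{}"])
  obtain u v u' v' where uv: "{0..s} - V = {u..v}" "{s..1} - V = {u'..v'}" using I1 I2 by blast
  obtain E E' where E: "finite E" "h ` {u..v} = (\<Union>(a, b)\<in>E. closed_segment a b)"
    "finite E'" "h ` {u'..v'} = (\<Union>(a, b)\<in>E'. closed_segment a b)" using im by meson
  have "{0..1} - V = ({0..s} - V) \<union> ({s..1} - V)" using s by auto
  moreover have "closed_segment p q - C = h ` ({0..1} - V)" unfolding seg01 V_def by auto
  ultimately have "closed_segment p q - C = h ` {u..v} \<union> h ` {u'..v'}" using uv by (simp add: image_Un)
  then have "closed_segment p q - C = (\<Union>(a, b)\<in>E \<union> E'. closed_segment a b)" using E by auto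
  then show ?thesis using E by (intro exI[of _ "E \<union> E'"]) auto
qed

lemma segments_minus_open_convex:
  fixes K :: "'a::real_normed_vector set"
  assumes C: "open C" "convex C" and E: "finite E" "K = (\<Union>(a, b)\<in>E. closed_segment a b)"
  shows "\<exists>E'. finite E' \<and> K - C = (\<Union>(a, b)\<in>E'. closed_segment a b)"
proof -
  have "\<forall>e. \<exists>E. finite E \<and> (case e of (p, q) \<Rightarrow> closed_segment p q - C) = (\<Union>(a, b)\<in>E. closed_segment a b)"
    using segment_minus_open_convex[OF C] by simp
  then obtain F where "\<forall>e. finite (F e) \<and> (case e of (p, q) \<Rightarrow> closed_segment p q - C) = (\<Union>(a, b)\<in>F e. closed_segment a b)"
    by (rule choice[THEN exE])
  then have F: "\<And>p q. finite (F (p, q)) \<and> closed_segment p q - C = (\<Union>(a, b)\<in>F (p, q). closed_segment a b)"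
    by simp
  have "K - C = (\<Union>(p, q)\<in>E. closed_segment p q - C)" unfolding E(2) by auto
  also have "\<dots> = (\<Union>(p, q)\<in>E. \<Union>(a, b)\<in>F (p, q). closed_segment a b)"
    using F by (intro SUP_cong) auto
  also have "\<dots> = (\<Union>(a, b)\<in>(\<Union>e\<in>E. F e). closed_segment a b)" by auto
  finally show ?thesis using E(1) F by (intro exI[of _ "\<Union>e\<in>E. F e"]) auto
qed

text \<open>The data of a finger move. The finger starts at the point \<open>x\<close> of a strand with direction
  \<open>d\<close> and its tip is \<open>x + w\<close>. The linear forms \<open>a\<close> and \<open>b\<close>
  depend on the projection to the plane only and are the coordinates there with respect to the basis given by
  \<open>d\<close> and \<open>w\<close>; the strand is replaced for \<open>|a(z - x)| < \<delta>\<close>. Seen from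
  above, the finger covers the triangle \<open>b \<ge> 0\<close>, \<open>|a| \<le> \<delta> (1 - b)\<close>.

  Four assumptions carry the geometry. By \<open>strand\<close>, nothing but the strand itself lies over a
  neighborhood of \<open>x\<close>. By \<open>away\<close>, the remaining diagram in the strip \<open>|a| <
  \<rho>\<close> stays at vertical distance at least \<open>\<delta>\<close> from the plane through \<open>x\<close>
  spanned by \<open>d\<close> and \<open>w\<close>, and lies below it on the side of the finger. It holds once
  \<open>w\<close> is steep enough. By \<open>clear\<close> and \<open>transverse\<close>, the triangle contains no
  crossing and its two long sides meet the diagram transversely.\<close>
locale finger =
  fixes D :: "(real^3) set" and x d w :: "real^3" and a b :: "real^3 \<Rightarrow> real" and \<rho> \<delta> :: real
  assumes D: "is_diagram D"
    and lin_a: "linear a" and lin_b: "linear b"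
    and coords: "\<And>u v. plane_proj u = plane_proj v \<longleftrightarrow> a u = a v \<and> b u = b v"
    and basis: "a d = 1" "b d = 0" "a w = 0" "b w = 1"
    and \<delta>: "0 < \<delta>" "\<delta> < \<rho>"
    and strand: "\<And>z. \<bar>a (z - x)\<bar> < \<rho> \<Longrightarrow> \<bar>b (z - x)\<bar> < \<rho> \<Longrightarrow> z \<in> D \<longleftrightarrow> z = x + a (z - x) *\<^sub>R d"
    and away: "\<And>z. z \<in> D \<Longrightarrow> \<bar>a (z - x)\<bar> < \<rho> \<Longrightarrow> \<rho> \<le> \<bar>b (z - x)\<bar> \<Longrightarrow>
      \<delta> \<le> \<bar>(z - x) $ 3 - a (z - x) * d $ 3 - b (z - x) * w $ 3\<bar> \<and>
      (0 < b (z - x) \<longrightarrow> (z - x) $ 3 - a (z - x) * d $ 3 - b (z - x) * w $ 3 < 0)"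
    and clear: "\<And>u v. crossing D u v \<Longrightarrow> \<not> (0 \<le> b (u - x) \<and> \<bar>a (u - x)\<bar> \<le> \<delta> * (1 - b (u - x)))"
    and transverse: "\<And>z. z \<in> D \<Longrightarrow> 0 < b (z - x) \<Longrightarrow> \<bar>a (z - x)\<bar> = \<delta> * (1 - b (z - x)) \<Longrightarrow>
      b (z - x) < 1 \<and> (\<exists>e. straight_at D z e \<and> \<bar>a e\<bar> \<noteq> \<delta> * \<bar>b e\<bar>)"
begin

text \<open>The functions \<open>\<alpha>\<close>, \<open>\<beta>\<close>, \<open>\<gamma>\<close> are affine coordinates on
  space with origin \<open>x\<close>: the first two determine the projection to the plane, and
  \<open>\<gamma>\<close> is the height above the plane through \<open>x\<close> spanned by \<open>d\<close> and
  \<open>w\<close>, so that over a fixed point of the plane \<open>\<gamma>\<close> orders points as the third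
  coordinate does. The finger lies in \<open>\<gamma> = 0\<close>.\<close>
definition "\<alpha> z = a (z - x)"
definition "\<beta> z = b (z - x)"
definition "c z = z $ 3 - a z * d $ 3 - b z * w $ 3"
definition "\<gamma> z = c (z - x)"

lemma lin_c: "linear c"
  unfolding c_def
  by (rule linearI) (simp_all add: linear_add[OF lin_a] linear_add[OF lin_b] linear_cmul[OF lin_a] linear_cmul[OF lin_b] algebra_simps)

lemma coord_line:
  "\<alpha> (u + t *\<^sub>R e) = \<alpha> u + t * a e" "\<beta> (u + t *\<^sub>R e) = \<beta> u + t * b e" "\<gamma> (u + t *\<^sub>R e) = \<gamma> u + t * c e"
proof -
  have e: "u + t *\<^sub>R e - x = (u - x) + t *\<^sub>R e" by simp
  show "\<alpha> (u + t *\<^sub>R e) = \<alpha> u + t * a e" "\<beta> (u + t *\<^sub>R e) = \<beta> u + t * b e" "\<gamma> (u + t *\<^sub>R e) = \<gamma> u + t * c e"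
    unfolding \<alpha>_def \<beta>_def \<gamma>_def e by (simp_all only: linear_add linear_cmul lin_a lin_b lin_c real_scaleR_def)
qed

lemma c_basis [simp]: "c d = 0" "c w = 0" by (simp_all add: c_def basis)

lemmas [simp] = basis coord_line

lemma coord_x [simp]: "\<alpha> x = 0" "\<beta> x = 0" "\<gamma> x = 0"
  by (simp_all add: \<alpha>_def \<beta>_def \<gamma>_def linear_0 lin_a lin_b lin_c)

lemma continuous_coords [continuous_intros]:
  assumes "continuous_on S h"
  shows "continuous_on S (\<lambda>z. \<alpha> (h z))" "continuous_on S (\<lambda>z. \<beta> (h z))" "continuous_on S (\<lambda>z. \<gamma> (h z))"
proof -
  have "continuous_on UNIV \<alpha>" "continuous_on UNIV \<beta>" "continuous_on UNIV \<gamma>"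
    unfolding \<alpha>_def \<beta>_def \<gamma>_def
    by (intro linear_continuous_on_compose[OF _ lin_a] linear_continuous_on_compose[OF _ lin_b]
       linear_continuous_on_compose[OF _ lin_c] continuous_intros)+
  then show "continuous_on S (\<lambda>z. \<alpha> (h z))" "continuous_on S (\<lambda>z. \<beta> (h z))" "continuous_on S (\<lambda>z. \<gamma> (h z))"
    using assms by (auto intro: continuous_on_compose2)
qed

lemma plane_proj_iff: "plane_proj u = plane_proj v \<longleftrightarrow> \<alpha> u = \<alpha> v \<and> \<beta> u = \<beta> v"
proof -
  have "\<alpha> u - \<alpha> v = a u - a v" "\<beta> u - \<beta> v = b u - b v"
    by (simp_all add: \<alpha>_def \<beta>_def linear_diff lin_a lin_b)
  then show ?thesis using coords[of u v] by linarith
qed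

lemma gamma_diff: "\<alpha> u = \<alpha> v \<Longrightarrow> \<beta> u = \<beta> v \<Longrightarrow> \<gamma> u - \<gamma> v = u $ 3 - v $ 3"
  by (simp add: \<gamma>_def c_def \<alpha>_def \<beta>_def)

lemma coords_eqI: "\<alpha> u = \<alpha> v \<Longrightarrow> \<beta> u = \<beta> v \<Longrightarrow> \<gamma> u = \<gamma> v \<Longrightarrow> u = v"
  using gamma_diff[of u v] plane_proj_iff[of u v]
  by (simp add: plane_proj_def vec_eq_iff forall_2 forall_3)

lemma crossing_iff: "crossing K u v \<longleftrightarrow> u \<in> K \<and> v \<in> K \<and> \<alpha> u = \<alpha> v \<and> \<beta> u = \<beta> v \<and> \<gamma> u < \<gamma> v"
  unfolding crossing_def plane_proj_iff using gamma_diff[of u v] by auto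

lemma strand_iff: "\<bar>\<alpha> z\<bar> < \<rho> \<Longrightarrow> \<bar>\<beta> z\<bar> < \<rho> \<Longrightarrow> z \<in> D \<longleftrightarrow> \<beta> z = 0 \<and> \<gamma> z = 0"
proof -
  assume "\<bar>\<alpha> z\<bar> < \<rho>" "\<bar>\<beta> z\<bar> < \<rho>"
  then have "z \<in> D \<longleftrightarrow> z = x + \<alpha> z *\<^sub>R d" using strand[of z] by (simp add: \<alpha>_def \<beta>_def)
  also have "\<dots> \<longleftrightarrow> \<beta> z = 0 \<and> \<gamma> z = 0"
  proof -
    have "\<alpha> (x + \<alpha> z *\<^sub>R d) = \<alpha> z" "\<beta> (x + \<alpha> z *\<^sub>R d) = 0" "\<gamma> (x + \<alpha> z *\<^sub>R d) = 0" by simp_all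
    then show ?thesis using coords_eqI[of z "x + \<alpha> z *\<^sub>R d"] by metis
  qed
  finally show ?thesis .
qed

lemma away_coords: "z \<in> D \<Longrightarrow> \<bar>\<alpha> z\<bar> < \<rho> \<Longrightarrow> \<rho> \<le> \<bar>\<beta> z\<bar> \<Longrightarrow> \<delta> \<le> \<bar>\<gamma> z\<bar> \<and> (0 < \<beta> z \<longrightarrow> \<gamma> z < 0)"
  using away[of z] unfolding \<alpha>_def \<beta>_def \<gamma>_def c_def by simp

lemma clear_coords: "crossing D u v \<Longrightarrow> 0 \<le> \<beta> u \<Longrightarrow> \<not> \<bar>\<alpha> u\<bar> \<le> \<delta> * (1 - \<beta> u)"
  using clear[of u v] unfolding \<alpha>_def \<beta>_def by simp

lemma transverse_coords:
  assumes "z \<in> D" "0 < \<beta> z" "\<bar>\<alpha> z\<bar> = \<delta> * (1 - \<beta> z)"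
  shows "\<beta> z < 1" "\<exists>e. straight_at D z e \<and> \<bar>a e\<bar> \<noteq> \<delta> * \<bar>b e\<bar>"
  using transverse[of z] assms unfolding \<alpha>_def \<beta>_def by auto

text \<open>The tent function \<open>bump\<close> depends on \<open>\<alpha>\<close> and \<open>\<gamma>\<close> only, hence is
  invariant under translation by multiples of \<open>w\<close>. On the strand it is \<open>1 -
  |\<alpha>|/\<delta>\<close>, so the shear turns the segment \<open>|\<alpha>| \<le> \<delta>\<close> of the strand
  into two straight sides that meet at \<open>x + w\<close>. The rest of the diagram lies outside the support.\<close>
definition "bump z = max 0 (1 - (\<bar>\<alpha> z\<bar> + \<bar>\<gamma> z\<bar>) / \<delta>)"
definition "D' = shear bump w ` D"
definition "kept = {z \<in> D. \<delta> \<le> \<bar>\<alpha> z\<bar> + \<bar>\<gamma> z\<bar>}"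
definition "sides = {z. \<gamma> z = 0 \<and> 0 \<le> \<beta> z \<and> \<bar>\<alpha> z\<bar> = \<delta> * (1 - \<beta> z)}"

lemma continuous_bump: "continuous_on UNIV bump"
  unfolding bump_def using \<delta> by (intro continuous_intros) auto

lemma bump_invariant: "bump (z + s *\<^sub>R w) = bump z"
  by (simp add: bump_def)

lemma isotopic_D': "isotopic D D'"
  unfolding D'_def by (rule isotopic_shear[OF continuous_bump bump_invariant])

lemma removed: "z \<in> D \<Longrightarrow> z \<notin> kept \<Longrightarrow> \<bar>\<alpha> z\<bar> < \<delta> \<and> \<beta> z = 0 \<and> \<gamma> z = 0"
  using strand_iff[of z] away_coords[of z] \<delta> unfolding kept_def by fastforce

lemma D_eq_strand: "\<bar>\<alpha> z\<bar> < \<rho> \<Longrightarrow> \<beta> z = 0 \<Longrightarrow> \<gamma> z = 0 \<Longrightarrow> z \<in> D"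
  using strand_iff[of z] \<delta> by auto

lemma sides_bounds: "z \<in> sides \<Longrightarrow> \<beta> z \<le> 1 \<and> \<bar>\<alpha> z\<bar> \<le> \<delta>"
proof -
  assume z: "z \<in> sides"
  then have "0 \<le> \<delta> * (1 - \<beta> z)" unfolding sides_def by (smt (verit) mem_Collect_eq)
  then have "\<beta> z \<le> 1" using \<delta> by (simp add: zero_le_mult_iff)
  moreover have "\<delta> * (1 - \<beta> z) \<le> \<delta> * 1" using z \<delta> by (intro mult_left_mono) (auto simp: sides_def)
  ultimately show ?thesis using z unfolding sides_def by auto
qed

text \<open>The shear fixes the points of \<open>D\<close> outside the support of \<open>bump\<close> and maps the short segment
  of the strand onto the two sides.\<close>
lemma D'_eq: "D' = kept \<union> sides"
proof (intro equalityI subsetI)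
  fix y assume "y \<in> D'"
  then obtain z where z: "z \<in> D" "y = z + bump z *\<^sub>R w" by (auto simp: D'_def shear_def)
  show "y \<in> kept \<union> sides"
  proof (cases "z \<in> kept")
    case True
    then have "bump z = 0" using \<delta> by (simp add: bump_def kept_def)
    then show ?thesis using z True by simp
  next
    case False
    then have r: "\<bar>\<alpha> z\<bar> < \<delta>" "\<beta> z = 0" "\<gamma> z = 0" using removed z by auto
    then have "bump z = 1 - \<bar>\<alpha> z\<bar> / \<delta>" using \<delta> by (simp add: bump_def)
    moreover have "0 \<le> bump z" by (simp add: bump_def)
    ultimately show ?thesis using r z(2) \<delta> by (auto simp: sides_def field_simps)
  qed
next
  fix y assume "y \<in> kept \<union> sides"
  then show "y \<in> D'"
  proof
    assume y: "y \<in> kept"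
    then have "bump y = 0" using \<delta> by (simp add: bump_def kept_def)
    then have "shear bump w y = y" by (simp add: shear_def)
    then show ?thesis using y unfolding D'_def kept_def by (metis (no_types, lifting) image_eqI mem_Collect_eq)
  next
    assume y: "y \<in> sides"
    define z where "z = x + \<alpha> y *\<^sub>R d"
    have z: "\<alpha> z = \<alpha> y" "\<beta> z = 0" "\<gamma> z = 0" by (auto simp: z_def)
    have "z \<in> D" using sides_bounds[OF y] \<delta> z by (intro D_eq_strand) auto
    moreover have "\<bar>\<alpha> y\<bar> / \<delta> = 1 - \<beta> y" using y \<delta> by (simp add: sides_def)
    then have "bump z = \<beta> y"
      using y z unfolding bump_def sides_def by simp
    then have "shear bump w z = y" using y z by (intro coords_eqI) (auto simp: shear_def sides_def)
    ultimately show ?thesis unfolding D'_def by blast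
  qed
qed

definition "pt_P = x - \<delta> *\<^sub>R d"
definition "pt_Q = x + \<delta> *\<^sub>R d"
definition "apex = x + w"

lemma coords_triangle:
  "\<alpha> pt_P = -\<delta>" "\<beta> pt_P = 0" "\<gamma> pt_P = 0" "\<alpha> pt_Q = \<delta>" "\<beta> pt_Q = 0" "\<gamma> pt_Q = 0" "\<alpha> apex = 0" "\<beta> apex = 1" "\<gamma> apex = 0"
  using coord_line[of x "-\<delta>" d] coord_line[of x 1 w] by (simp_all add: pt_P_def pt_Q_def apex_def)

lemma sides_eq_segments: "sides = closed_segment pt_P apex \<union> closed_segment pt_Q apex"
proof -
  have cc: "\<alpha> ((1-u) *\<^sub>R p + u *\<^sub>R q) = (1-u) * \<alpha> p + u * \<alpha> q" "\<beta> ((1-u) *\<^sub>R p + u *\<^sub>R q) = (1-u) * \<beta> p + u * \<beta> q"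
    "\<gamma> ((1-u) *\<^sub>R p + u *\<^sub>R q) = (1-u) * \<gamma> p + u * \<gamma> q" for u p q
  proof -
    have e: "(1-u) *\<^sub>R p + u *\<^sub>R q - x = (1-u) *\<^sub>R (p - x) + u *\<^sub>R (q - x)" by (simp add: algebra_simps)
    show "\<alpha> ((1-u) *\<^sub>R p + u *\<^sub>R q) = (1-u) * \<alpha> p + u * \<alpha> q" "\<beta> ((1-u) *\<^sub>R p + u *\<^sub>R q) = (1-u) * \<beta> p + u * \<beta> q"
    "\<gamma> ((1-u) *\<^sub>R p + u *\<^sub>R q) = (1-u) * \<gamma> p + u * \<gamma> q"
      unfolding \<alpha>_def \<beta>_def \<gamma>_def e by (simp_all only: linear_add linear_cmul lin_a lin_b lin_c real_scaleR_def)
  qed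
  show ?thesis
  proof (intro equalityI subsetI)
    fix z assume z: "z \<in> sides"
    then have bz: "0 \<le> \<beta> z" "\<beta> z \<le> 1" using sides_bounds by (auto simp: sides_def)
    show "z \<in> closed_segment pt_P apex \<union> closed_segment pt_Q apex"
    proof (cases "\<alpha> z \<le> 0")
      case True
      have "z = (1 - \<beta> z) *\<^sub>R pt_P + \<beta> z *\<^sub>R apex"
        using z True mult.commute[of \<delta> "1 - \<beta> z"] by (intro coords_eqI) (auto simp: cc coords_triangle sides_def simp del: coord_line)
      then show ?thesis using bz by (auto simp: in_segment)
    next
      case False
      have "z = (1 - \<beta> z) *\<^sub>R pt_Q + \<beta> z *\<^sub>R apex"
        using z False mult.commute[of \<delta> "1 - \<beta> z"] by (intro coords_eqI) (auto simp: cc coords_triangle sides_def simp del: coord_line)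
      then show ?thesis using bz by (auto simp: in_segment)
    qed
  next
    fix z assume "z \<in> closed_segment pt_P apex \<union> closed_segment pt_Q apex"
    then show "z \<in> sides"
      using \<delta> by (auto simp: in_segment sides_def cc coords_triangle abs_mult simp del: coord_line)
  qed
qed

lemma polygonal_D': "polygonal_link D'"
proof -
  obtain E where E: "finite E" "D = (\<Union>(a, b)\<in>E. closed_segment a b)" using diagram_segments[OF D] .
  define C where "C = {z. \<bar>\<alpha> z\<bar> + \<bar>\<gamma> z\<bar> < \<delta>}"
  have "open C" unfolding C_def by (intro open_Collect_less continuous_intros)
  moreover have "convex C"
  proof (rule convexI)
    fix p q :: "real^3" and u v :: real assume A: "p \<in> C" "q \<in> C" "0 \<le> u" "0 \<le> v" "u + v = 1"
    have e: "u *\<^sub>R p + v *\<^sub>R q - x = u *\<^sub>R (p - x) + v *\<^sub>R (q - x)"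
      using A(5) by (simp add: algebra_simps flip: scaleR_left_distrib)
    have "\<alpha> (u *\<^sub>R p + v *\<^sub>R q) = u * \<alpha> p + v * \<alpha> q" "\<gamma> (u *\<^sub>R p + v *\<^sub>R q) = u * \<gamma> p + v * \<gamma> q"
      unfolding \<alpha>_def \<gamma>_def e by (simp_all only: linear_add linear_cmul lin_a lin_c real_scaleR_def)
    moreover have "\<bar>u * s + v * t\<bar> \<le> u * \<bar>s\<bar> + v * \<bar>t\<bar>" for s t
      using A by (metis abs_mult abs_of_nonneg abs_triangle_ineq)
    ultimately have "\<bar>\<alpha> (u *\<^sub>R p + v *\<^sub>R q)\<bar> + \<bar>\<gamma> (u *\<^sub>R p + v *\<^sub>R q)\<bar> \<le>
        u * (\<bar>\<alpha> p\<bar> + \<bar>\<gamma> p\<bar>) + v * (\<bar>\<alpha> q\<bar> + \<bar>\<gamma> q\<bar>)"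
      by (simp add: distrib_left add_mono add.assoc add.left_commute) (smt (verit))
    also have "\<dots> < \<delta>" using convex_bound_lt[of "\<bar>\<alpha> p\<bar> + \<bar>\<gamma> p\<bar>" \<delta> "\<bar>\<alpha> q\<bar> + \<bar>\<gamma> q\<bar>" u v] A by (simp add: C_def)
    finally show "u *\<^sub>R p + v *\<^sub>R q \<in> C" by (simp add: C_def)
  qed
  ultimately obtain E' where E': "finite E'" "D - C = (\<Union>(a, b)\<in>E'. closed_segment a b)"
    using segments_minus_open_convex[OF _ _ E] by meson
  have "kept = D - C" by (auto simp: kept_def C_def)
  then have "D' = (\<Union>(a, b)\<in>E' \<union> {(pt_P, apex), (pt_Q, apex)}. closed_segment a b)"
    unfolding D'_eq sides_eq_segments using E' by auto
  then show ?thesis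
    unfolding D'_def using D E'(1) homeomorphism_shear[OF continuous_bump bump_invariant]
    by (intro polygonal_link_homeomorphic_image[of D _ _ "E' \<union> {(pt_P, apex), (pt_Q, apex)}"]) (auto simp: is_diagram_def)
qed


section \<open>Crossings of the new diagram\<close>

definition "lift u = x + \<alpha> u *\<^sub>R d + \<beta> u *\<^sub>R w"

lemma coord_lift [simp]: "\<alpha> (lift u) = \<alpha> u" "\<beta> (lift u) = \<beta> u" "\<gamma> (lift u) = 0"
  by (simp_all add: lift_def)

text \<open>Over the triangle but away from its base the diagram is far from \<open>x\<close>, where it stays below the plane of
  the finger.\<close>
lemma over_triangle:
  assumes "z \<in> D" "0 < \<beta> z" "\<bar>\<alpha> z\<bar> \<le> \<delta> * (1 - \<beta> z)"
  shows "\<gamma> z < 0"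
proof -
  have "\<delta> * (1 - \<beta> z) \<le> \<delta> * 1" using assms(2) \<delta> by (intro mult_left_mono) auto
  then have "\<bar>\<alpha> z\<bar> < \<rho>" using assms(3) \<delta> by linarith
  then show ?thesis using strand_iff[of z] away_coords[of z] assms \<delta> by fastforce
qed

lemma kept_end_of_side: "z \<in> D \<Longrightarrow> z \<in> sides \<Longrightarrow> \<beta> z = 0 \<and> \<bar>\<alpha> z\<bar> = \<delta> \<and> \<gamma> z = 0"
  using over_triangle[of z] unfolding sides_def by fastforce

lemma D_base: "z \<in> D \<Longrightarrow> \<beta> z = 0 \<Longrightarrow> \<bar>\<alpha> z\<bar> \<le> \<delta> \<Longrightarrow> \<gamma> z = 0"
  using strand_iff[of z] \<delta> by auto

lemma clear_crossing:
  assumes "crossing D u v" "z = u \<or> z = v" "0 \<le> \<beta> z"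
  shows "\<not> \<bar>\<alpha> z\<bar> \<le> \<delta> * (1 - \<beta> z)"
  using clear_coords[of u v] assms by (auto simp: crossing_iff)

lemma kept_in_D: "z \<in> kept \<Longrightarrow> z \<in> D" by (simp add: kept_def)

lemma off_triangle_kept:
  assumes "z \<in> D" "0 \<le> \<beta> z \<Longrightarrow> \<not> \<bar>\<alpha> z\<bar> \<le> \<delta> * (1 - \<beta> z)"
  shows "z \<in> kept"
  using removed[of z] assms by fastforce

lemma crossing_off_sides:
  assumes "crossing D u v" "z = u \<or> z = v"
  shows "z \<in> kept \<and> z \<notin> sides"
proof -
  have "z \<in> D" using assms by (auto simp: crossing_def)
  then show ?thesis using clear_crossing[OF assms] off_triangle_kept[of z] unfolding sides_def by fastforce
qed

lemma off_base_kept: "z \<in> D \<Longrightarrow> \<beta> z \<noteq> 0 \<Longrightarrow> z \<in> kept"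
  using removed[of z] by fastforce

text \<open>The old crossings survive, as none of them is near the finger, and every point of \<open>D\<close> below a side of
  the finger becomes an under-crossing point. No other crossings arise: the finger is above everything that it
  meets, and its two sides have only the tip in common.\<close>
lemma crossing_D':
  "crossing D' u v \<longleftrightarrow> crossing D u v \<or> (u \<in> D \<and> 0 < \<beta> u \<and> \<bar>\<alpha> u\<bar> = \<delta> * (1 - \<beta> u) \<and> v = lift u)"
proof
  assume c: "crossing D' u v"
  then have uv: "u \<in> kept \<union> sides" "v \<in> kept \<union> sides" "\<alpha> u = \<alpha> v" "\<beta> u = \<beta> v" "\<gamma> u < \<gamma> v"
    unfolding crossing_iff D'_eq by blast+
  consider "u \<in> kept" "v \<in> kept" | "u \<in> kept" "v \<in> sides" | "u \<in> sides" using uv by blast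
  then show "crossing D u v \<or> (u \<in> D \<and> 0 < \<beta> u \<and> \<bar>\<alpha> u\<bar> = \<delta> * (1 - \<beta> u) \<and> v = lift u)"
  proof cases
    case 1
    then show ?thesis using uv kept_in_D by (simp add: crossing_iff)
  next
    case 2
    then have v: "\<gamma> v = 0" "0 \<le> \<beta> u" "\<bar>\<alpha> u\<bar> = \<delta> * (1 - \<beta> u)" using uv by (auto simp: sides_def)
    have "\<beta> u \<noteq> 0"
    proof
      assume "\<beta> u = 0"
      then have "\<gamma> u = 0" using v D_base[of u] kept_in_D[OF 2(1)] by simp
      then show False using uv v by simp
    qed
    moreover have "v = lift u" by (rule coords_eqI) (use v uv in simp_all)
    ultimately show ?thesis using v kept_in_D[OF 2(1)] by simp
  next
    case 3
    then have u: "\<gamma> u = 0" "0 \<le> \<beta> u" "\<bar>\<alpha> u\<bar> = \<delta> * (1 - \<beta> u)" by (auto simp: sides_def)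
    then have "v \<notin> sides" using uv by (auto simp: sides_def)
    then have v: "v \<in> D" using uv kept_in_D by auto
    have "\<gamma> v \<le> 0"
      using over_triangle[OF v] D_base[OF v] u uv by (cases "\<beta> v = 0") auto
    then show ?thesis using u uv by simp
  qed
next
  assume "crossing D u v \<or> (u \<in> D \<and> 0 < \<beta> u \<and> \<bar>\<alpha> u\<bar> = \<delta> * (1 - \<beta> u) \<and> v = lift u)"
  then show "crossing D' u v"
  proof
    assume c: "crossing D u v"
    then have "u \<in> kept" "v \<in> kept"
      using clear_crossing[OF c] off_triangle_kept by (auto simp: crossing_def)
    then show ?thesis using c by (auto simp: crossing_iff D'_eq)
  next
    assume a: "u \<in> D \<and> 0 < \<beta> u \<and> \<bar>\<alpha> u\<bar> = \<delta> * (1 - \<beta> u) \<and> v = lift u"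
    then have "\<gamma> u < 0" using over_triangle[of u] by simp
    moreover have "u \<in> kept" using off_base_kept[of u] a by simp
    moreover have "v \<in> sides" using a by (auto simp: sides_def)
    ultimately show ?thesis using a by (auto simp: crossing_iff D'_eq)
  qed
qed

lemma closed_sides: "closed sides"
  unfolding sides_def by (intro closed_Collect_conj closed_Collect_eq closed_Collect_le continuous_intros)

lemma closed_kept: "closed kept"
proof -
  have "kept = D \<inter> {z. \<delta> \<le> \<bar>\<alpha> z\<bar> + \<bar>\<gamma> z\<bar>}" by (auto simp: kept_def)
  moreover have "closed {z. \<delta> \<le> \<bar>\<alpha> z\<bar> + \<bar>\<gamma> z\<bar>}" by (intro closed_Collect_le continuous_intros)
  ultimately show ?thesis using compact_imp_closed[OF diagram_compact[OF D]] by (simp add: closed_Int)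
qed

lemma D'_locally_eq_D:
  assumes z: "z \<in> kept" "z \<notin> sides"
  shows "\<exists>e>0. D' \<inter> ball z e = D \<inter> ball z e"
proof -
  define S where "S = - sides \<inter> - {y. \<bar>\<alpha> y\<bar> \<le> \<delta> \<and> \<beta> y = 0 \<and> \<gamma> y = 0}"
  have "closed {y. \<bar>\<alpha> y\<bar> \<le> \<delta> \<and> \<beta> y = 0 \<and> \<gamma> y = 0}"
    by (intro closed_Collect_conj closed_Collect_eq closed_Collect_le continuous_intros)
  then have "open S" unfolding S_def using closed_sides by (simp add: open_Compl open_Int)
  moreover have "z \<in> S" using z unfolding S_def by (auto simp: sides_def kept_def)
  ultimately obtain e where e: "e > 0" "ball z e \<subseteq> S" using openE by blast
  have "y \<in> D' \<longleftrightarrow> y \<in> D" if "y \<in> S" for y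
    using that removed[of y] unfolding D'_eq S_def by (cases "y \<in> kept") (auto simp: kept_in_D)
  then show ?thesis using e by blast
qed

lemma straight_at_D'_iff:
  assumes z: "z \<in> kept" "z \<notin> sides"
  shows "straight_at D' z e \<longleftrightarrow> straight_at D z e"
  using D'_locally_eq_D[OF z] straight_at_cong_locally by metis

text \<open>The direction of the side that contains \<open>z\<close>, with increasing \<open>\<beta>\<close>: the sign of
  \<open>\<alpha> z\<close> tells the two sides apart.\<close>
definition "side_dir z = w - (sgn (\<alpha> z) * \<delta>) *\<^sub>R d"

lemma side_dir_coords [simp]: "a (side_dir z) = - (sgn (\<alpha> z) * \<delta>)" "b (side_dir z) = 1" "c (side_dir z) = 0"
  unfolding side_dir_def
  by (simp_all add: linear_diff[OF lin_a] linear_diff[OF lin_b] linear_diff[OF lin_c] linear_cmul[OF lin_a] linear_cmul[OF lin_b] linear_cmul[OF lin_c])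

text \<open>Near such a point the kept part of \<open>D\<close> and the other side are absent.\<close>
lemma straight_at_sides:
  assumes z: "z \<in> sides" "z \<notin> D" "0 < \<beta> z" "\<beta> z < 1"
  shows "straight_at D' z (side_dir z)"
proof -
  define \<sigma> where "\<sigma> = sgn (\<alpha> z)"
  have zF: "\<gamma> z = 0" "\<bar>\<alpha> z\<bar> = \<delta> * (1 - \<beta> z)" using z by (auto simp: sides_def)
  then have "\<alpha> z \<noteq> 0" using z \<delta> by auto
  then have \<sigma>: "\<sigma> = 1 \<or> \<sigma> = -1" "\<bar>\<alpha> z\<bar> = \<sigma> * \<alpha> z" by (auto simp: \<sigma>_def sgn_if)
  define S where "S = {y. 0 < \<sigma> * \<alpha> y} \<inter> {y. 0 < \<beta> y} \<inter> - kept"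
  have "open S" unfolding S_def using closed_kept
    by (intro open_Int open_Collect_less continuous_intros open_Compl)
  moreover have "z \<in> S" using z kept_in_D \<sigma> \<open>\<alpha> z \<noteq> 0\<close> unfolding S_def by auto
  moreover have "side_dir z \<noteq> 0"
    using linear_0[OF lin_b] side_dir_coords(2)[of z] by (metis zero_neq_one)
  moreover have "D' \<inter> S = range (\<lambda>t. z + t *\<^sub>R side_dir z) \<inter> S"
  proof (intro equalityI subsetI)
    fix y assume y: "y \<in> D' \<inter> S"
    then have "\<gamma> y = 0" "\<bar>\<alpha> y\<bar> = \<delta> * (1 - \<beta> y)" by (auto simp: D'_eq S_def sides_def)
    moreover have "\<bar>\<alpha> y\<bar> = \<sigma> * \<alpha> y" using y \<sigma>(1) by (auto simp: S_def)
    ultimately have "\<alpha> y = \<alpha> z + (\<beta> y - \<beta> z) * - (\<sigma> * \<delta>)" "\<gamma> y = 0"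
      using zF \<sigma> by (auto simp: algebra_simps)
    then have "y = z + (\<beta> y - \<beta> z) *\<^sub>R side_dir z"
      by (intro coords_eqI) (simp_all add: zF flip: \<sigma>_def)
    then show "y \<in> range (\<lambda>t. z + t *\<^sub>R side_dir z) \<inter> S" using y by blast
  next
    fix y assume y: "y \<in> range (\<lambda>t. z + t *\<^sub>R side_dir z) \<inter> S"
    then obtain t where t: "y = z + t *\<^sub>R side_dir z" by blast
    then have c: "\<alpha> y = \<alpha> z - t * (\<sigma> * \<delta>)" "\<beta> y = \<beta> z + t" "\<gamma> y = 0" using zF by (simp_all add: \<sigma>_def)
    have "\<bar>\<alpha> y\<bar> = \<sigma> * \<alpha> y" "0 < \<beta> y" using y \<sigma>(1) by (auto simp: S_def)
    then have "y \<in> sides" using c zF \<sigma> by (auto simp: sides_def algebra_simps)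
    then show "y \<in> D' \<inter> S" using y by (auto simp: D'_eq)
  qed
  ultimately show ?thesis by (rule straight_at_openI)
qed

text \<open>Where \<open>\<beta>\<close> is positive, \<open>excess\<close> is negative over the interior of the triangle, zero
  over its sides, and positive elsewhere.\<close>
definition "excess z = \<bar>\<alpha> z\<bar> - \<delta> * (1 - \<beta> z)"

text \<open>Away from the tip \<open>\<alpha>\<close> has a constant sign near a point over a side, so that
  \<open>excess\<close> is linear along a line. Its slope is nonzero by transversality, so the line passes from one
  side of the boundary of the triangle to the other.\<close>
lemma excess_linear_near:
  assumes "0 < \<beta> u" "\<bar>\<alpha> u\<bar> = \<delta> * (1 - \<beta> u)" "\<beta> u < 1" "\<bar>a e\<bar> \<noteq> \<delta> * \<bar>b e\<bar>"
  shows "\<exists>s. s \<noteq> 0 \<and> (\<forall>\<^sub>F t in at 0. 0 < \<beta> (u + t *\<^sub>R e) \<and> excess (u + t *\<^sub>R e) = t * s)"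
proof -
  define \<sigma> where "\<sigma> = sgn (\<alpha> u)"
  have "\<alpha> u \<noteq> 0" using assms \<delta> by auto
  then have \<sigma>: "\<sigma> = 1 \<or> \<sigma> = -1" "\<bar>\<alpha> u\<bar> = \<sigma> * \<alpha> u" by (auto simp: \<sigma>_def sgn_if)
  define s where "s = \<sigma> * a e + \<delta> * b e"
  have s0: "s \<noteq> 0"
  proof
    assume "s = 0"
    then have "\<bar>\<sigma> * a e\<bar> = \<bar>\<delta> * b e\<bar>" unfolding s_def by linarith
    then show False using assms(4) \<sigma>(1) \<delta> by (auto simp: abs_mult)
  qed
  have "\<forall>\<^sub>F t in at 0. 0 < \<sigma> * \<alpha> (u + t *\<^sub>R e)"
  proof (rule order_tendstoD(1))
    show "((\<lambda>t. \<sigma> * \<alpha> (u + t *\<^sub>R e)) \<longlongrightarrow> \<sigma> * (\<alpha> u + 0 * a e)) (at 0)"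
      unfolding coord_line by (intro tendsto_intros)
    show "0 < \<sigma> * (\<alpha> u + 0 * a e)" using \<sigma> \<open>\<alpha> u \<noteq> 0\<close> by auto
  qed
  moreover have "\<forall>\<^sub>F t in at 0. 0 < \<beta> (u + t *\<^sub>R e)"
  proof (rule order_tendstoD(1))
    show "((\<lambda>t. \<beta> (u + t *\<^sub>R e)) \<longlongrightarrow> \<beta> u + 0 * b e) (at 0)"
      unfolding coord_line by (intro tendsto_intros)
    show "0 < \<beta> u + 0 * b e" using assms by auto
  qed
  ultimately have "\<forall>\<^sub>F t in at 0. 0 < \<beta> (u + t *\<^sub>R e) \<and> excess (u + t *\<^sub>R e) = t * s"
  proof (eventually_elim)
    case (elim t)
    then have "\<bar>\<alpha> (u + t *\<^sub>R e)\<bar> = \<sigma> * \<alpha> (u + t *\<^sub>R e)" using \<sigma>(1) by auto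
    then have "excess (u + t *\<^sub>R e) = \<sigma> * \<alpha> u + t * (\<sigma> * a e) - \<delta> * (1 - \<beta> u) + t * (\<delta> * b e)"
      unfolding excess_def by (simp add: algebra_simps)
    then show ?case using elim assms(2) \<sigma>(2) by (simp add: s_def algebra_simps)
  qed
  then show ?thesis using s0 by blast
qed

text \<open>A limit point of these points would be over a closed side. It is not over the base, since only the strand is near
  the base, and elsewhere transversality isolates the points.\<close>
lemma finite_new_under: "finite {u \<in> D. 0 < \<beta> u \<and> \<bar>\<alpha> u\<bar> = \<delta> * (1 - \<beta> u)}" (is "finite ?X")
proof (rule ccontr)
  assume inf: "infinite ?X"
  define Y where "Y = D \<inter> {u. 0 \<le> \<beta> u \<and> \<bar>\<alpha> u\<bar> = \<delta> * (1 - \<beta> u)}"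
  have "closed {u. 0 \<le> \<beta> u \<and> \<bar>\<alpha> u\<bar> = \<delta> * (1 - \<beta> u)}"
    by (intro closed_Collect_conj closed_Collect_eq closed_Collect_le continuous_intros)
  then have "compact Y" unfolding Y_def using diagram_compact[OF D] by (simp add: compact_Int_closed)
  moreover have "?X \<subseteq> Y" by (auto simp: Y_def)
  ultimately obtain u where u: "u \<in> Y" "u islimpt ?X" using inf compact_eq_Bolzano_Weierstrass[of Y] by blast
  have "\<forall>\<^sub>F y in at u within D. y \<notin> ?X"
  proof (cases "\<beta> u = 0")
    case True
    then have "\<bar>\<alpha> u\<bar> < \<rho>" "\<bar>\<beta> u\<bar> < \<rho>" using u(1) \<delta> by (auto simp: Y_def)
    moreover have "open {y. \<bar>\<alpha> y\<bar> < \<rho> \<and> \<bar>\<beta> y\<bar> < \<rho>}"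
      by (intro open_Collect_conj open_Collect_less continuous_intros)
    ultimately have "\<forall>\<^sub>F y in at u within D. y \<in> {y. \<bar>\<alpha> y\<bar> < \<rho> \<and> \<bar>\<beta> y\<bar> < \<rho>} \<and> y \<in> D"
      by (intro eventually_at_within_open) auto
    then show ?thesis by eventually_elim (use strand_iff in auto)
  next
    case False
    then have u1: "u \<in> D" "0 < \<beta> u" "\<bar>\<alpha> u\<bar> = \<delta> * (1 - \<beta> u)" using u(1) by (auto simp: Y_def)
    then obtain e where e: "straight_at D u e" "\<bar>a e\<bar> \<noteq> \<delta> * \<bar>b e\<bar>" using transverse_coords by blast
    obtain s where s: "s \<noteq> 0" "\<forall>\<^sub>F t in at 0. 0 < \<beta> (u + t *\<^sub>R e) \<and> excess (u + t *\<^sub>R e) = t * s"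
      using excess_linear_near[OF u1(2,3) transverse_coords(1)[OF u1] e(2)] by blast
    have "\<forall>\<^sub>F t in at 0. u + t *\<^sub>R e \<notin> ?X"
      using s(2) eventually_neq_at_within[of 0 0 UNIV]
      by eventually_elim (use s(1) in \<open>auto simp: excess_def\<close>)
    then show ?thesis by (rule straight_at_punctured_coverage[OF e(1)])
  qed
  then obtain S where S: "open S" "u \<in> S" "\<And>y. y \<in> S \<Longrightarrow> y \<noteq> u \<Longrightarrow> y \<in> D \<Longrightarrow> y \<notin> ?X"
    unfolding eventually_at_topological by blast
  then show False using u(2) unfolding islimpt_def by blast
qed

lemma independent_if_det:
  assumes "a e * b f \<noteq> b e * a f"
  shows "plane_proj e \<noteq> plane_proj f" "independent {plane_proj e, plane_proj f}"
proof -
  have k: False if "plane_proj e = k *\<^sub>R plane_proj f" for k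
  proof -
    have "plane_proj e = plane_proj (k *\<^sub>R f)" using that by (simp add: linear_cmul[OF plane_proj_linear])
    then have "a e = k * a f" "b e = k * b f" using coords by (auto simp: linear_cmul[OF lin_a] linear_cmul[OF lin_b])
    then show False using assms by simp
  qed
  have f0: "plane_proj f \<noteq> 0"
  proof
    assume "plane_proj f = 0"
    then have "plane_proj f = plane_proj 0" by (simp add: linear_0[OF plane_proj_linear])
    then have "a f = 0" "b f = 0" using coords linear_0[OF lin_a] linear_0[OF lin_b] by auto
    then show False using assms by simp
  qed
  show ne: "plane_proj e \<noteq> plane_proj f" using k[of 1] by auto
  have "plane_proj e \<notin> span {plane_proj f}" using k by (auto simp: span_singleton)
  then show "independent {plane_proj e, plane_proj f}"
    using f0 ne by (simp add: independent_insert)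
qed

text \<open>Over a side of the finger there is at most one point of \<open>D\<close>, because two would form a crossing over the
  triangle. Together with the point on the finger this makes at most two.\<close>
lemma regular_D': "regular_position D'"
  unfolding regular_position_def
proof (intro conjI allI impI)
  let ?X = "{u \<in> D. 0 < \<beta> u \<and> \<bar>\<alpha> u\<bar> = \<delta> * (1 - \<beta> u)}"
  have "{(u, v). crossing D' u v} \<subseteq> {(u, v). crossing D u v} \<union> (\<lambda>u. (u, lift u)) ` ?X"
    by (auto simp: crossing_D')
  then show "finite {(u, v). crossing D' u v}"
    using finite_new_under diagram_finite_crossings[OF D] finite_subset by (metis (no_types, lifting) finite_UnI finite_imageI)
next
  fix q :: "real^2"
  have fibD: "card {y \<in> D. plane_proj y = q} \<le> 2" "finite {y \<in> D. plane_proj y = q}"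
    using D unfolding is_diagram_def regular_position_def by blast+
  have "\<exists>S. finite S \<and> card S \<le> 2 \<and> {y \<in> D'. plane_proj y = q} \<subseteq> S"
  proof (cases "\<exists>f\<in>sides. plane_proj f = q")
    case False
    then have "{y \<in> D'. plane_proj y = q} \<subseteq> {y \<in> D. plane_proj y = q}" by (auto simp: D'_eq kept_in_D)
    then show ?thesis using fibD by blast
  next
    case True
    then obtain f where f: "f \<in> sides" "plane_proj f = q" by blast
    then have fc: "\<gamma> f = 0" "0 \<le> \<beta> f" "\<bar>\<alpha> f\<bar> = \<delta> * (1 - \<beta> f)" by (auto simp: sides_def)
    have Fgu: "y = f" if "y \<in> sides" "plane_proj y = q" for y
      using that f plane_proj_iff[of y f] by (intro coords_eqI) (auto simp: sides_def)
    have Du: "y = z" if yz: "y \<in> D" "plane_proj y = q" "z \<in> D" "plane_proj z = q" for y z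
    proof (rule ccontr)
      assume ne: "y \<noteq> z"
      have c: "\<alpha> y = \<alpha> f" "\<beta> y = \<beta> f" "\<alpha> z = \<alpha> f" "\<beta> z = \<beta> f" using yz f plane_proj_iff by metis+
      then have "\<gamma> y \<noteq> \<gamma> z" using ne coords_eqI by metis
      then have "crossing D y z \<or> crossing D z y" using yz c by (auto simp: crossing_iff)
      then show False using clear_crossing[of y z y] clear_crossing[of z y y] c fc by auto
    qed
    show ?thesis
    proof (cases "\<exists>y\<in>kept. plane_proj y = q")
      case True
      then obtain y where y: "y \<in> kept" "plane_proj y = q" by blast
      then have "{y \<in> D'. plane_proj y = q} \<subseteq> {f, y}" using Fgu Du kept_in_D by (auto simp: D'_eq)
      moreover have "card {f, y} \<le> 2" by (simp add: card_insert_if)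
      ultimately show ?thesis by (intro exI[of _ "{f, y}"]) auto
    next
      case False
      then have "{y \<in> D'. plane_proj y = q} \<subseteq> {f}" using Fgu by (auto simp: D'_eq)
      then show ?thesis by (intro exI[of _ "{f}"]) auto
    qed
  qed
  then obtain S where S: "finite S" "card S \<le> 2" "{y \<in> D'. plane_proj y = q} \<subseteq> S" by blast
  show "card {y \<in> D'. plane_proj y = q} \<le> 2" using card_mono[OF S(1,3)] S(2) by linarith
  show "finite {y \<in> D'. plane_proj y = q}" using S finite_subset by blast
next
  fix u v assume "crossing D' u v"
  then consider "crossing D u v" | "u \<in> D" "0 < \<beta> u" "\<bar>\<alpha> u\<bar> = \<delta> * (1 - \<beta> u)" "v = lift u"
    by (auto simp: crossing_D')
  then show "\<exists>d d'. straight_at D' u d \<and> straight_at D' v d' \<and> plane_proj d \<noteq> plane_proj d' \<and>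
      independent {plane_proj d, plane_proj d'}"
  proof cases
    case 1
    then have "u \<in> kept" "v \<in> kept" "u \<notin> sides" "v \<notin> sides"
      using crossing_off_sides[OF 1, of u] crossing_off_sides[OF 1, of v] by simp_all
    then show ?thesis
      using D 1 straight_at_D'_iff[of u] straight_at_D'_iff[of v] unfolding is_diagram_def regular_position_def by simp
  next
    case 2
    obtain e where e: "straight_at D u e" "\<bar>a e\<bar> \<noteq> \<delta> * \<bar>b e\<bar>" using transverse_coords[of u] 2 by blast
    have "\<gamma> u < 0" using over_triangle[of u] 2 by simp
    then have "u \<notin> sides" by (auto simp: sides_def)
    then have su: "straight_at D' u e" using straight_at_D'_iff[of u e] off_base_kept[of u] 2 e by simp
    have vF: "v \<in> sides" using 2 by (auto simp: sides_def)
    moreover have "v \<notin> D" using over_triangle[of v] 2 by auto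
    ultimately have sv: "straight_at D' v (side_dir v)"
      using 2 transverse_coords(1)[of u] by (intro straight_at_sides) auto
    have "\<alpha> v \<noteq> 0" using 2 transverse_coords(1)[of u] \<delta> by auto
    then have "\<bar>sgn (\<alpha> v)\<bar> = 1" by (simp add: abs_sgn_eq)
    have "a e * b (side_dir v) \<noteq> b e * a (side_dir v)"
    proof
      assume "a e * b (side_dir v) = b e * a (side_dir v)"
      then have "\<bar>a e\<bar> = \<bar>b e * (sgn (\<alpha> v) * \<delta>)\<bar>" by simp
      then show False using e(2) \<open>\<bar>sgn (\<alpha> v)\<bar> = 1\<close> \<delta> by (simp add: abs_mult)
    qed
    then show ?thesis using su sv independent_if_det by blast
  qed
qed

lemma diagram_D': "is_diagram D'"
  by (simp add: is_diagram_def polygonal_D' regular_D')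


section \<open>The coloring of the new diagram\<close>

definition "covered z \<longleftrightarrow> 0 < \<beta> z \<and> excess z < 0"

text \<open>The whole finger inherits the color of \<open>x\<close>, and all that it covers is reflected in that color. The
  reflection \<open>q \<mapsto> 2 k(x) - q\<close> is what the coloring rule demands of a strand that passes under
  an arc of color \<open>k(x)\<close>.\<close>
definition "recolor p k z = (if z \<in> sides then k x else if covered z then (2 * k x - k z) mod int p else k z)"

lemma continuous_excess [continuous_intros]:
  "continuous_on S h \<Longrightarrow> continuous_on S (\<lambda>z. excess (h z))"
  unfolding excess_def by (intro continuous_intros)

lemma strand_in_cut:
  assumes z: "\<bar>\<alpha> z\<bar> < \<rho>" "\<beta> z = 0" "\<gamma> z = 0"
  shows "z \<in> cut_diagram D"
proof -
  have False if "crossing D z v" for v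
    using that z strand_iff[of v] \<delta> by (auto simp: crossing_iff)
  then show ?thesis using D_eq_strand[OF z] by (auto simp: cut_diagram_def)
qed

lemma x_in_cut: "x \<in> cut_diagram D"
  using \<delta> by (intro strand_in_cut) auto

text \<open>The points of the strand near \<open>x\<close> form a connected part of the cut diagram.\<close>
lemma strand_color:
  assumes k: "point_coloring p D k" and z: "\<bar>\<alpha> z\<bar> < \<rho>" "\<beta> z = 0" "\<gamma> z = 0"
  shows "k z = k x"
proof -
  define S where "S = (\<lambda>t. x + t *\<^sub>R d) ` {-\<rho><..<\<rho>}"
  have sub: "S \<subseteq> cut_diagram D"
  proof
    fix y assume "y \<in> S"
    then obtain t where t: "y = x + t *\<^sub>R d" "t \<in> {-\<rho><..<\<rho>}" unfolding S_def by (rule imageE)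
    then have "\<bar>t\<bar> < \<rho>" by auto
    with t(1) show "y \<in> cut_diagram D" by (intro strand_in_cut) simp_all
  qed
  have con: "connected S" unfolding S_def
    by (intro connected_continuous_image continuous_intros) simp
  have "z = x + \<alpha> z *\<^sub>R d" by (rule coords_eqI) (use z in simp_all)
  then have zS: "z \<in> S" unfolding S_def by (rule image_eqI) (use z in auto)
  have "x = x + 0 *\<^sub>R d" by simp
  then have xS: "x \<in> S" unfolding S_def by (rule image_eqI) (use \<delta> in auto)
  have "\<forall>y\<in>S. \<forall>\<^sub>F t in at y within S. k y = k t"
  proof
    fix y assume "y \<in> S"
    then have "\<forall>\<^sub>F t in at y within cut_diagram D. k y = k t"
      using k sub unfolding point_coloring_def by blast
    then show "\<forall>\<^sub>F t in at y within S. k y = k t" by (rule filter_leD[OF at_le[OF sub]])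
  qed
  from connected_local_const[OF con zS xS this] show ?thesis .
qed

lemma sides_in_cut: "z \<in> sides \<Longrightarrow> z \<in> cut_diagram D'"
  using crossing_off_sides[of z _ z] over_triangle[of z]
  unfolding cut_diagram_def crossing_D' by (fastforce simp: D'_eq sides_def)

lemma cut_D'_off_sides:
  assumes "z \<in> cut_diagram D'" "z \<notin> sides"
  shows "z \<in> kept" "z \<in> cut_diagram D" "0 < \<beta> z \<Longrightarrow> excess z \<noteq> 0"
proof -
  show "z \<in> kept" using assms by (simp add: cut_diagram_def D'_eq)
  then have "z \<in> D" by (rule kept_in_D)
  then show "z \<in> cut_diagram D" using assms(1) by (auto simp: cut_diagram_def crossing_D')
  show "excess z \<noteq> 0" if "0 < \<beta> z"
    using assms(1) \<open>z \<in> D\<close> that by (auto simp: cut_diagram_def crossing_D' excess_def)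
qed

lemma cut_D'_I:
  assumes "z \<in> kept" "z \<in> cut_diagram D" "\<not> (0 < \<beta> z \<and> excess z = 0)"
  shows "z \<in> cut_diagram D'"
proof -
  have "z \<in> D'" using assms by (simp add: D'_eq)
  moreover have "\<not> crossing D' z v" for v
    using assms unfolding cut_diagram_def crossing_D' excess_def by auto
  ultimately show ?thesis by (simp add: cut_diagram_def)
qed

text \<open>The boundary of the triangle causes no case of its own. Points of \<open>D\<close> over the open long sides are cut
  out, and what lies over the base has been moved or is an end of a side.\<close>
lemma cut_D'_cases:
  assumes "z \<in> cut_diagram D'" "z \<notin> sides"
  shows "\<beta> z < 0 \<or> 0 < excess z \<or> covered z"
proof (rule ccontr)
  assume n: "\<not> ?thesis"
  have z: "z \<in> kept" "z \<in> D" using cut_D'_off_sides[OF assms] kept_in_D by auto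
  have "\<beta> z = 0" using n cut_D'_off_sides(3)[OF assms] unfolding covered_def by linarith
  moreover from this have "\<bar>\<alpha> z\<bar> \<le> \<delta>" using n by (auto simp: excess_def)
  ultimately have "\<gamma> z = 0" using D_base z by simp
  then have "\<bar>\<alpha> z\<bar> = \<delta>" using z(1) \<open>\<bar>\<alpha> z\<bar> \<le> \<delta>\<close> by (simp add: kept_def)
  then have "z \<in> sides" using \<open>\<beta> z = 0\<close> \<open>\<gamma> z = 0\<close> by (simp add: sides_def)
  then show False using assms(2) by simp
qed

text \<open>The formula jumps only across the boundary of the triangle, where the new diagram is cut. At the two ends of the
  finger the colors on both parts agree with that of \<open>x\<close>.\<close>
lemma recolor_locally_constant:
  assumes k: "point_coloring p D k" and z: "z \<in> cut_diagram D'"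
  shows "\<forall>\<^sub>F y in at z within cut_diagram D'. recolor p k z = recolor p k y"
proof (cases "z \<in> sides")
  case zF: True
  show ?thesis
  proof (cases "z \<in> kept")
    case False
    have "\<forall>\<^sub>F y in at z within cut_diagram D'. y \<in> - kept \<and> y \<in> cut_diagram D'"
      using False closed_kept by (intro eventually_at_within_open) auto
    then show ?thesis
      by eventually_elim (use zF in \<open>auto simp: recolor_def cut_diagram_def D'_eq\<close>)
  next
    case True
    then have "\<beta> z = 0" "\<bar>\<alpha> z\<bar> = \<delta>" using kept_end_of_side zF kept_in_D by auto
    then have "\<forall>\<^sub>F y in at z within cut_diagram D'. y \<in> {y. \<bar>\<alpha> y\<bar> < \<rho> \<and> \<bar>\<beta> y\<bar> < \<rho>} \<and> y \<in> cut_diagram D'"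
      using \<delta> by (intro eventually_at_within_open open_Collect_conj open_Collect_less continuous_intros) auto
    then show ?thesis
    proof eventually_elim
      case (elim y)
      show ?case
      proof (cases "y \<in> sides")
        case False
        then have "\<beta> y = 0" "\<gamma> y = 0" using strand_iff[of y] elim cut_D'_off_sides[of y] kept_in_D by auto
        then show ?thesis using strand_color[OF k, of y] zF elim False by (simp add: recolor_def covered_def)
      qed (use zF in \<open>simp add: recolor_def\<close>)
    qed
  qed
next
  case zF: False
  have zc: "z \<in> cut_diagram D" using cut_D'_off_sides(2)[OF z zF] .
  then have kz: "\<forall>\<^sub>F y in nhds z. y \<noteq> z \<longrightarrow> y \<in> cut_diagram D \<longrightarrow> k z = k y"
    using k unfolding point_coloring_def eventually_at_filter by blast
  have "\<forall>\<^sub>F y in nhds z. y \<in> - sides" using zF closed_sides by (intro eventually_nhds_in_open) auto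
  moreover have "\<forall>\<^sub>F y in nhds z. covered y = covered z"
    using cut_D'_cases[OF z zF]
  proof (elim disjE)
    assume "\<beta> z < 0"
    then have "\<forall>\<^sub>F y in nhds z. y \<in> {y. \<beta> y < 0}"
      by (intro eventually_nhds_in_open open_Collect_less continuous_intros) auto
    then show ?thesis by eventually_elim (use \<open>\<beta> z < 0\<close> in \<open>auto simp: covered_def\<close>)
  next
    assume "0 < excess z"
    then have "\<forall>\<^sub>F y in nhds z. y \<in> {y. 0 < excess y}"
      by (intro eventually_nhds_in_open open_Collect_less continuous_intros) auto
    then show ?thesis by eventually_elim (use \<open>0 < excess z\<close> in \<open>auto simp: covered_def\<close>)
  next
    assume "covered z"
    then have "\<forall>\<^sub>F y in nhds z. y \<in> {y. 0 < \<beta> y \<and> excess y < 0}"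
      by (intro eventually_nhds_in_open open_Collect_conj open_Collect_less continuous_intros) (auto simp: covered_def)
    then show ?thesis by eventually_elim (use \<open>covered z\<close> in \<open>auto simp: covered_def\<close>)
  qed
  ultimately have "\<forall>\<^sub>F y in nhds z. y \<noteq> z \<longrightarrow> y \<in> cut_diagram D' \<longrightarrow> recolor p k z = recolor p k y"
    using kz by eventually_elim (use zF cut_D'_off_sides(2) in \<open>auto simp: recolor_def\<close>)
  then show ?thesis by (simp add: eventually_at_filter)
qed

lemma recolor_old_crossing:
  assumes k: "point_coloring p D k" and c: "crossing D u v" and e: "straight_at D' u e"
  shows "\<forall>\<^sub>F t in at_right 0. [2 * recolor p k v = recolor p k (u + t *\<^sub>R e) + recolor p k (u - t *\<^sub>R e)] (mod int p)"
proof -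
  have off: "z \<in> kept \<and> z \<notin> sides \<and> \<not> covered z \<and> (\<beta> z < 0 \<or> 0 < excess z)" if "z = u \<or> z = v" for z
    using crossing_off_sides[OF c that] clear_crossing[OF c that] unfolding covered_def excess_def by linarith
  have e': "straight_at D u e" using e straight_at_D'_iff off by blast
  have "\<forall>\<^sub>F y in nhds u. y \<in> - sides \<inter> ({y. \<beta> y < 0} \<union> {y. 0 < excess y})"
    using off[of u] closed_sides
    by (intro eventually_nhds_in_open open_Int open_Un open_Collect_less continuous_intros) auto
  then have N: "\<forall>\<^sub>F y in nhds u. recolor p k y = k y"
    by eventually_elim (auto simp: recolor_def covered_def)
  have "((\<lambda>t. u + t *\<^sub>R e) \<longlongrightarrow> u + 0 *\<^sub>R e) (at 0)" by (intro tendsto_intros)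
  then have "filterlim (\<lambda>t. u + t *\<^sub>R e) (nhds u) (at 0)" by simp
  from eventually_at_right_both_signs[OF eventually_compose_filterlim[OF N this]]
  have "\<forall>\<^sub>F t in at_right 0. recolor p k (u + t *\<^sub>R e) = k (u + t *\<^sub>R e) \<and> recolor p k (u - t *\<^sub>R e) = k (u - t *\<^sub>R e)"
    by simp
  moreover have "\<forall>\<^sub>F t in at_right 0. [2 * k v = k (u + t *\<^sub>R e) + k (u - t *\<^sub>R e)] (mod int p)"
    using k c e' unfolding point_coloring_def by blast
  ultimately show ?thesis
    by eventually_elim (use off[of v] in \<open>simp add: recolor_def\<close>)
qed

text \<open>Of the two directions along the under-strand exactly one enters the triangle. The colors on the two parts are
  \<open>q\<close> and \<open>2 k(x) - q\<close>, with sum \<open>2 k(x)\<close>.\<close>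
lemma recolor_new_crossing:
  assumes k: "point_coloring p D k" and u: "u \<in> D" "0 < \<beta> u" "\<bar>\<alpha> u\<bar> = \<delta> * (1 - \<beta> u)"
    and e: "straight_at D' u e"
  shows "\<forall>\<^sub>F t in at_right 0. [2 * recolor p k (lift u) = recolor p k (u + t *\<^sub>R e) + recolor p k (u - t *\<^sub>R e)] (mod int p)"
proof -
  have "\<gamma> u < 0" using over_triangle[of u] u by simp
  then have uF: "u \<notin> sides" by (auto simp: sides_def)
  have uD0: "u \<in> kept" using off_base_kept[of u] u by simp
  have su: "straight_at D u e" using straight_at_D'_iff[OF uD0 uF] e by simp
  obtain e0 where e0: "straight_at D u e0" "\<bar>a e0\<bar> \<noteq> \<delta> * \<bar>b e0\<bar>" using transverse_coords[OF u] by blast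
  obtain r where r: "r \<noteq> 0" "e = r *\<^sub>R e0" using straight_at_parallel[OF e0(1) su] by blast
  have "\<bar>a e\<bar> = \<bar>r\<bar> * \<bar>a e0\<bar>" "\<delta> * \<bar>b e\<bar> = \<bar>r\<bar> * (\<delta> * \<bar>b e0\<bar>)"
    by (simp_all add: r(2) linear_cmul[OF lin_a] linear_cmul[OF lin_b] abs_mult)
  then have "\<bar>a e\<bar> \<noteq> \<delta> * \<bar>b e\<bar>" using e0(2) r(1) by (metis abs_eq_0 mult_left_cancel)
  from excess_linear_near[OF u(2,3) transverse_coords(1)[OF u] this]
  obtain s where s: "s \<noteq> 0" "\<forall>\<^sub>F t in at 0. 0 < \<beta> (u + t *\<^sub>R e) \<and> excess (u + t *\<^sub>R e) = t * s" by blast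
  have uc: "u \<in> cut_diagram D" using u clear_coords[of u] by (auto simp: cut_diagram_def)
  then have "\<forall>\<^sub>F y in at u within cut_diagram D. k u = k y" using k unfolding point_coloring_def by blast
  from eventually_compose_filterlim[OF this straight_at_filterlim_cut[OF D su]]
  have "\<forall>\<^sub>F t in at 0. k u = k (u + t *\<^sub>R e)" .
  moreover have "\<forall>\<^sub>F y in nhds u. y \<in> - sides" using uF closed_sides by (intro eventually_nhds_in_open) auto
  moreover have "((\<lambda>t. u + t *\<^sub>R e) \<longlongrightarrow> u + 0 *\<^sub>R e) (at 0)" by (intro tendsto_intros)
  then have "filterlim (\<lambda>t. u + t *\<^sub>R e) (nhds u) (at 0)" by simp
  ultimately have "\<forall>\<^sub>F t in at 0. u + t *\<^sub>R e \<notin> sides \<and> k (u + t *\<^sub>R e) = k u \<and> 0 < \<beta> (u + t *\<^sub>R e) \<and> excess (u + t *\<^sub>R e) = t * s"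
    using s(2) eventually_compose_filterlim[of "\<lambda>y. y \<in> - sides"] by (auto elim: eventually_elim2 simp: eventually_conj_iff)
  then have "\<forall>\<^sub>F t in at 0. recolor p k (u + t *\<^sub>R e) = (if t * s < 0 then (2 * k x - k u) mod int p else k u)"
    by eventually_elim (auto simp: recolor_def covered_def)
  from eventually_at_right_both_signs[OF this] eventually_at_right_less[of "0::real"]
  show ?thesis
  proof eventually_elim
    case (elim t)
    have "lift u \<in> sides" using u by (auto simp: sides_def)
    then have l: "recolor p k (lift u) = k x" by (simp add: recolor_def)
    have "t * s < 0 \<and> \<not> (- t) * s < 0 \<or> \<not> t * s < 0 \<and> (- t) * s < 0"
      using elim(2) s(1) by (cases "0 < s") (auto simp: mult_less_0_iff zero_less_mult_iff)
    then have "recolor p k (u + t *\<^sub>R e) + recolor p k (u - t *\<^sub>R e) = (2 * k x - k u) mod int p + k u"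
      using elim(1) by auto
    then show ?case unfolding l by (simp add: cong_def mod_simps)
  qed
qed

lemma point_coloring_recolor:
  assumes k: "point_coloring p D k" and p: "p > 0"
  shows "point_coloring p D' (recolor p k)"
  unfolding point_coloring_def
proof (intro conjI ballI allI impI)
  fix z assume z: "z \<in> cut_diagram D'"
  have "k x \<in> {0..<int p}" using k x_in_cut unfolding point_coloring_def by blast
  moreover have "k z \<in> {0..<int p}" if "z \<notin> sides"
    using k cut_D'_off_sides(2)[OF z that] unfolding point_coloring_def by blast
  ultimately show "recolor p k z \<in> {0..<int p}" using p by (auto simp: recolor_def)
  show "\<forall>\<^sub>F y in at z within cut_diagram D'. recolor p k z = recolor p k y"
    by (rule recolor_locally_constant[OF k z])
next
  fix u v e assume "crossing D' u v \<and> straight_at D' u e"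
  then show "\<forall>\<^sub>F t in at_right 0. [2 * recolor p k v = recolor p k (u + t *\<^sub>R e) + recolor p k (u - t *\<^sub>R e)] (mod int p)"
    unfolding crossing_D' using recolor_old_crossing[OF k] recolor_new_crossing[OF k] by blast
qed

lemma recolor_image_subset:
  "recolor p k ` cut_diagram D' \<subseteq> k ` cut_diagram D \<union> {(2 * k x - k z) mod int p | z. z \<in> D \<and> covered z}"
proof
  fix q assume "q \<in> recolor p k ` cut_diagram D'"
  then obtain z where z: "z \<in> cut_diagram D'" "q = recolor p k z" by blast
  show "q \<in> k ` cut_diagram D \<union> {(2 * k x - k z) mod int p | z. z \<in> D \<and> covered z}"
  proof (cases "z \<in> sides")
    case True
    then show ?thesis using z x_in_cut by (simp add: recolor_def)
  next
    case False
    then show ?thesis using z cut_D'_off_sides[OF z(1) False] kept_in_D by (auto simp: recolor_def)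
  qed
qed

lemma recolor_outside:
  assumes z: "z \<in> D" "0 \<le> \<beta> z \<Longrightarrow> \<not> \<bar>\<alpha> z\<bar> \<le> \<delta> * (1 - \<beta> z)"
  shows "z \<in> kept" "z \<notin> sides" "recolor p k z = k z" "z \<in> cut_diagram D \<Longrightarrow> z \<in> cut_diagram D'"
proof -
  show 0: "z \<in> kept" using off_triangle_kept[OF z] .
  show 1: "z \<notin> sides" using z by (auto simp: sides_def)
  show "recolor p k z = k z" using 1 z by (auto simp: recolor_def covered_def excess_def)
  show "z \<in> cut_diagram D'" if "z \<in> cut_diagram D"
    by (rule cut_D'_I[OF 0 that]) (use z in \<open>auto simp: excess_def\<close>)
qed

lemma recolor_covered:
  assumes z: "z \<in> D" "covered z"
  shows "z \<in> cut_diagram D'" "recolor p k z = (2 * k x - k z) mod int p"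
proof -
  have i: "0 < \<beta> z" "\<bar>\<alpha> z\<bar> < \<delta> * (1 - \<beta> z)" using z by (auto simp: covered_def excess_def)
  then have "z \<in> kept" using off_base_kept[OF z(1)] by simp
  moreover have "z \<in> cut_diagram D" using z clear_coords[of z] i by (auto simp: cut_diagram_def)
  ultimately show "z \<in> cut_diagram D'" by (rule cut_D'_I) (use z in \<open>auto simp: covered_def\<close>)
  have "z \<notin> sides" using i by (auto simp: sides_def)
  then show "recolor p k z = (2 * k x - k z) mod int p" using z by (simp add: recolor_def)
qed

lemma apex_colored: "apex \<in> cut_diagram D'" "recolor p k apex = k x"
proof -
  have "apex \<in> sides" by (simp add: sides_def coords_triangle)
  then show "apex \<in> cut_diagram D'" "recolor p k apex = k x" by (auto simp: sides_in_cut recolor_def)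
qed

end

section \<open>Thin fingers along a generic segment\<close>

text \<open>A compactness argument: outside the open set where \<open>P\<close> holds locally, the function \<open>g\<close> has
  a positive minimum.\<close>
lemma compact_near_zero_set:
  fixes g :: "'a::t2_space \<Rightarrow> real"
  assumes D: "compact D" and g: "continuous_on D g" "\<And>z. z \<in> D \<Longrightarrow> 0 \<le> g z"
    and P: "\<And>z. z \<in> D \<Longrightarrow> g z = 0 \<Longrightarrow> \<forall>\<^sub>F y in nhds z. y \<in> D \<longrightarrow> P y"
  shows "\<exists>\<epsilon>>0. \<forall>z\<in>D. g z < \<epsilon> \<longrightarrow> P z"
proof -
  define U where "U = \<Union>{S. open S \<and> (\<forall>y\<in>S. y \<in> D \<longrightarrow> P y)}"
  have U: "open U" "\<And>y. y \<in> U \<Longrightarrow> y \<in> D \<Longrightarrow> P y" unfolding U_def by blast+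
  have "compact (D - U)" using D U(1) by (intro compact_diff)
  have pos: "0 < g z" if "z \<in> D - U" for z
  proof (rule ccontr)
    assume "\<not> 0 < g z"
    moreover have zD: "z \<in> D" using that by simp
    ultimately have "g z = 0" using g(2)[of z] by auto
    from P[OF zD this] obtain S where "open S" "z \<in> S" "\<forall>y\<in>S. y \<in> D \<longrightarrow> P y"
      unfolding eventually_nhds by (elim exE conjE)
    then show False using that unfolding U_def by blast
  qed
  show ?thesis
  proof (cases "D - U = {}")
    case True
    then show ?thesis using U(2) by (intro exI[of _ 1]) auto
  next
    case False
    then obtain z0 where z0: "z0 \<in> D - U" "\<And>z. z \<in> D - U \<Longrightarrow> g z0 \<le> g z"
      using continuous_attains_inf[OF \<open>compact (D - U)\<close> False continuous_on_subset[OF g(1)]] by blast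
    show ?thesis using pos[OF z0(1)] z0(2) U(2) by (intro exI[of _ "g z0"]) force
  qed
qed

text \<open>The triangles shrink to the segment \<open>s = 0\<close>, \<open>0 \<le> t \<le> 1\<close>, so a point off this
  segment is eventually outside.\<close>
lemma eventually_off_triangle:
  fixes s t :: real
  assumes "\<not> (s = 0 \<and> 0 \<le> t \<and> t \<le> 1)"
  shows "\<forall>\<^sub>F \<delta> in at_right 0. \<not> (0 \<le> t \<and> \<bar>s\<bar> \<le> \<delta> * (1 - t))"
proof (cases "s = 0")
  case True
  have "\<not> (0 \<le> t \<and> \<bar>s\<bar> \<le> \<delta> * (1 - t))" if "0 < \<delta>" for \<delta>
    using that assms True by (auto simp: zero_le_mult_iff)
  then show ?thesis using eventually_at_right_less[of "0::real"] by (rule eventually_mono[rotated])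
next
  case False
  have "\<forall>\<^sub>F \<delta> in at_right 0. \<delta> < \<bar>s\<bar>" using False unfolding eventually_at_right_field by (intro exI[of _ "\<bar>s\<bar>"]) auto
  then show ?thesis using eventually_at_right_less[of "0::real"]
  proof eventually_elim
    case (elim \<delta>)
    have "\<delta> * (1 - t) \<le> \<delta> * 1" if "0 \<le> t" using that elim by (intro mult_left_mono) auto
    then show ?case using elim by linarith
  qed
qed

text \<open>Only \<open>x\<close> lies over its own projection. Hence, by compactness, all points of \<open>D\<close> over a
  small neighborhood of that projection are close to \<open>x\<close> and lie on the strand.\<close>
lemma strand_neighborhood:
  fixes a b :: "real^3 \<Rightarrow> real"
  assumes D: "compact D" and lin: "linear a" "linear b" and d: "straight_at D x d" and basis: "a d = 1" "b d = 0"
    and fib: "\<And>z. z \<in> D \<Longrightarrow> a (z - x) = 0 \<Longrightarrow> b (z - x) = 0 \<Longrightarrow> z = x"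
  shows "\<exists>\<rho>>0. \<forall>z. \<bar>a (z - x)\<bar> < \<rho> \<longrightarrow> \<bar>b (z - x)\<bar> < \<rho> \<longrightarrow> (z \<in> D \<longleftrightarrow> z = x + a (z - x) *\<^sub>R d)"
proof -
  have conta: "continuous_on X (\<lambda>z. a (z - x))" "continuous_on X (\<lambda>z. b (z - x))" for X
    by (intro linear_continuous_on_compose[OF _ lin(1)] linear_continuous_on_compose[OF _ lin(2)] continuous_intros)+
  obtain r where r: "r > 0" "D \<inter> ball x r = range (\<lambda>t. x + t *\<^sub>R d) \<inter> ball x r" "d \<noteq> 0"
    using d unfolding straight_at_def by blast
  have "\<exists>\<epsilon>>0. \<forall>z\<in>D. \<bar>a (z - x)\<bar> + \<bar>b (z - x)\<bar> < \<epsilon> \<longrightarrow> z \<in> ball x r"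
  proof (rule compact_near_zero_set[OF D])
    show "continuous_on D (\<lambda>z. \<bar>a (z - x)\<bar> + \<bar>b (z - x)\<bar>)" by (intro continuous_intros conta)
    fix z assume "z \<in> D" "\<bar>a (z - x)\<bar> + \<bar>b (z - x)\<bar> = 0"
    then have "z = x" using fib[of z] by linarith
    then have "\<forall>\<^sub>F y in nhds z. y \<in> ball x r" using r by (intro eventually_nhds_in_open) auto
    then show "\<forall>\<^sub>F y in nhds z. y \<in> D \<longrightarrow> y \<in> ball x r" by eventually_elim simp
  qed auto
  then obtain \<epsilon> where \<epsilon>: "\<epsilon> > 0" "\<And>z. z \<in> D \<Longrightarrow> \<bar>a (z - x)\<bar> + \<bar>b (z - x)\<bar> < \<epsilon> \<Longrightarrow> z \<in> ball x r" by blast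
  define \<rho> where "\<rho> = min (\<epsilon> / 2) (r / norm d)"
  have \<rho>: "\<rho> > 0" "\<rho> \<le> \<epsilon> / 2" "\<rho> \<le> r / norm d" using \<epsilon>(1) r(1,3) unfolding \<rho>_def by (simp_all only: min.cobounded1 min.cobounded2) simp
  have strand: "z \<in> D \<longleftrightarrow> z = x + a (z - x) *\<^sub>R d" if z: "\<bar>a (z - x)\<bar> < \<rho>" "\<bar>b (z - x)\<bar> < \<rho>" for z
  proof
    assume zD: "z \<in> D"
    then have "z \<in> D \<inter> ball x r" using \<epsilon>(2)[OF zD] z \<rho>(2) by simp
    then have "z \<in> range (\<lambda>t. x + t *\<^sub>R d)" using r(2) by simp
    then obtain t where t: "z = x + t *\<^sub>R d" by (rule rangeE)
    then have "a (z - x) = t" by (simp add: linear_cmul lin basis)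
    then show "z = x + a (z - x) *\<^sub>R d" using t by simp
  next
    assume e: "z = x + a (z - x) *\<^sub>R d"
    have "dist x z = \<bar>a (z - x)\<bar> * norm d" by (subst e) (simp add: dist_norm)
    also have "\<dots> < r / norm d * norm d" using z \<rho>(3) r(3) by (intro mult_strict_right_mono) auto
    finally have "z \<in> range (\<lambda>t. x + t *\<^sub>R d) \<inter> ball x r" using e r(3) by auto
    then show "z \<in> D" using r(2) by blast
  qed
  show ?thesis using \<rho>(1) strand by blast
qed

text \<open>The move along the segment from the projection of \<open>x\<close> to that of \<open>x + w0\<close>, over which
  \<open>wall\<close> is the vertical strip. The reflected colors are exactly those found over the segment. The
  finger is made so thin that it covers no further colors, and that every old color still has a point that it does
  not cover. It also stays away from the finite set \<open>F\<close>, which allows to use known points of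
  \<open>D\<close> in the new diagram. All requirements hold for all sufficiently small widths, with finitely many
  widths excluded by transversality.\<close>
lemma finger_move:
  fixes D :: "(real^3) set" and a b :: "real^3 \<Rightarrow> real" and x d w0 :: "real^3"
  assumes D: "is_diagram D" and k: "point_coloring p D k" and p: "p > 0"
    and lin: "linear a" "linear b"
    and coords: "\<And>u v. plane_proj u = plane_proj v \<longleftrightarrow> a u = a v \<and> b u = b v"
    and x: "x \<in> D" and d: "straight_at D x d" and basis: "a d = 1" "b d = 0" "a w0 = 0" "b w0 = 1"
    and fiber: "\<And>z. z \<in> D \<Longrightarrow> plane_proj z = plane_proj x \<Longrightarrow> z = x"
    and gen: "generic_data D B Dirs"
    and wall: "wall = {z. a (z - x) = 0 \<and> 0 \<le> b (z - x) \<and> b (z - x) \<le> 1}"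
    and avoid: "B \<inter> wall = {}"
    and apex: "\<And>z. z \<in> D \<Longrightarrow> a (z - x) = 0 \<Longrightarrow> b (z - x) \<noteq> 1"
    and trans: "\<And>z e. z \<in> D \<Longrightarrow> z \<in> wall \<Longrightarrow> straight_at D z e \<Longrightarrow> a e \<noteq> 0"
    and F: "finite F" "F \<subseteq> D" "F \<inter> wall = {}"
  shows "\<exists>D' k'. is_diagram D' \<and> isotopic D D' \<and> point_coloring p D' k' \<and>
    k' ` cut_diagram D' = k ` cut_diagram D \<union> (\<lambda>z. (2 * k x - k z) mod int p) ` (D \<inter> wall) \<and>
    (\<exists>y\<in>cut_diagram D'. plane_proj y = plane_proj (x + w0) \<and> k' y = k x) \<and>
    (\<forall>y\<in>F. y \<in> D' \<and> k' y = k y \<and> (y \<in> cut_diagram D \<longrightarrow> y \<in> cut_diagram D') \<and>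
       (\<forall>e. straight_at D y e \<longrightarrow> straight_at D' y e))"
proof -
  have B: "finite B" "\<And>u v. crossing D u v \<Longrightarrow> u \<in> B"
    and Dirs: "finite Dirs" "\<And>z. z \<in> D \<Longrightarrow> z \<notin> B \<Longrightarrow> \<exists>e\<in>Dirs. straight_at D z e"
    using generic_dataD[OF gen] by simp_all
  note comp = diagram_compact[OF D]
  have conta: "continuous_on X (\<lambda>z. a (z - x))" "continuous_on X (\<lambda>z. b (z - x))" for X
    by (intro linear_continuous_on_compose[OF _ lin(1)] linear_continuous_on_compose[OF _ lin(2)] continuous_intros)+
  have fib: "z = x" if "z \<in> D" "a (z - x) = 0" "b (z - x) = 0" for z
    using fiber[OF that(1)] coords[of z x] that by (simp add: linear_diff lin)
  obtain \<rho> where \<rho>: "\<rho> > 0"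
    and strand: "\<And>z. \<bar>a (z - x)\<bar> < \<rho> \<Longrightarrow> \<bar>b (z - x)\<bar> < \<rho> \<Longrightarrow> z \<in> D \<longleftrightarrow> z = x + a (z - x) *\<^sub>R d"
    using strand_neighborhood[OF comp lin d basis(1,2) fib] by blast
  obtain M' where M': "\<And>z. z \<in> D \<Longrightarrow> norm z \<le> M'" using compact_imp_bounded[OF comp] unfolding bounded_iff by blast
  define M where "M = M' + norm x"
  have M: "\<bar>(z - x) $ 3\<bar> \<le> M" if "z \<in> D" for z
    using component_le_norm_cart[of "z - x" 3] norm_triangle_ineq4[of z x] M'[OF that] by (simp add: M_def)
  have M0: "M \<ge> 0" using M[OF x] by simp
  \<comment> \<open>With this slope \<open>W\<close>, the plane of the finger has left the height range of \<open>D\<close> by a margin of \<open>\<rho>\<close> as soon as \<open>|b| \<ge> \<rho>\<close>.\<close>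
  define W where "W = (M + \<rho> * \<bar>d $ 3\<bar> + \<rho>) / \<rho>"
  define w where "w = w0 + (W - w0 $ 3) *\<^sub>R axis 3 1"
  have w3: "w $ 3 = W" by (simp add: w_def axis_def)
  have "plane_proj (axis 3 1) = plane_proj 0" by (simp add: plane_proj_def axis_def)
  then have ax: "a (axis 3 1) = 0" "b (axis 3 1) = 0" using coords linear_0[OF lin(1)] linear_0[OF lin(2)] by auto
  have wb: "a w = 0" "b w = 1" by (simp_all add: w_def linear_add linear_cmul lin ax basis)
  have away: "\<rho> \<le> \<bar>(z - x) $ 3 - a (z - x) * d $ 3 - b (z - x) * w $ 3\<bar> \<and>
      (0 < b (z - x) \<longrightarrow> (z - x) $ 3 - a (z - x) * d $ 3 - b (z - x) * w $ 3 < 0)"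
    if z: "z \<in> D" "\<bar>a (z - x)\<bar> < \<rho>" "\<rho> \<le> \<bar>b (z - x)\<bar>" for z
  proof -
    have "\<bar>a (z - x) * d $ 3\<bar> \<le> \<rho> * \<bar>d $ 3\<bar>" using z by (simp add: abs_mult mult_right_mono)
    then have 1: "\<bar>(z - x) $ 3 - a (z - x) * d $ 3\<bar> \<le> M + \<rho> * \<bar>d $ 3\<bar>" using M[OF z(1)] by linarith
    have W0: "W > 0" using M0 \<rho> by (simp add: W_def add_nonneg_pos)
    have "\<rho> * W = M + \<rho> * \<bar>d $ 3\<bar> + \<rho>" using \<rho> by (simp add: W_def)
    moreover have "\<rho> * W \<le> \<bar>b (z - x)\<bar> * W" using z W0 by (intro mult_right_mono) auto
    ultimately have 2: "M + \<rho> * \<bar>d $ 3\<bar> + \<rho> \<le> \<bar>b (z - x) * W\<bar>" using W0 by (simp add: abs_mult)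
    have 3: "0 < b (z - x) \<Longrightarrow> \<bar>b (z - x) * W\<bar> = b (z - x) * W" using W0 by simp
    show ?thesis unfolding w3 using 1 2 3 \<rho> by linarith
  qed
  define C where "C = k ` cut_diagram D \<union> (\<lambda>z. (2 * k x - k z) mod int p) ` (D \<inter> wall)"
  have wall_cut: "z \<in> cut_diagram D" if "z \<in> D" "z \<in> wall" for z
    using that avoid B(2) unfolding cut_diagram_def by blast
  have "\<exists>\<epsilon>>0. \<forall>z\<in>D. \<bar>a (z - x)\<bar> + max 0 (- b (z - x)) + max 0 (b (z - x) - 1) < \<epsilon> \<longrightarrow> (2 * k x - k z) mod int p \<in> C"
  proof (rule compact_near_zero_set[OF comp])
    show "continuous_on D (\<lambda>z. \<bar>a (z - x)\<bar> + max 0 (- b (z - x)) + max 0 (b (z - x) - 1))"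
      by (intro continuous_intros conta)
    fix z assume z: "z \<in> D" "\<bar>a (z - x)\<bar> + max 0 (- b (z - x)) + max 0 (b (z - x) - 1) = 0"
    then have zw: "z \<in> wall" unfolding wall by (auto simp: max_def split: if_splits)
    then have zc: "z \<in> cut_diagram D" using wall_cut z by blast
    then have "\<forall>\<^sub>F y in nhds z. y \<noteq> z \<longrightarrow> y \<in> cut_diagram D \<longrightarrow> k z = k y"
      using k unfolding point_coloring_def eventually_at_filter by blast
    moreover have "\<forall>\<^sub>F y in nhds z. y \<noteq> z \<longrightarrow> y \<in> D \<longrightarrow> y \<in> cut_diagram D"
      using cut_diagram_eventually_eq[OF D, of z] by (simp add: eventually_at_filter)
    ultimately show "\<forall>\<^sub>F y in nhds z. y \<in> D \<longrightarrow> (2 * k x - k y) mod int p \<in> C"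
    proof eventually_elim
      case (elim y)
      have "k y = k z" if "y \<in> D" using elim that by (cases "y = z") auto
      then show ?case using z zw unfolding C_def by (auto intro!: imageI)
    qed
  qed (auto simp: max_def)
  then obtain \<epsilon>2 where \<epsilon>2: "\<epsilon>2 > 0" "\<And>z. z \<in> D \<Longrightarrow> \<bar>a (z - x)\<bar> + max 0 (- b (z - x)) + max 0 (b (z - x) - 1) < \<epsilon>2 \<Longrightarrow> (2 * k x - k z) mod int p \<in> C" by blast
  \<comment> \<open>Every color has a representative off the wall, because the diagram crosses the wall transversely.\<close>
  have "\<forall>q\<in>k ` cut_diagram D. \<exists>z. z \<in> cut_diagram D \<and> z \<notin> wall \<and> k z = q"
  proof
    fix q assume "q \<in> k ` cut_diagram D"
    then obtain z where z: "z \<in> cut_diagram D" "k z = q" by blast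
    show "\<exists>z. z \<in> cut_diagram D \<and> z \<notin> wall \<and> k z = q"
    proof (cases "z \<in> wall")
      case True
      have zD: "z \<in> D" using z by (simp add: cut_diagram_def)
      then obtain e where e: "straight_at D z e" using Dirs(2)[OF zD] avoid True by blast
      have ae: "a e \<noteq> 0" using trans[OF zD True e] .
      have "\<forall>\<^sub>F y in at z within cut_diagram D. k z = k y" using k z unfolding point_coloring_def by blast
      from eventually_compose_filterlim[OF this straight_at_filterlim_cut[OF D e]]
      have "\<forall>\<^sub>F t in at 0. k z = k (z + t *\<^sub>R e)" .
      moreover have "\<forall>\<^sub>F t in at 0. z + t *\<^sub>R e \<in> cut_diagram D"
        using straight_at_filterlim_cut[OF D e] unfolding filterlim_at by (auto elim: eventually_mono)
      ultimately have "\<forall>\<^sub>F t in at (0::real). t \<noteq> 0 \<and> k z = k (z + t *\<^sub>R e) \<and> z + t *\<^sub>R e \<in> cut_diagram D"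
        using eventually_neq_at_within[of 0 0 UNIV] by eventually_elim simp
      then obtain t where t: "t \<noteq> 0" "k z = k (z + t *\<^sub>R e)" "z + t *\<^sub>R e \<in> cut_diagram D"
        using eventually_happens'[of "at (0::real)"] by auto
      have "a (z + t *\<^sub>R e - x) = a (z - x) + t * a e"
        using linear_add[OF lin(1), of "z - x" "t *\<^sub>R e"] by (simp add: linear_cmul lin algebra_simps)
      then have "z + t *\<^sub>R e \<notin> wall" using True t(1) ae by (simp add: wall)
      then show ?thesis using t z by metis
    qed (use z in blast)
  qed
  then obtain h where h: "\<And>q. q \<in> k ` cut_diagram D \<Longrightarrow> h q \<in> cut_diagram D \<and> h q \<notin> wall \<and> k (h q) = q"
    by (metis (no_types, lifting))
  define R where "R = h ` k ` cut_diagram D"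
  have "k ` cut_diagram D \<subseteq> {0..<int p}" using k unfolding point_coloring_def by blast
  then have "finite R" unfolding R_def using finite_subset by blast
  define G where "G = B \<union> F \<union> R"
  have G: "finite G" "G \<inter> wall = {}" using \<open>finite R\<close> B(1) F avoid h unfolding G_def R_def by auto
  have "\<forall>\<^sub>F \<delta> in at_right 0. \<forall>z\<in>G. \<not> (0 \<le> b (z - x) \<and> \<bar>a (z - x)\<bar> \<le> \<delta> * (1 - b (z - x)))"
    using G by (intro eventually_ball_finite ballI eventually_off_triangle) (auto simp: wall)
  moreover have "\<forall>\<^sub>F \<delta> in at_right 0. \<forall>e\<in>Dirs. \<not> (a e = 0 \<and> b e = 0) \<longrightarrow> \<bar>a e\<bar> \<noteq> \<delta> * \<bar>b e\<bar>"
  proof (intro eventually_ball_finite[OF Dirs(1)] ballI)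
    fix e
    show "\<forall>\<^sub>F \<delta> in at_right 0. \<not> (a e = 0 \<and> b e = 0) \<longrightarrow> \<bar>a e\<bar> \<noteq> \<delta> * \<bar>b e\<bar>"
      using eventually_neq_at_within[of "\<bar>a e\<bar> / \<bar>b e\<bar>" "0::real" "{0<..}"]
      by eventually_elim (cases "b e = 0", auto)
  qed
  moreover have "\<forall>\<^sub>F \<delta> in at_right 0. \<delta> < min \<rho> \<epsilon>2"
    using \<rho> \<epsilon>2 unfolding eventually_at_right_field by (intro exI[of _ "min \<rho> \<epsilon>2"]) auto
  ultimately have "\<forall>\<^sub>F \<delta> in at_right 0. 0 < \<delta> \<and> \<delta> < min \<rho> \<epsilon>2 \<and>
      (\<forall>z\<in>G. \<not> (0 \<le> b (z - x) \<and> \<bar>a (z - x)\<bar> \<le> \<delta> * (1 - b (z - x)))) \<and>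
      (\<forall>e\<in>Dirs. \<not> (a e = 0 \<and> b e = 0) \<longrightarrow> \<bar>a e\<bar> \<noteq> \<delta> * \<bar>b e\<bar>)"
    using eventually_at_right_less[of "0::real"] by eventually_elim simp
  from eventually_happens'[OF trivial_limit_at_right_real this]
  obtain \<delta> where \<delta>': "0 < \<delta> \<and> \<delta> < min \<rho> \<epsilon>2 \<and>
      (\<forall>z\<in>G. \<not> (0 \<le> b (z - x) \<and> \<bar>a (z - x)\<bar> \<le> \<delta> * (1 - b (z - x)))) \<and>
      (\<forall>e\<in>Dirs. \<not> (a e = 0 \<and> b e = 0) \<longrightarrow> \<bar>a e\<bar> \<noteq> \<delta> * \<bar>b e\<bar>)" by (rule exE)
  then have offG: "\<And>z. z \<in> G \<Longrightarrow> \<not> (0 \<le> b (z - x) \<and> \<bar>a (z - x)\<bar> \<le> \<delta> * (1 - b (z - x)))"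
      and dir: "\<And>e. e \<in> Dirs \<Longrightarrow> \<not> (a e = 0 \<and> b e = 0) \<Longrightarrow> \<bar>a e\<bar> \<noteq> \<delta> * \<bar>b e\<bar>"
    by blast+
  from \<delta>' have small: "0 < \<delta>" "\<delta> < \<rho>" "\<delta> < \<epsilon>2" by simp_all
  have "plane_proj w = plane_proj w0" using coords[of w w0] wb basis by simp
  then have proj_apex: "plane_proj (x + w) = plane_proj (x + w0)"
    by (simp add: linear_add[OF plane_proj_linear])
  interpret finger D x d w a b \<rho> \<delta>
  proof (rule finger.intro)
    show "is_diagram D" "linear a" "linear b" by fact+
    show "plane_proj u = plane_proj v \<longleftrightarrow> a u = a v \<and> b u = b v" for u v by (rule coords)
    show "a d = 1" "b d = 0" "a w = 0" "b w = 1" "0 < \<delta>" "\<delta> < \<rho>" by (fact basis wb small)+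
    show "\<bar>a (z - x)\<bar> < \<rho> \<Longrightarrow> \<bar>b (z - x)\<bar> < \<rho> \<Longrightarrow> z \<in> D \<longleftrightarrow> z = x + a (z - x) *\<^sub>R d" for z by (rule strand)
    show "\<delta> \<le> \<bar>(z - x) $ 3 - a (z - x) * d $ 3 - b (z - x) * w $ 3\<bar> \<and>
      (0 < b (z - x) \<longrightarrow> (z - x) $ 3 - a (z - x) * d $ 3 - b (z - x) * w $ 3 < 0)"
      if "z \<in> D" "\<bar>a (z - x)\<bar> < \<rho>" "\<rho> \<le> \<bar>b (z - x)\<bar>" for z
      using away[OF that] small by linarith
    show "\<not> (0 \<le> b (u - x) \<and> \<bar>a (u - x)\<bar> \<le> \<delta> * (1 - b (u - x)))" if "crossing D u v" for u v
      using offG[of u] B(2)[OF that] by (auto simp: G_def)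
    show "b (z - x) < 1 \<and> (\<exists>e. straight_at D z e \<and> \<bar>a e\<bar> \<noteq> \<delta> * \<bar>b e\<bar>)"
      if z: "z \<in> D" "0 < b (z - x)" "\<bar>a (z - x)\<bar> = \<delta> * (1 - b (z - x))" for z
    proof
      have "0 \<le> \<delta> * (1 - b (z - x))" using z(3) by (metis abs_ge_zero)
      then have "b (z - x) \<le> 1" using small(1) by (simp add: zero_le_mult_iff)
      moreover have "b (z - x) \<noteq> 1" using apex[OF z(1)] z(3) by auto
      ultimately show "b (z - x) < 1" by simp
      have "z \<notin> B" using offG[of z] z by (auto simp: G_def)
      then obtain e where e: "e \<in> Dirs" "straight_at D z e" using Dirs(2) z(1) by blast
      have "plane_proj e \<noteq> plane_proj 0"
        using diagram_nonvertical[OF D e(2)] by (simp add: linear_0[OF plane_proj_linear])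
      then have "\<not> (a e = 0 \<and> b e = 0)" using coords[of e 0] by (simp add: linear_0 lin)
      then show "\<exists>e. straight_at D z e \<and> \<bar>a e\<bar> \<noteq> \<delta> * \<bar>b e\<bar>" using dir e by blast
    qed
  qed
  have off: "z \<in> G \<Longrightarrow> 0 \<le> \<beta> z \<Longrightarrow> \<not> \<bar>\<alpha> z\<bar> \<le> \<delta> * (1 - \<beta> z)" for z
    using offG[of z] by (simp add: \<alpha>_def \<beta>_def)
  have colors: "recolor p k ` cut_diagram D' = C"
  proof (intro equalityI subsetI)
    fix q assume "q \<in> recolor p k ` cut_diagram D'"
    then consider "q \<in> k ` cut_diagram D" | z where "q = (2 * k x - k z) mod int p" "z \<in> D" "covered z"
      using recolor_image_subset[of p k] by blast
    then show "q \<in> C"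
    proof cases
      case 2
      then have z: "0 < b (z - x)" "\<bar>a (z - x)\<bar> < \<delta> * (1 - b (z - x))"
        by (auto simp: covered_def excess_def \<alpha>_def \<beta>_def)
      have "\<delta> * (1 - b (z - x)) \<le> \<delta> * 1" using z small by (intro mult_left_mono) auto
      then have "\<bar>a (z - x)\<bar> < \<epsilon>2" using z small by linarith
      moreover have "b (z - x) < 1" using z small(1) by (smt (verit) mult_nonneg_nonpos)
      ultimately show ?thesis using \<epsilon>2(2)[OF 2(2)] z small 2(1) by (simp add: max_def)
    qed (simp add: C_def)
  next
    fix q assume "q \<in> C"
    then consider "q \<in> k ` cut_diagram D" | z where "q = (2 * k x - k z) mod int p" "z \<in> D" "z \<in> wall"
      unfolding C_def by blast
    then show "q \<in> recolor p k ` cut_diagram D'"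
    proof cases
      case 1
      then have hq: "h q \<in> G" "h q \<in> cut_diagram D" "h q \<in> D" "k (h q) = q"
        using h[OF 1] by (auto simp: G_def R_def cut_diagram_def)
      show ?thesis using recolor_outside(3,4)[OF hq(3) off[OF hq(1)]] hq by (metis imageI)
    next
      case 2
      show ?thesis
      proof (cases "b (z - x) = 0")
        case True
        then have "z = x" using fib 2 by (simp add: wall)
        moreover have "k x \<in> {0..<int p}" using k x_in_cut unfolding point_coloring_def by blast
        ultimately have "q = k x" using 2(1) by simp
        then show ?thesis using apex_colored(1) apex_colored(2)[of p k] by (metis imageI)
      next
        case False
        then have "covered z" using 2 apex[of z] small by (auto simp: wall covered_def excess_def \<alpha>_def \<beta>_def)
        then show ?thesis using recolor_covered(1)[OF 2(2)] recolor_covered(2)[OF 2(2), of p k] 2(1) by (metis imageI)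
      qed
    qed
  qed
  have ap: "\<exists>y\<in>cut_diagram D'. plane_proj y = plane_proj (x + w0) \<and> recolor p k y = k x"
    using apex_colored(1) apex_colored(2)[of p k] proj_apex unfolding apex_def by blast
  have FF: "y \<in> D' \<and> recolor p k y = k y \<and> (y \<in> cut_diagram D \<longrightarrow> y \<in> cut_diagram D') \<and>
       (\<forall>e. straight_at D y e \<longrightarrow> straight_at D' y e)" if "y \<in> F" for y
  proof -
    have y: "y \<in> D" "y \<in> G" using that F(2) by (auto simp: G_def)
    note o = recolor_outside[OF y(1) off[OF y(2)]]
    show ?thesis using o straight_at_D'_iff[OF o(1,2)] by (simp add: D'_eq)
  qed
  show ?thesis
    using diagram_D' isotopic_D' point_coloring_recolor[OF k p] colors ap FF unfolding C_def
    by (intro exI[of _ D'] exI[of _ "recolor p k"]) blast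
qed

section \<open>Directions in general position\<close>

text \<open>The determinant of the projections to the plane. It vanishes exactly if these are linearly dependent.\<close>
definition plane_det :: "real^3 \<Rightarrow> real^3 \<Rightarrow> real" where
  "plane_det u v = u $ 1 * v $ 2 - u $ 2 * v $ 1"

lemma plane_det_linear:
  "plane_det u (v + w) = plane_det u v + plane_det u w" "plane_det (v + w) u = plane_det v u + plane_det w u" "plane_det u (v - w) = plane_det u v - plane_det u w"
  "plane_det (v - w) u = plane_det v u - plane_det w u" "plane_det u (t *\<^sub>R v) = t * plane_det u v" "plane_det (t *\<^sub>R v) u = t * plane_det v u" "plane_det u u = 0"
  by (simp_all add: plane_det_def algebra_simps)

lemma plane_proj_eq_iff: "plane_proj u = plane_proj v \<longleftrightarrow> u $ 1 = v $ 1 \<and> u $ 2 = v $ 2"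
  by (simp add: plane_proj_def vec_eq_iff forall_2)

lemma plane_det_both_zero:
  assumes "plane_det u v \<noteq> 0" "plane_det f u = 0" "plane_det f v = 0"
  shows "plane_proj f = 0"
proof -
  have "f $ 1 * plane_det u v = u $ 1 * plane_det f v - v $ 1 * plane_det f u" "f $ 2 * plane_det u v = u $ 2 * plane_det f v - v $ 2 * plane_det f u"
    by (simp_all add: plane_det_def algebra_simps)
  then have "f $ 1 = 0" "f $ 2 = 0" using assms by simp_all
  then show ?thesis by (simp add: plane_proj_def vec_eq_iff forall_2)
qed

lemma plane_coordinates:
  assumes dw: "plane_det d w \<noteq> 0"
  defines "a \<equiv> \<lambda>z. plane_det z w / plane_det d w" and "b \<equiv> \<lambda>z. plane_det d z / plane_det d w"
  shows "linear a" "linear b" "plane_proj u = plane_proj v \<longleftrightarrow> a u = a v \<and> b u = b v"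
    "a d = 1" "b d = 0" "a w = 0" "b w = 1"
proof -
  show "linear a" "linear b" unfolding a_def b_def
    by (rule linearI; simp add: plane_det_linear add_divide_distrib)+
  have ex: "z $ i = a z * d $ i + b z * w $ i" if "i = 1 \<or> i = 2" for z :: "real^3" and i :: 3
  proof -
    have "z $ i * plane_det d w = plane_det z w * d $ i + plane_det d z * w $ i" using that by (auto simp: plane_det_def algebra_simps)
    then show ?thesis using dw by (simp add: a_def b_def field_simps)
  qed
  show "plane_proj u = plane_proj v \<longleftrightarrow> a u = a v \<and> b u = b v"
  proof
    assume "plane_proj u = plane_proj v"
    then show "a u = a v \<and> b u = b v" by (simp add: plane_proj_eq_iff a_def b_def plane_det_def)
  next
    assume "a u = a v \<and> b u = b v"
    then show "plane_proj u = plane_proj v" unfolding plane_proj_eq_iff using ex by metis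
  qed
  show "a d = 1" "b d = 0" "a w = 0" "b w = 1" using dw by (simp_all add: a_def b_def plane_det_linear)
qed

text \<open>For each \<open>v\<close> the determinant is an affine function of \<open>t\<close>, and it is not identically zero
  because \<open>u\<close> and \<open>e\<close> span the plane.\<close>
lemma eventually_avoids_directions:
  assumes V: "finite V" "\<And>v. v \<in> V \<Longrightarrow> plane_proj v \<noteq> 0" and uv: "plane_det u e \<noteq> 0"
  shows "\<forall>\<^sub>F t in at 0. \<forall>v\<in>V. plane_det v (u + t *\<^sub>R e) \<noteq> 0"
proof (intro eventually_ball_finite[OF V(1)] ballI)
  fix v assume v: "v \<in> V"
  then have n: "\<not> (plane_det v u = 0 \<and> plane_det v e = 0)" using plane_det_both_zero[OF uv] V(2) by blast
  show "\<forall>\<^sub>F t in at 0. plane_det v (u + t *\<^sub>R e) \<noteq> 0"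
  proof (cases "plane_det v e = 0")
    case True
    then show ?thesis using n by (simp add: plane_det_linear)
  next
    case False
    have "\<forall>\<^sub>F t in at 0. t \<noteq> - plane_det v u / plane_det v e" by (rule eventually_neq_at_within)
    then show ?thesis by eventually_elim (use False in \<open>auto simp: plane_det_linear field_simps\<close>)
  qed
qed

text \<open>Transversality isolates the points of the section, and the section is compact.\<close>
lemma finite_transverse_section:
  assumes D: "compact D" and a: "linear a"
    and tr: "\<And>z. z \<in> D \<Longrightarrow> a (z - x) = 0 \<Longrightarrow> \<exists>e. straight_at D z e \<and> a e \<noteq> (0::real)"
  shows "finite {z \<in> D. a (z - x) = 0}"
proof (rule ccontr)
  let ?L = "{z \<in> D. a (z - x) = 0}"
  assume inf: "infinite ?L"
  have "continuous_on UNIV (\<lambda>z. a (z - x))"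
    by (intro linear_continuous_on_compose[OF _ a] continuous_intros)
  then have "closed {z. a (z - x) = 0}" by (intro closed_Collect_eq continuous_on_const)
  then have "compact (D \<inter> {z. a (z - x) = 0})" using D by (simp add: compact_Int_closed)
  moreover have "?L = D \<inter> {z. a (z - x) = 0}" by auto
  ultimately obtain z where z: "z \<in> ?L" "z islimpt ?L" using inf compact_eq_Bolzano_Weierstrass[of ?L] by auto
  then obtain e where e: "straight_at D z e" "a e \<noteq> 0" using tr by auto
  have "\<forall>\<^sub>F t in at 0. z + t *\<^sub>R e \<notin> ?L"
  proof -
    have "a (z + t *\<^sub>R e - x) = a (z - x) + t * a e" for t
      using linear_add[OF a, of "z - x" "t *\<^sub>R e"] by (simp add: linear_cmul a algebra_simps)
    then show ?thesis using eventually_neq_at_within[of 0 0 UNIV] z(1) e(2) by (auto elim: eventually_mono)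
  qed
  then have "\<forall>\<^sub>F y in at z within D. y \<notin> ?L" by (rule straight_at_punctured_coverage[OF e(1)])
  then obtain S where S: "open S" "z \<in> S" "\<And>y. y \<in> S \<Longrightarrow> y \<noteq> z \<Longrightarrow> y \<in> D \<Longrightarrow> y \<notin> ?L"
    unfolding eventually_at_topological by blast
  then show False using z(2) unfolding islimpt_def by blast
qed

lemma generic_point_of_color:
  assumes D: "is_diagram D" and k: "point_coloring p D k" and z: "z \<in> cut_diagram D"
    and B: "finite B" and S: "open S" "z \<in> S"
  shows "\<exists>y. y \<in> cut_diagram D \<and> y \<notin> B \<and> y \<in> S \<and> k y = k z"
proof -
  have "z islimpt D" using polygonal_link_islimpt[of D z] D z by (simp add: is_diagram_def cut_diagram_def)
  then have nt: "at z within D \<noteq> bot" using trivial_limit_within by blast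
  have "\<forall>\<^sub>F y in at z within D. y \<in> S \<and> y \<in> D" using S by (rule eventually_at_within_open)
  moreover have "\<forall>\<^sub>F y in at z within D. y \<notin> B" by (rule finite_avoids_punctured[OF B])
  moreover have "\<forall>\<^sub>F y in at z within D. y \<in> cut_diagram D"
    using finite_avoids_punctured[OF diagram_finite_under[OF D], of z D] eventually_at_within_open[OF open_UNIV UNIV_I, where z = z and T = D]
    by eventually_elim (auto simp: cut_diagram_def)
  moreover have "\<forall>\<^sub>F y in at z within D. y \<in> cut_diagram D \<longrightarrow> k z = k y"
  proof -
    have "\<forall>\<^sub>F y in at z within cut_diagram D. k z = k y" using k z unfolding point_coloring_def by blast
    then show ?thesis unfolding eventually_at_filter by eventually_elim blast
  qed
  ultimately have "\<forall>\<^sub>F y in at z within D. y \<in> cut_diagram D \<and> y \<notin> B \<and> y \<in> S \<and> k y = k z"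
    by eventually_elim simp
  from eventually_happens'[OF nt this] show ?thesis .
qed

lemma single_fiber:
  assumes "\<And>u v. crossing D u v \<Longrightarrow> u \<in> B \<and> v \<in> B" "x \<in> D" "x \<notin> B" "z \<in> D" "plane_proj z = plane_proj x"
  shows "z = x"
proof (rule ccontr)
  assume "z \<noteq> x"
  moreover have "z $ 1 = x $ 1" "z $ 2 = x $ 2" using assms(5) by (simp_all add: plane_proj_eq_iff)
  ultimately have "z $ 3 \<noteq> x $ 3" by (auto simp: vec_eq_iff forall_3)
  then have "crossing D z x \<or> crossing D x z" using assms(2,4,5) by (auto simp: crossing_def)
  then show False using assms(1,3) by blast
qed

section \<open>Gaining exactly one color\<close>

text \<open>Reflecting one term of an arithmetic progression in the next gives the term after it, so \<open>C\<close> contains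
  the progression that starts with two of its elements \<open>t\<close> and \<open>s\<close>. Modulo a prime, the
  multiples of \<open>s - t\<close> are all the residues.\<close>
lemma closed_under_reflection_imp_all:
  fixes C :: "int set"
  assumes p: "prime p" and C: "C \<subseteq> {0..<int p}" "card C > 1"
    and cl: "\<And>s t. s \<in> C \<Longrightarrow> t \<in> C \<Longrightarrow> (2 * s - t) mod int p \<in> C"
  shows "C = {0..<int p}"
proof -
  obtain s t where st: "s \<in> C" "t \<in> C" "s \<noteq> t"
    using C(2) card_le_Suc0_iff_eq[of C] finite_subset[OF C(1)] by auto
  have prog: "(t + int n * (s - t)) mod int p \<in> C \<and> (t + int (Suc n) * (s - t)) mod int p \<in> C" for n
  proof (induction n)
    case 0
    have "t mod int p = t" "s mod int p = s" using st C(1) by auto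
    then show ?case using st by simp
  next
    case (Suc n)
    let ?u = "t + int (Suc n) * (s - t)" and ?v = "t + int n * (s - t)"
    have "[2 * (?u mod int p) - ?v mod int p = 2 * ?u - ?v] (mod int p)"
      by (intro cong_diff cong_mult cong_refl) (simp_all add: cong_def)
    then have "(2 * (?u mod int p) - ?v mod int p) mod int p = (2 * ?u - ?v) mod int p"
      unfolding cong_def .
    also have "2 * (t + int (Suc n) * (s - t)) - (t + int n * (s - t)) = t + int (Suc (Suc n)) * (s - t)"
      by (simp add: algebra_simps)
    finally show ?case using cl[of "?u mod int p" "?v mod int p"] Suc by (metis (no_types, lifting))
  qed
  have "s \<in> {0..<int p}" "t \<in> {0..<int p}" using st C(1) by blast+
  then have "\<bar>s - t\<bar> < int p" "s - t \<noteq> 0" using st by auto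
  then have "\<not> int p dvd s - t" using zdvd_not_zless[of "\<bar>s - t\<bar>" "int p"] by auto
  then have cop: "coprime (s - t) (int p)"
    using p prime_imp_coprime[of "int p" "s - t"] by (simp add: coprime_commute)
  have "q \<in> C" if q: "q \<in> {0..<int p}" for q
  proof -
    obtain m where m: "[(s - t) * m = 1] (mod int p)" using cong_solve_coprime_int[OF cop] by blast
    define n where "n = nat ((m * (q - t)) mod int p)"
    have pp: "int p > 0" using p prime_gt_0_nat by simp
    then have n: "int n = (m * (q - t)) mod int p" by (simp add: n_def)
    have "[int n * (s - t) = (m * (q - t)) * (s - t)] (mod int p)" unfolding n by (simp add: cong_def mod_simps)
    also have "(m * (q - t)) * (s - t) = ((s - t) * m) * (q - t)" by (simp add: algebra_simps)
    also have "[((s - t) * m) * (q - t) = 1 * (q - t)] (mod int p)" using m by (rule cong_scalar_right)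
    finally have "[t + int n * (s - t) = t + 1 * (q - t)] (mod int p)" by (rule cong_add[OF cong_refl])
    then have "(t + int n * (s - t)) mod int p = q" using q by (simp add: cong_def)
    then show ?thesis using prog[of n] by simp
  qed
  then show ?thesis using C(1) by blast
qed


text \<open>Reflecting the color of \<open>y\<close> in that of \<open>x\<close> gives a new color. The endpoint
  \<open>y\<close> is first moved along its strand until the segment from \<open>x\<close> is in general position,
  which is possible because \<open>x\<close> is not on the projected line of that strand. The finger then follows
  this segment and stops right after the first point whose reflected color is new. Up to there, all reflected colors
  but the last are old.\<close>
lemma finger_towards_point:
  assumes p: "p > 0" and D: "is_diagram D" and k: "point_coloring p D k"
    and gen: "generic_data D B Dirs"
    and x: "x \<in> D" "x \<notin> B"
    and y: "y \<in> cut_diagram D" "straight_at D y e" "plane_det e (x - y) \<noteq> 0"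
    and new: "(2 * k x - k y) mod int p \<notin> k ` cut_diagram D"
  shows "\<exists>D' k'. is_diagram D' \<and> isotopic D D' \<and> point_coloring p D' k' \<and>
    card (k' ` cut_diagram D') = Suc (card (k ` cut_diagram D))"
proof -
  note B = generic_dataD(1-3)[OF gen] and Dirs = generic_dataD(4,6,5)[OF gen]
  let ?C = "k ` cut_diagram D"
  define f where "f z = (2 * k x - k z) mod int p" for z
  have fiber: "z = z'" if "z' \<in> D" "z' \<notin> B" "z \<in> D" "plane_proj z = plane_proj z'" for z z'
    using single_fiber[of D B z' z] B(3) that by blast
  obtain d where d: "straight_at D x d" using Dirs(2) x by blast
  \<comment> \<open>The directions that the finger has to avoid: its own strand, all strands, and the bad points as seen from \<open>x\<close>.\<close>
  define V where "V = insert d Dirs \<union> (\<lambda>q. q - x) ` B"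
  have V: "plane_proj v \<noteq> 0" if "v \<in> V" for v
  proof -
    have "plane_proj (q - x) \<noteq> 0" if q: "q \<in> B" for q
    proof
      assume "plane_proj (q - x) = 0"
      then have "plane_proj q = plane_proj x" by (simp add: linear_diff[OF plane_proj_linear])
      then have "q = x" using fiber[OF x] q B(2) by blast
      then show False using x q by simp
    qed
    then show "plane_proj v \<noteq> 0" using that Dirs(3) diagram_nonvertical[OF D d] by (auto simp: V_def)
  qed
  have finV: "finite V" using Dirs(1) B(1) by (simp add: V_def)
  have "plane_det (y - x) e \<noteq> 0" using y(3) by (simp add: plane_det_def algebra_simps)
  from eventually_avoids_directions[OF finV V this]
  have "\<forall>\<^sub>F t in at 0. \<forall>v\<in>V. plane_det v (y + t *\<^sub>R e - x) \<noteq> 0" by (simp add: algebra_simps)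
  moreover have "\<forall>\<^sub>F z in at y within cut_diagram D. k y = k z"
    using k y(1) unfolding point_coloring_def by blast
  from eventually_compose_filterlim[OF this straight_at_filterlim_cut[OF D y(2)]]
  have "\<forall>\<^sub>F t in at 0. k y = k (y + t *\<^sub>R e)" .
  moreover have "\<forall>\<^sub>F t in at 0. y + t *\<^sub>R e \<in> cut_diagram D"
    using straight_at_filterlim_cut[OF D y(2)] unfolding filterlim_at by (auto elim: eventually_mono)
  ultimately have "\<forall>\<^sub>F t in at 0. (\<forall>v\<in>V. plane_det v (y + t *\<^sub>R e - x) \<noteq> 0) \<and> k y = k (y + t *\<^sub>R e) \<and> y + t *\<^sub>R e \<in> cut_diagram D"
    by eventually_elim blast
  then obtain t where t: "\<forall>v\<in>V. plane_det v (y + t *\<^sub>R e - x) \<noteq> 0" "k y = k (y + t *\<^sub>R e)" "y + t *\<^sub>R e \<in> cut_diagram D"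
    using eventually_happens'[of "at (0::real)"] by auto
  define w where "w = y + t *\<^sub>R e - x"
  have cw: "plane_det v w \<noteq> 0" if "v \<in> V" for v using t(1) that by (simp add: w_def)
  have dw: "plane_det d w \<noteq> 0" using cw by (simp add: V_def)
  define a where "a z = plane_det z w / plane_det d w" for z
  define b where "b z = plane_det d z / plane_det d w" for z
  have ab: "linear a" "linear b" "\<And>u v. plane_proj u = plane_proj v \<longleftrightarrow> a u = a v \<and> b u = b v"
    "a d = 1" "b d = 0" "a w = 0" "b w = 1"
    unfolding a_def b_def by (rule plane_coordinates[OF dw])+
  have aV: "a v \<noteq> 0" if "v \<in> V" for v using cw[OF that] dw by (simp add: a_def)
  have aB: "a (q - x) \<noteq> 0" if "q \<in> B" for q using aV[of "q - x"] that by (auto simp: V_def)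
  have aD: "a e' \<noteq> 0" if z: "z \<in> D" "a (z - x) = 0" "straight_at D z e'" for z e'
  proof -
    have "z \<notin> B" using aB z by blast
    then obtain e0 where e0: "e0 \<in> Dirs" "straight_at D z e0" using Dirs(2) z by blast
    then obtain c where "c \<noteq> 0" "e' = c *\<^sub>R e0" using straight_at_parallel z(3) by blast
    then show ?thesis using aV[of e0] e0 by (simp add: linear_cmul[OF ab(1)] V_def)
  qed
  define L where "L = {z \<in> D. a (z - x) = 0}"
  have LB: "z \<notin> B" if "z \<in> L" for z using aB that by (auto simp: L_def)
  have "finite L" unfolding L_def
  proof (rule finite_transverse_section[OF diagram_compact[OF D] ab(1)])
    fix z assume z: "z \<in> D" "a (z - x) = 0"
    then have "z \<notin> B" using aB by blast
    then show "\<exists>e. straight_at D z e \<and> a e \<noteq> 0" using Dirs(2)[OF z(1)] aD[OF z] by blast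
  qed
  \<comment> \<open>\<open>L\<close> is what the diagram has over the line of the finger, and \<open>Z\<close> consists of those of its points ahead of \<open>x\<close> that would yield a new color.\<close>
  define Z where "Z = {z \<in> L. 0 \<le> b (z - x) \<and> f z \<notin> ?C}"
  have "y + t *\<^sub>R e \<in> Z"
  proof -
    have "y + t *\<^sub>R e - x = w" by (simp add: w_def)
    then show ?thesis using t ab new by (simp add: Z_def L_def f_def cut_diagram_def)
  qed
  moreover have "finite Z" using \<open>finite L\<close> by (simp add: Z_def)
  ultimately obtain z1 where z1: "z1 \<in> Z" "\<And>z. z \<in> Z \<Longrightarrow> b (z1 - x) \<le> b (z - x)"
    using ex_min_if_finite[of "(\<lambda>z. b (z - x)) ` Z"] by (metis (no_types, lifting) arg_min_if_finite(1) arg_min_least empty_iff)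
  define \<beta>1 where "\<beta>1 = b (z1 - x)"
  have xC: "x \<in> cut_diagram D" using x B(3) by (auto simp: cut_diagram_def)
  have kx: "k x \<in> {0..<int p}" using k xC unfolding point_coloring_def by blast
  have same: "z = z'" if "z \<in> L" "z' \<in> L" "b (z - x) = b (z' - x)" for z z'
  proof -
    have "plane_proj z = plane_proj z'" using that ab(1-3) by (simp add: L_def linear_diff)
    then show ?thesis using fiber[of z' z] that LB by (simp add: L_def)
  qed
  have xL: "x \<in> L" using x by (simp add: L_def linear_0 ab(1))
  have "\<beta>1 \<noteq> 0"
  proof
    assume "\<beta>1 = 0"
    then have "z1 = x" using same[of z1 x] z1(1) xL by (simp add: \<beta>1_def Z_def linear_0 ab(2))
    then have "f z1 = k x" using kx by (simp add: f_def)
    then show False using z1(1) xC by (simp add: Z_def)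
  qed
  then have "0 < \<beta>1" using z1(1) by (simp add: Z_def \<beta>1_def)
  \<comment> \<open>The tip lies beyond \<open>z1\<close> but before the next point of \<open>L\<close>.\<close>
  have "\<forall>\<^sub>F s in at_right \<beta>1. \<forall>z\<in>L. b (z - x) \<le> \<beta>1 \<or> s < b (z - x)"
  proof (intro eventually_ball_finite[OF \<open>finite L\<close>] ballI)
    fix z
    show "\<forall>\<^sub>F s in at_right \<beta>1. b (z - x) \<le> \<beta>1 \<or> s < b (z - x)"
      unfolding eventually_at_right_field by (cases "b (z - x) \<le> \<beta>1") (auto intro: exI[of _ "\<beta>1 + 1"] exI[of _ "b (z - x)"])
  qed
  then have "\<forall>\<^sub>F s in at_right \<beta>1. \<beta>1 < s \<and> (\<forall>z\<in>L. b (z - x) \<le> \<beta>1 \<or> s < b (z - x))"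
    using eventually_at_right_less[of \<beta>1] by eventually_elim blast
  from eventually_happens'[OF trivial_limit_at_right_real this]
  obtain \<beta>2 where \<beta>2: "\<beta>1 < \<beta>2" "\<And>z. z \<in> L \<Longrightarrow> b (z - x) \<le> \<beta>1 \<or> \<beta>2 < b (z - x)" by blast
  define b' where "b' z = b z / \<beta>2" for z
  define wall where "wall = {z. a (z - x) = 0 \<and> 0 \<le> b' (z - x) \<and> b' (z - x) \<le> 1}"
  have pos: "0 < \<beta>2" using \<beta>2 \<open>0 < \<beta>1\<close> by simp
  have Dwall: "z \<in> D \<inter> wall \<longleftrightarrow> z \<in> L \<and> 0 \<le> b (z - x) \<and> b (z - x) \<le> \<beta>1" for z
    using \<beta>2(2)[of z] \<beta>2(1) pos by (auto simp: wall_def L_def b'_def field_simps)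
  have "\<exists>D' k'. is_diagram D' \<and> isotopic D D' \<and> point_coloring p D' k' \<and>
    k' ` cut_diagram D' = k ` cut_diagram D \<union> (\<lambda>z. (2 * k x - k z) mod int p) ` (D \<inter> wall) \<and>
    (\<exists>y\<in>cut_diagram D'. plane_proj y = plane_proj (x + \<beta>2 *\<^sub>R w) \<and> k' y = k x) \<and>
    (\<forall>y\<in>{}. y \<in> D' \<and> k' y = k y \<and> (y \<in> cut_diagram D \<longrightarrow> y \<in> cut_diagram D') \<and>
       (\<forall>e. straight_at D y e \<longrightarrow> straight_at D' y e))"
  proof (rule finger_move[OF D k p ab(1) _ _ x(1) d ab(4)])
    show "linear b'" unfolding b'_def by (rule linearI) (simp_all add: linear_add[OF ab(2)] linear_cmul[OF ab(2)] add_divide_distrib)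
    show "plane_proj u = plane_proj v \<longleftrightarrow> a u = a v \<and> b' u = b' v" for u v
      using ab(3)[of u v] pos by (simp add: b'_def)
    show "b' d = 0" "a (\<beta>2 *\<^sub>R w) = 0" "b' (\<beta>2 *\<^sub>R w) = 1"
      using ab pos by (simp_all add: b'_def linear_cmul)
    show "z = x" if "z \<in> D" "plane_proj z = plane_proj x" for z using fiber[OF x that] .
    show "generic_data D B Dirs" by (rule gen)
    show "wall = {z. a (z - x) = 0 \<and> 0 \<le> b' (z - x) \<and> b' (z - x) \<le> 1}" by (rule wall_def)
    show "B \<inter> wall = {}" using aB by (auto simp: wall_def)
    show "b' (z - x) \<noteq> 1" if "z \<in> D" "a (z - x) = 0" for z
      using \<beta>2(2)[of z] \<beta>2(1) pos that by (auto simp: L_def b'_def field_simps)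
    show "a e' \<noteq> 0" if "z \<in> D" "z \<in> wall" "straight_at D z e'" for z e'
      using aD[OF that(1) _ that(3)] that(2) by (simp add: wall_def)
  qed simp_all
  then obtain D' k' where D': "is_diagram D'" "isotopic D D'" "point_coloring p D' k'"
    "k' ` cut_diagram D' = ?C \<union> f ` (D \<inter> wall)" unfolding f_def by blast
  have "f ` (D \<inter> wall) \<subseteq> insert (f z1) ?C"
  proof
    fix q assume "q \<in> f ` (D \<inter> wall)"
    then obtain z where z: "z \<in> L" "0 \<le> b (z - x)" "b (z - x) \<le> \<beta>1" "q = f z" using Dwall by blast
    show "q \<in> insert (f z1) ?C"
    proof (rule ccontr)
      assume n: "q \<notin> insert (f z1) ?C"
      then have "z \<in> Z" using z by (simp add: Z_def)
      then have "b (z - x) = b (z1 - x)" using z1(2) z(3) by (simp add: \<beta>1_def order_antisym)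
      then have "z = z1" using same z(1) z1(1) by (simp add: Z_def)
      then show False using n z(4) by simp
    qed
  qed
  moreover have "z1 \<in> D \<inter> wall" using z1(1) Dwall[of z1] by (simp add: Z_def \<beta>1_def)
  ultimately have "?C \<union> f ` (D \<inter> wall) = insert (f z1) ?C" by blast
  moreover have "f z1 \<notin> ?C" using z1(1) by (simp add: Z_def)
  moreover have "?C \<subseteq> {0..<int p}" using k unfolding point_coloring_def by blast
  then have "finite ?C" using finite_subset by blast
  ultimately have "card (k' ` cut_diagram D') = Suc (card ?C)" using D'(4) by simp
  then show ?thesis using D' by blast
qed

text \<open>The remaining case: the projection of \<open>x\<close> is on the line of the strand at \<open>y\<close>, as can
  happen for two arcs separated by an under-crossing. A straight finger from \<open>x\<close> cannot reach
  \<open>y\<close> transversely. A finger so short that it covers nothing changes no color, and its tip has the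
  color of \<open>x\<close> and is off the line.\<close>
lemma bend_off_line:
  assumes p: "p > 0" and D: "is_diagram D" and k: "point_coloring p D k"
    and gen: "generic_data D B Dirs"
    and x: "x \<in> D" "x \<notin> B"
    and y: "y \<in> cut_diagram D" "y \<noteq> x" "straight_at D y e" and on_line: "plane_det e (x - y) = 0"
  shows "\<exists>D' k'. is_diagram D' \<and> isotopic D D' \<and> point_coloring p D' k' \<and>
    k' ` cut_diagram D' = k ` cut_diagram D \<and> y \<in> cut_diagram D' \<and> k' y = k y \<and> straight_at D' y e \<and>
    (\<exists>z\<in>cut_diagram D'. k' z = k x \<and> plane_det e (z - y) \<noteq> 0)"
proof -
  note B = generic_dataD(1-3)[OF gen] and Dirs = generic_dataD(4,6,5)[OF gen]
  have fiber: "z = x" if "z \<in> D" "plane_proj z = plane_proj x" for z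
    using single_fiber[of D B x z] B(3) x that by blast
  obtain d where d: "straight_at D x d" using Dirs(2) x by blast
  have yD: "y \<in> D" using y by (simp add: cut_diagram_def)
  \<comment> \<open>The short finger points in a direction \<open>u\<close> that is parallel to neither strand.\<close>
  have "plane_det (axis 1 1) (axis 2 1) \<noteq> 0" by (simp add: plane_det_def axis_def)
  from eventually_avoids_directions[of "{d, e}", OF _ _ this]
  have "\<forall>\<^sub>F t in at 0. \<forall>v\<in>{d, e}. plane_det v (axis 1 1 + t *\<^sub>R axis 2 1) \<noteq> 0"
    using diagram_nonvertical[OF D d] diagram_nonvertical[OF D y(3)] by auto
  then obtain t where t: "\<forall>v\<in>{d, e}. plane_det v (axis 1 1 + t *\<^sub>R axis 2 1) \<noteq> 0"
    using eventually_happens'[of "at (0::real)"] by auto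
  define u :: "real^3" where "u = axis 1 1 + t *\<^sub>R axis 2 1"
  have du: "plane_det d u \<noteq> 0" and eu: "plane_det e u \<noteq> 0" using t by (simp_all add: u_def)
  define a where "a z = plane_det z u / plane_det d u" for z
  define b where "b z = plane_det d z / plane_det d u" for z
  have ab: "linear a" "linear b" "\<And>u v. plane_proj u = plane_proj v \<longleftrightarrow> a u = a v \<and> b u = b v"
    "a d = 1" "b d = 0" "a u = 0" "b u = 1"
    unfolding a_def b_def by (rule plane_coordinates[OF du])+
  have "z = x" if "z \<in> D" "a (z - x) = 0" "b (z - x) = 0" for z
    using fiber[OF that(1)] ab(3)[of z x] that by (simp add: linear_diff ab(1,2))
  from strand_neighborhood[OF diagram_compact[OF D] ab(1,2) d ab(4,5) this]
  obtain \<rho> where \<rho>: "\<rho> > 0" "\<And>z. \<bar>a (z - x)\<bar> < \<rho> \<Longrightarrow> \<bar>b (z - x)\<bar> < \<rho> \<Longrightarrow> z \<in> D \<longleftrightarrow> z = x + a (z - x) *\<^sub>R d"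
    by blast
  define \<eta> where "\<eta> = \<rho> / 2"
  have \<eta>: "0 < \<eta>" "\<eta> < \<rho>" using \<rho> by (simp_all add: \<eta>_def)
  define b' where "b' z = b z / \<eta>" for z
  define wall where "wall = {z. a (z - x) = 0 \<and> 0 \<le> b' (z - x) \<and> b' (z - x) \<le> 1}"
  have only_x: "z = x" if "z \<in> D" "z \<in> wall" for z
    using \<rho>(2)[of z] that \<eta> \<rho>(1) by (simp add: wall_def b'_def field_simps)
  have xw: "x \<in> wall" by (simp add: wall_def b'_def linear_0 ab(1,2))
  have Dw: "D \<inter> wall = {x}" using only_x xw x by blast
  have xC: "x \<in> cut_diagram D" using x B(3) by (auto simp: cut_diagram_def)
  have kx: "k x \<in> {0..<int p}" using k xC unfolding point_coloring_def by blast
  have "\<exists>D' k'. is_diagram D' \<and> isotopic D D' \<and> point_coloring p D' k' \<and>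
    k' ` cut_diagram D' = k ` cut_diagram D \<union> (\<lambda>z. (2 * k x - k z) mod int p) ` (D \<inter> wall) \<and>
    (\<exists>y\<in>cut_diagram D'. plane_proj y = plane_proj (x + \<eta> *\<^sub>R u) \<and> k' y = k x) \<and>
    (\<forall>y\<in>{y}. y \<in> D' \<and> k' y = k y \<and> (y \<in> cut_diagram D \<longrightarrow> y \<in> cut_diagram D') \<and>
       (\<forall>e. straight_at D y e \<longrightarrow> straight_at D' y e))"
  proof (rule finger_move[OF D k p ab(1) _ _ x(1) d ab(4)])
    show "linear b'" unfolding b'_def by (rule linearI) (simp_all add: linear_add[OF ab(2)] linear_cmul[OF ab(2)] add_divide_distrib)
    show "plane_proj u = plane_proj v \<longleftrightarrow> a u = a v \<and> b' u = b' v" for u v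
      using ab(3)[of u v] \<eta> by (simp add: b'_def)
    show "b' d = 0" "a (\<eta> *\<^sub>R u) = 0" "b' (\<eta> *\<^sub>R u) = 1"
      using ab \<eta> by (simp_all add: b'_def linear_cmul)
    show "z = x" if "z \<in> D" "plane_proj z = plane_proj x" for z using fiber[OF that] .
    show "generic_data D B Dirs" by (rule gen)
    show "wall = {z. a (z - x) = 0 \<and> 0 \<le> b' (z - x) \<and> b' (z - x) \<le> 1}" by (rule wall_def)
    show "B \<inter> wall = {}"
    proof (rule equals0I)
      fix z assume "z \<in> B \<inter> wall"
      then show False using only_x[of z] B(2) x(2) by auto
    qed
    show "b' (z - x) \<noteq> 1" if z: "z \<in> D" "a (z - x) = 0" for z
    proof
      assume b1: "b' (z - x) = 1"
      then have "z \<in> wall" using z(2) by (simp add: wall_def)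
      then have "b' (x - x) = 1" using only_x[OF z(1)] b1 by simp
      then show False by (simp add: b'_def linear_0 ab(2))
    qed
    show "a e' \<noteq> 0" if z: "z \<in> D" "z \<in> wall" "straight_at D z e'" for z e'
    proof -
      have "straight_at D x e'" using z(3) unfolding only_x[OF z(1,2)] .
      then obtain c where "c \<noteq> 0" "e' = c *\<^sub>R d" using straight_at_parallel[OF d] by blast
      then show ?thesis by (simp add: linear_cmul ab)
    qed
    show "{y} \<subseteq> D" using yD by simp
    show "{y} \<inter> wall = {}" using only_x[OF yD] y(2) by blast
  qed simp_all
  then obtain D' k' z where D': "is_diagram D'" "isotopic D D'" "point_coloring p D' k'"
    "k' ` cut_diagram D' = k ` cut_diagram D \<union> (\<lambda>z. (2 * k x - k z) mod int p) ` (D \<inter> wall)"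
    "k' y = k y" "y \<in> cut_diagram D'" "straight_at D' y e"
    and z: "z \<in> cut_diagram D'" "plane_proj z = plane_proj (x + \<eta> *\<^sub>R u)" "k' z = k x" using y by blast
  have "k' ` cut_diagram D' = k ` cut_diagram D" using D'(4) kx xC by (simp add: Dw insert_absorb)
  moreover have "plane_det e (z - y) = plane_det e (x - y) + \<eta> * plane_det e u"
    using z(2) unfolding plane_proj_eq_iff by (simp add: plane_det_def algebra_simps)
  then have "plane_det e (z - y) \<noteq> 0" using on_line \<eta> eu by simp
  ultimately show ?thesis using D' z by blast
qed

text \<open>As not all residues occur, some reflection leads out of the set of colors, and a finger realizes it.\<close>
lemma one_more_color:
  assumes p: "prime p" and D: "is_diagram D" and k: "point_coloring p D k"
    and card: "1 < card (k ` cut_diagram D)" "card (k ` cut_diagram D) < p"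
  shows "\<exists>D' k'. is_diagram D' \<and> isotopic D D' \<and> point_coloring p D' k' \<and>
    card (k' ` cut_diagram D') = Suc (card (k ` cut_diagram D))"
proof -
  let ?C = "k ` cut_diagram D"
  have p0: "p > 0" using p prime_gt_0_nat by simp
  have sub: "?C \<subseteq> {0..<int p}" using k unfolding point_coloring_def by blast
  have "?C \<noteq> {0..<int p}" using card(2) by auto
  then obtain s t where st: "s \<in> ?C" "t \<in> ?C" "(2 * s - t) mod int p \<notin> ?C"
    using closed_under_reflection_imp_all[OF p sub card(1)] by blast
  have "s \<noteq> t"
  proof
    assume "s = t"
    then have "(2 * s - t) mod int p = s" using st(1) sub by auto
    then show False using st by simp
  qed
  obtain B Dirs where gen: "generic_data D B Dirs" using diagram_generic[OF D] by blast
  note B = generic_dataD(1-3)[OF gen] and Dirs = generic_dataD(4,6,5)[OF gen]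
  have pick: "\<exists>z. z \<in> cut_diagram D \<and> z \<notin> B \<and> k z = q" if "q \<in> ?C" for q
  proof -
    obtain z where z: "z \<in> cut_diagram D" "k z = q" using \<open>q \<in> ?C\<close> by auto
    show ?thesis using generic_point_of_color[OF D k z(1) B(1) open_UNIV UNIV_I] z(2) by auto
  qed
  obtain x where x: "x \<in> cut_diagram D" "x \<notin> B" "k x = s" using pick[OF st(1)] by blast
  obtain y where y: "y \<in> cut_diagram D" "y \<notin> B" "k y = t" using pick[OF st(2)] by blast
  have xy: "x \<in> D" "y \<in> D" using x y by (simp_all add: cut_diagram_def)
  obtain e where e: "straight_at D y e" using Dirs(2) xy y by blast
  have new: "(2 * k x - k y) mod int p \<notin> ?C" using st x y by simp
  show ?thesis
  proof (cases "plane_det e (x - y) = 0")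
    case False
    show ?thesis
      by (rule finger_towards_point[OF p0 D k gen xy(1) x(2) y(1) e False new])
  next
    case True
    have "y \<noteq> x" using \<open>s \<noteq> t\<close> x y by blast
    from bend_off_line[OF p0 D k gen xy(1) x(2) y(1) this e True]
    obtain D1 k1 z where D1: "is_diagram D1" "isotopic D D1" "point_coloring p D1 k1"
      "k1 ` cut_diagram D1 = ?C" "y \<in> cut_diagram D1" "k1 y = k y" "straight_at D1 y e"
      and z: "z \<in> cut_diagram D1" "k1 z = k x" "plane_det e (z - y) \<noteq> 0" by blast
    obtain B1 Dirs1 where gen1: "generic_data D1 B1 Dirs1" using diagram_generic[OF D1(1)] by blast
    have "open {v. plane_det e (v - y) \<noteq> 0}"
      unfolding plane_det_def by (intro open_Collect_neq continuous_intros)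
    from generic_point_of_color[OF D1(1,3) z(1) generic_dataD(1)[OF gen1] this] z(3)
    obtain x' where x': "x' \<in> cut_diagram D1" "x' \<notin> B1" "plane_det e (x' - y) \<noteq> 0" "k1 x' = k1 z" by blast
    have "x' \<in> D1" using x' by (simp add: cut_diagram_def)
    moreover have "(2 * k1 x' - k1 y) mod int p \<notin> k1 ` cut_diagram D1" using new x' z D1 by simp
    ultimately have "\<exists>D' k'. is_diagram D' \<and> isotopic D1 D' \<and> point_coloring p D' k' \<and>
        card (k' ` cut_diagram D') = Suc (card (k1 ` cut_diagram D1))"
      by (intro finger_towards_point[OF p0 D1(1,3) gen1 _ x'(2) D1(5,7) x'(3)])
    then show ?thesis using isotopic_trans[OF D1(2)] D1(4) by metis
  qed
qed

section \<open>The spectrum has no gaps\<close>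

theorem theorem1p4:
  fixes p :: nat and L :: "(real^3) set"
  assumes "prime p" and "odd p"
    and "is_link L" and "\<not> split_link L"
    and "admits_nontrivial_colorings p L"
  shows "Spec p L = {mincol p L..maxcol p L}"
proof -
  define X where "X = {num_colors D c | D c. diagram_of L D \<and> nontrivial_coloring p D c}"
  have bound: "1 < n \<and> n \<le> p" if "n \<in> X" for n
  proof -
    obtain D c where c: "n = num_colors D c" "nontrivial_coloring p D c" using \<open>n \<in> X\<close> unfolding X_def by blast
    then have "c ` arcs D \<subseteq> {0..<int p}" by (auto simp: nontrivial_coloring_def coloring_def)
    then have "card (c ` arcs D) \<le> p" using card_mono[of "{0..<int p}"] by fastforce
    then show ?thesis using c by (simp add: num_colors_def nontrivial_coloring_def)
  qed
  have Spec_X: "Spec p L = X"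
    using bound unfolding Spec_def X_def by fastforce
  have fin: "finite X" using bound finite_subset[of X "{..p}"] by auto
  have ne: "X \<noteq> {}" using assms(5) unfolding admits_nontrivial_colorings_def X_def by blast
  have up: "Suc n \<in> X" if n: "n \<in> X" "n < p" for n
  proof -
    obtain D c where D: "isotopic L D" "is_diagram D" and c: "coloring p D c" "card (c ` arcs D) = n"
      using n(1) unfolding X_def diagram_of_def nontrivial_coloring_def num_colors_def by blast
    let ?k = "\<lambda>z. c (arc_at D z)"
    have img: "?k ` cut_diagram D = c ` arcs D" by (rule point_coloring_of_coloring(2)[OF D(2) c(1)])
    from one_more_color[OF assms(1) D(2) point_coloring_of_coloring(1)[OF D(2) c(1)]] img c(2) bound[OF n(1)] n(2)
    obtain D' k' where D': "is_diagram D'" "isotopic D D'" "point_coloring p D' k'"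
      "card (k' ` cut_diagram D') = Suc n" by auto
    obtain c' where c': "coloring p D' c'" "c' ` arcs D' = k' ` cut_diagram D'"
      using coloring_of_point_coloring[OF D'(1,3)] by blast
    have "diagram_of L D'" using D' isotopic_trans[OF D(1)] by (simp add: diagram_of_def)
    moreover have "num_colors D' c' = Suc n" using c' D' by (simp add: num_colors_def)
    moreover from this have "nontrivial_coloring p D' c'" using c' bound[OF n(1)] by (simp add: nontrivial_coloring_def)
    ultimately show ?thesis unfolding X_def by (intro CollectI exI[of _ D'] exI[of _ c']) simp
  qed
  have "n \<in> X" if "Min X \<le> n" "n \<le> Max X" for n
    using that
  proof (induction n rule: dec_induct)
    case base
    show ?case using Min_in[OF fin ne] .
  next
    case (step n)
    have "Max X \<le> p" using bound Max_in[OF fin ne] by blast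
    then show ?case using step up[of n] by simp
  qed
  then have "{Min X..Max X} \<subseteq> X" by (auto simp only: atLeastAtMost_iff)
  moreover have "X \<subseteq> {Min X..Max X}"
  proof
    fix n assume "n \<in> X"
    then show "n \<in> {Min X..Max X}" using Min_le[OF fin] Max_ge[OF fin] by simp
  qed
  ultimately have "X = {Min X..Max X}" by (rule equalityI[rotated])
  then show ?thesis unfolding Spec_X mincol_def maxcol_def X_def[symmetric] .
qed

end
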